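(* Let $n\geq 2$ and let $a=a_1+ia_2\in\mathbb{C}^{2n}$ be such that $a_1,a_2\in\mathbb{R}^{2n}$ are linearly independent. Let $\phi:\mathbf{Sp}(n,\mathbb{R})/\mathbf{U}(n)\to\mathbb{C}$ be the complex-valued map defined by $$\phi(x\cdot\mathbf{U}(n))=\operatorname{trace}(aa^txx^t).$$ Then the inverse image $\phi^{-1}(\{0\})$ is a complete minimal submanifold of $\mathbf{Sp}(n,\mathbb{R})/\mathbf{U}(n)$ of codimension two.
   Context: Let $J_n=\begin{pmatrix}0&I_n\\-I_n&0\end{pmatrix}$. The real symplectic group is $\mathbf{Sp}(n,\mathbb{R})=\{x\in\mathbf{GL}_{2n}(\mathbb{R}) : xJ_nx^t=J_n\}$. The unitary group $\mathbf{U}(n)=\{z\in\mathbb{C}^{n\times n}: zz^*=I_n\}$ is embedded in $\mathbf{Sp}(n,\mathbb{R})$ as a maximal compact subgroup by $z=x+iy\mapsto\begin{pmatrix}x&y\\-y&x\end{pmatrix}$ with $x,y$ real. Vectors are column vectors and $a^t$ is the transpose (no conjugation). Metric: $\mathbf{GL}_{2n}(\mathbb{C})$ carries the left-invariant Riemannian metric induced by the inner product $g(Z,W)=\operatorname{Re}\operatorname{trace}(ZW^* )$ on its Lie algebra $\mathbb{C}^{2n\times 2n}$, where $W^*$ is the conjugate transpose. $\mathbf{Sp}(n,\mathbb{R})$ carries the induced left-invariant metric, and $\mathbf{Sp}(n,\mathbb{R})/\mathbf{U}(n)$ carries the Riemannian metric for which the natural projection $\mathbf{Sp}(n,\mathbb{R})\to\mathbf{Sp}(n,\mathbb{R})/\mathbf{U}(n)$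 is a Riemannian submersion; it is a non-compact Riemannian symmetric space. *)

theory Defs
  imports "HOL-Analysis.Analysis"
begin

section \<open>Smooth maps between Euclidean spaces\<close>

primrec Ck_on :: "nat \<Rightarrow> ('a::euclidean_space \<Rightarrow> 'b::real_normed_vector) \<Rightarrow> 'a set \<Rightarrow> bool" where
  "Ck_on 0 f S \<longleftrightarrow> continuous_on S f"
| "Ck_on (Suc k) f S \<longleftrightarrow>
     (\<forall>x\<in>S. f differentiable (at x)) \<and> (\<forall>v. Ck_on k (\<lambda>x. frechet_derivative f (at x) v) S)"

text \<open>Only used for open \<open>S\<close>.\<close>

definition smooth_on :: "'a set \<Rightarrow> ('a::euclidean_space \<Rightarrow> 'b::real_normed_vector) \<Rightarrow> bool" where
  "smooth_on S f \<longleftrightarrow> (\<forall>k. Ck_on k f S)"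


section \<open>Riemannian manifolds and their minimal submanifolds\<close>

text \<open>
  A chart is a pair \<open>(U, \<phi>)\<close>.  The atlas is meant to be the maximal one.  In the chart
  \<open>(U, \<phi>)\<close> the Riemannian metric is given at \<open>y \<in> \<phi> ` U\<close>, on coordinate vectors \<open>v\<close>, \<open>w\<close>,
  by \<open>metric M (U, \<phi>) y v w\<close>.
\<close>

type_synonym ('p, 'e) chart = "'p set \<times> ('p \<Rightarrow> 'e)"

record ('p, 'e) riemannian =
  mtop :: "'p topology"
  atlas :: "('p, 'e) chart set"
  metric :: "('p, 'e) chart \<Rightarrow> 'e \<Rightarrow> 'e \<Rightarrow> 'e \<Rightarrow> real"

subsection \<open>Embedded submanifolds\<close>

text \<open>
  The submanifold property is expressed by slice charts.  A submanifold is required to be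
  nonempty, since otherwise its codimension would be meaningless.
\<close>

definition slice_chart ::
  "('p, 'e::euclidean_space) riemannian \<Rightarrow> 'p set \<Rightarrow> ('p, 'e) chart \<Rightarrow> 'e set \<Rightarrow> bool" where
  "slice_chart M N c L \<longleftrightarrow>
     c \<in> atlas M \<and> subspace L \<and> snd c ` (fst c \<inter> N) = snd c ` fst c \<inter> L"

definition submanifold_of_codim ::
  "('p, 'e::euclidean_space) riemannian \<Rightarrow> 'p set \<Rightarrow> nat \<Rightarrow> bool" where
  "submanifold_of_codim M N k \<longleftrightarrow>
     N \<noteq> {} \<and> N \<subseteq> topspace (mtop M) \<and>
     (\<forall>p\<in>N. \<exists>c L. slice_chart M N c L \<and> p \<in> fst c \<and> dim L + k = DIM('e))"

subsection \<open>Levi-Civita connection and mean curvature\<close>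

text \<open>
  In this subsection \<open>g y\<close> is an inner product on the model space, depending on \<open>y\<close>: the
  metric in a chart.
  \<open>christoffel g y v w\<close> is the vector \<open>\<Sum> \<Gamma>\<^sup>k\<^sub>i\<^sub>j v\<^sub>i w\<^sub>j e\<^sub>k\<close>, given by the Koszul formula for
  constant vector fields.
\<close>

definition christoffel ::
  "('e \<Rightarrow> 'e \<Rightarrow> 'e \<Rightarrow> real) \<Rightarrow> 'e \<Rightarrow> 'e \<Rightarrow> 'e \<Rightarrow> 'e::euclidean_space" where
  "christoffel g y v w = (THE u. \<forall>z. g y u z =
     (frechet_derivative (\<lambda>y'. g y' w z) (at y) v
      + frechet_derivative (\<lambda>y'. g y' v z) (at y) w
      - frechet_derivative (\<lambda>y'. g y' v w) (at y) z) / 2)"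

definition cov_deriv ::
  "('e \<Rightarrow> 'e \<Rightarrow> 'e \<Rightarrow> real) \<Rightarrow> 'e \<Rightarrow> 'e \<Rightarrow> ('e \<Rightarrow> 'e) \<Rightarrow> 'e::euclidean_space" where
  "cov_deriv g y v Y = frechet_derivative Y (at y) v + christoffel g y v (Y y)"

definition normal_part ::
  "('e \<Rightarrow> 'e \<Rightarrow> 'e \<Rightarrow> real) \<Rightarrow> 'e set \<Rightarrow> 'e \<Rightarrow> 'e \<Rightarrow> 'e::euclidean_space" where
  "normal_part g L y w = (THE u. w - u \<in> L \<and> (\<forall>v\<in>L. g y u v = 0))"

text \<open>
  In a slice chart the tangent spaces of the submanifold are all equal to \<open>L\<close>, and the constant
  vector field \<open>w \<in> L\<close> is tangent to the submanifold, so it may be used as the extension of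
  the tangent vector \<open>w\<close> in the second fundamental form.
\<close>

definition second_fundamental_form ::
  "('e \<Rightarrow> 'e \<Rightarrow> 'e \<Rightarrow> real) \<Rightarrow> 'e set \<Rightarrow> 'e \<Rightarrow> 'e \<Rightarrow> 'e \<Rightarrow> 'e::euclidean_space" where
  "second_fundamental_form g L y v w = normal_part g L y (cov_deriv g y v (\<lambda>_. w))"

definition orthonormal_basis ::
  "('e \<Rightarrow> 'e \<Rightarrow> 'e \<Rightarrow> real) \<Rightarrow> 'e set \<Rightarrow> 'e \<Rightarrow> 'e::euclidean_space set \<Rightarrow> bool" where
  "orthonormal_basis g L y B \<longleftrightarrow>
     finite B \<and> span B = L \<and> (\<forall>u\<in>B. \<forall>v\<in>B. g y u v = (if u = v then 1 else 0))"

text \<open>The trace of the second fundamental form, not divided by the dimension.\<close>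

definition mean_curvature ::
  "('e \<Rightarrow> 'e \<Rightarrow> 'e \<Rightarrow> real) \<Rightarrow> 'e set \<Rightarrow> 'e \<Rightarrow> 'e::euclidean_space" where
  "mean_curvature g L y =
     (\<Sum>e \<in> (SOME B. orthonormal_basis g L y B). second_fundamental_form g L y e e)"

definition minimal_in :: "('p, 'e::euclidean_space) riemannian \<Rightarrow> 'p set \<Rightarrow> bool" where
  "minimal_in M N \<longleftrightarrow>
     (\<forall>c L. slice_chart M N c L \<longrightarrow>
        (\<forall>p \<in> fst c \<inter> N. mean_curvature (metric M c) L (snd c p) = 0))"

subsection \<open>Completeness of the induced metric\<close>

definition piecewise_C1_curve ::
  "('p, 'e::euclidean_space) riemannian \<Rightarrow> 'p set \<Rightarrow> (real \<Rightarrow> 'p) \<Rightarrow> bool" where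
  "piecewise_C1_curve M N \<gamma> \<longleftrightarrow>
     continuous_map (top_of_set {0..1}) (mtop M) \<gamma> \<and> \<gamma> ` {0..1} \<subseteq> N \<and>
     (\<forall>c \<in> atlas M. \<forall>s t. 0 \<le> s \<and> s \<le> t \<and> t \<le> 1 \<and> \<gamma> ` {s..t} \<subseteq> fst c \<longrightarrow>
        (snd c \<circ> \<gamma>) piecewise_C1_differentiable_on {s..t})"

text \<open>
  The speed does not depend on the chart around \<open>\<gamma> t\<close>.  At the finitely many \<open>t\<close> where
  \<open>\<gamma>\<close> is not differentiable its value is irrelevant.  The length of a curve may be infinite,
  because the one-sided derivatives need not exist at the break points.
\<close>

definition curve_speed ::
  "('p, 'e::euclidean_space) riemannian \<Rightarrow> (real \<Rightarrow> 'p) \<Rightarrow> real \<Rightarrow> real" where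
  "curve_speed M \<gamma> t =
     (let c = (SOME c. c \<in> atlas M \<and> \<gamma> t \<in> fst c);
          v = vector_derivative (snd c \<circ> \<gamma>) (at t)
      in sqrt (metric M c (snd c (\<gamma> t)) v v))"

definition curve_length ::
  "('p, 'e::euclidean_space) riemannian \<Rightarrow> (real \<Rightarrow> 'p) \<Rightarrow> ennreal" where
  "curve_length M \<gamma> = (\<integral>\<^sup>+ t \<in> {0..1}. ennreal (curve_speed M \<gamma> t) \<partial>lborel)"

text \<open>The Riemannian distance of \<open>N\<close> with the induced metric (infinite between different components).\<close>

definition induced_dist ::
  "('p, 'e::euclidean_space) riemannian \<Rightarrow> 'p set \<Rightarrow> 'p \<Rightarrow> 'p \<Rightarrow> ennreal" where
  "induced_dist M N p q =
     (INF \<gamma> \<in> {\<gamma>. piecewise_C1_curve M N \<gamma> \<and> \<gamma> 0 = p \<and> \<gamma> 1 = q}. curve_length M \<gamma>)"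

definition complete_in :: "('p, 'e::euclidean_space) riemannian \<Rightarrow> 'p set \<Rightarrow> bool" where
  "complete_in M N \<longleftrightarrow>
     (\<forall>s. range s \<subseteq> N \<and>
          (\<forall>\<epsilon>>0. \<exists>K. \<forall>i\<ge>K. \<forall>j\<ge>K. induced_dist M N (s i) (s j) < ennreal \<epsilon>) \<longrightarrow>
          (\<exists>p\<in>N. (\<lambda>i::nat. induced_dist M N (s i) p) \<longlonglongrightarrow> 0))"

definition complete_minimal_submanifold ::
  "('p, 'e::euclidean_space) riemannian \<Rightarrow> 'p set \<Rightarrow> nat \<Rightarrow> bool" where
  "complete_minimal_submanifold M N k \<longleftrightarrow>
     submanifold_of_codim M N k \<and> minimal_in M N \<and> complete_in M N"


section \<open>Left-invariant metrics and coset spaces of matrix groups\<close>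

definition cmat :: "real^'m^'k \<Rightarrow> complex^'m^'k" where
  "cmat A = (\<chi> i j. complex_of_real (A $ i $ j))"

definition conj_transpose :: "complex^'m^'k \<Rightarrow> complex^'k^'m" where
  "conj_transpose A = (\<chi> i j. cnj (A $ j $ i))"

text \<open>The left-invariant metric of the complex general linear group at the point \<open>z\<close>.\<close>

definition GL_metric :: "complex^'m^'m \<Rightarrow> complex^'m^'m \<Rightarrow> complex^'m^'m \<Rightarrow> real" where
  "GL_metric z Z W = Re (trace ((matrix_inv z ** Z) ** conj_transpose (matrix_inv z ** W)))"

text \<open>
  In the following, \<open>G\<close> is a closed subgroup of the real general linear group and \<open>K\<close> is a
  compact subgroup of \<open>G\<close>.
\<close>

definition coset :: "(real^'m^'m) set \<Rightarrow> real^'m^'m \<Rightarrow> (real^'m^'m) set" where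
  "coset K x = (\<lambda>k. x ** k) ` K"

definition quotient_topology ::
  "(real^'m^'m) set \<Rightarrow> (real^'m^'m) set \<Rightarrow> (real^'m^'m) set topology" where
  "quotient_topology G K = topology (\<lambda>W.
     W \<subseteq> coset K ` G \<and> openin (top_of_set G) {x \<in> G. coset K x \<in> W})"

lemma istopology_quotient:
  "istopology (\<lambda>W. W \<subseteq> coset K ` G \<and> openin (top_of_set G) {x \<in> G. coset K x \<in> W})"
proof -
  have 1: "{x \<in> G. coset K x \<in> S \<inter> T} = {x \<in> G. coset K x \<in> S} \<inter> {x \<in> G. coset K x \<in> T}"
    for S T by auto
  have 2: "{x \<in> G. coset K x \<in> \<Union>\<K>} = \<Union>((\<lambda>S. {x \<in> G. coset K x \<in> S}) ` \<K>)" for \<K>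
    by auto
  show ?thesis
    unfolding istopology_def 1 2 by (auto intro!: openin_Union)
qed

lemma openin_quotient_topology:
  "openin (quotient_topology G K) W \<longleftrightarrow>
     W \<subseteq> coset K ` G \<and> openin (top_of_set G) {x \<in> G. coset K x \<in> W}"
  by (simp add: quotient_topology_def topology_inverse'[OF istopology_quotient])

lemma topspace_quotient_topology: "topspace (quotient_topology G K) = coset K ` G"
proof -
  have "{x \<in> G. coset K x \<in> coset K ` G} = G" by auto
  then have "openin (quotient_topology G K) (coset K ` G)"
    by (simp add: openin_quotient_topology)
  then show ?thesis
    unfolding topspace_def by (auto simp: openin_quotient_topology)
qed

text \<open>
  The smooth structure of \<open>G/K\<close> is the one for which the projection is a smooth submersion.
  Its charts are the injective maps \<open>\<phi>\<close> from open sets onto open sets for which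
  \<open>\<phi> \<circ> coset K\<close> is smooth (that is, it extends locally to a smooth function on the matrix
  space) and for which the inverse of \<open>\<phi>\<close> lifts locally to smooth maps \<open>\<sigma>\<close> into \<open>G\<close>.
\<close>

definition quotient_atlas ::
  "(real^'m^'m) set \<Rightarrow> (real^'m^'m) set \<Rightarrow> ((real^'m^'m) set, 'e::euclidean_space) chart set" where
  "quotient_atlas G K = {(U, \<phi>).
     openin (quotient_topology G K) U \<and> inj_on \<phi> U \<and> open (\<phi> ` U) \<and>
     (\<forall>x\<in>G. coset K x \<in> U \<longrightarrow>
        (\<exists>V F. open V \<and> x \<in> V \<and> smooth_on V F \<and>
           (\<forall>x' \<in> V \<inter> G. coset K x' \<in> U \<longrightarrow> F x' = \<phi> (coset K x')))) \<and>
     (\<forall>y \<in> \<phi> ` U. \<exists>W \<sigma>. open W \<and> y \<in> W \<and> W \<subseteq> \<phi> ` U \<and> smooth_on W \<sigma> \<and>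
        (\<forall>z\<in>W. \<sigma> z \<in> G \<and> coset K (\<sigma> z) \<in> U \<and> \<phi> (coset K (\<sigma> z)) = z))}"

text \<open>Tangent vectors are velocities of curves; this is used for the submanifolds \<open>G\<close> and \<open>xK\<close>.\<close>

definition curve_with_velocity ::
  "'v set \<Rightarrow> (real \<Rightarrow> 'v) \<Rightarrow> 'v \<Rightarrow> 'v::real_normed_vector \<Rightarrow> bool" where
  "curve_with_velocity S \<gamma> x X \<longleftrightarrow>
     \<gamma> 0 = x \<and> (\<forall>t. \<gamma> t \<in> S) \<and> (\<gamma> has_vector_derivative X) (at 0)"

definition tangent_space :: "'v set \<Rightarrow> 'v \<Rightarrow> 'v::real_normed_vector set" where
  "tangent_space S x = {X. \<exists>\<gamma>. curve_with_velocity S \<gamma> x X}"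

definition horizontal_space ::
  "(real^'m^'m) set \<Rightarrow> (real^'m^'m) set \<Rightarrow> real^'m^'m \<Rightarrow> (real^'m^'m) set" where
  "horizontal_space G K x = {X \<in> tangent_space G x.
     \<forall>Y \<in> tangent_space (coset K x) x. GL_metric (cmat x) (cmat X) (cmat Y) = 0}"

text \<open>
  \<open>X\<close> is the horizontal lift to \<open>x\<close> of the tangent vector of \<open>G/K\<close> at \<open>coset K x\<close> whose
  coordinate vector in the chart \<open>c\<close> is \<open>v\<close>.
\<close>

definition horizontal_lift ::
  "(real^'m^'m) set \<Rightarrow> (real^'m^'m) set \<Rightarrow> ((real^'m^'m) set, 'e::euclidean_space) chart \<Rightarrow>
   real^'m^'m \<Rightarrow> 'e \<Rightarrow> real^'m^'m \<Rightarrow> bool" where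
  "horizontal_lift G K c x v X \<longleftrightarrow>
     X \<in> horizontal_space G K x \<and>
     (\<exists>\<gamma>. curve_with_velocity G \<gamma> x X \<and>
          ((\<lambda>t. snd c (coset K (\<gamma> t))) has_vector_derivative v) (at 0))"

text \<open>
  The metric of \<open>G/K\<close> making the projection a Riemannian submersion: the inner product of two
  tangent vectors is the one of their horizontal lifts to any point \<open>x\<close> of the fibre.
\<close>

definition submersion_metric ::
  "(real^'m^'m) set \<Rightarrow> (real^'m^'m) set \<Rightarrow> ((real^'m^'m) set, 'e::euclidean_space) chart \<Rightarrow>
   'e \<Rightarrow> 'e \<Rightarrow> 'e \<Rightarrow> real" where
  "submersion_metric G K c y v w = (THE r. \<exists>x X Y.
     x \<in> G \<and> coset K x \<in> fst c \<and> snd c (coset K x) = y \<and>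
     horizontal_lift G K c x v X \<and> horizontal_lift G K c x w Y \<and>
     r = GL_metric (cmat x) (cmat X) (cmat Y))"

definition coset_space ::
  "(real^'m^'m) set \<Rightarrow> (real^'m^'m) set \<Rightarrow> ((real^'m^'m) set, 'e::euclidean_space) riemannian" where
  "coset_space G K =
     \<lparr>mtop = quotient_topology G K, atlas = quotient_atlas G K, metric = submersion_metric G K\<rparr>"


section \<open>The space Sp(n,R)/U(n)\<close>

text \<open>Matrices of size \<open>2n\<close> are indexed by \<open>'n + 'n\<close>, where \<open>n = CARD('n)\<close>.\<close>

definition block :: "'a^'n^'n \<Rightarrow> 'a^'n^'n \<Rightarrow> 'a^'n^'n \<Rightarrow> 'a^'n^'n \<Rightarrow> 'a^('n::finite + 'n)^('n + 'n)" where
  "block A B C D = (\<chi> i j.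
     case i of
       Inl p \<Rightarrow> (case j of Inl q \<Rightarrow> A $ p $ q | Inr q \<Rightarrow> B $ p $ q)
     | Inr p \<Rightarrow> (case j of Inl q \<Rightarrow> C $ p $ q | Inr q \<Rightarrow> D $ p $ q))"

definition symplectic_J :: "real^('n::finite + 'n)^('n + 'n)" where
  "symplectic_J = block 0 (mat 1) (- mat 1) 0"

definition Sp_group :: "(real^('n::finite + 'n)^('n + 'n)) set" where
  "Sp_group = {x. invertible x \<and> x ** symplectic_J ** transpose x = symplectic_J}"

definition unitary_group :: "(complex^'n^'n) set" where
  "unitary_group = {z. z ** conj_transpose z = mat 1}"

definition real_form :: "complex^'n^'n \<Rightarrow> real^('n::finite + 'n)^('n + 'n)" where
  "real_form z =
     (let x = (\<chi> i j. Re (z $ i $ j)); y = (\<chi> i j. Im (z $ i $ j)) in block x y (- y) x)"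

definition U_group :: "(real^('n::finite + 'n)^('n + 'n)) set" where
  "U_group = real_form ` unitary_group"

text \<open>
  The model space has dimension \<open>n(n + 1) = (2n\<^sup>2 + n) - n\<^sup>2\<close>, where \<open>n = CARD('n)\<close>, which is
  the dimension of \<open>Sp(n,R)/U(n)\<close>.
\<close>

definition Sp_mod_U ::
  "((real^('n::finite + 'n)^('n + 'n)) set, real^('n \<times> 'n option)) riemannian" where
  "Sp_mod_U = coset_space Sp_group U_group"

definition outer :: "complex^'m \<Rightarrow> complex^'m^'m" where
  "outer a = (\<chi> i j. a $ i * a $ j)"

text \<open>The value on a coset is defined through its representatives, see \<open>phi_coset\<close> below.\<close>

definition phi :: "complex^('n::finite + 'n) \<Rightarrow> (real^('n + 'n)^('n + 'n)) set \<Rightarrow> complex" where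
  "phi a C = (THE z. \<forall>x\<in>C. z = trace (outer a ** cmat x ** transpose (cmat x)))"

lemma cmat_mult: "cmat (A ** B) = cmat A ** cmat B"
  by (simp add: cmat_def matrix_matrix_mult_def vec_eq_iff)

lemma cmat_transpose: "cmat (transpose A) = transpose (cmat A)"
  by (simp add: cmat_def transpose_def vec_eq_iff)

lemma conj_transpose_mat_1: "conj_transpose (mat 1) = mat 1"
  by (auto simp: conj_transpose_def mat_def vec_eq_iff)

lemma GL_metric_mat_1: "GL_metric (mat 1) Z W = Re (trace (Z ** conj_transpose W))"
proof -
  have "matrix_inv (mat 1 :: complex^'a^'a) = mat 1"
    using someI_ex[of "\<lambda>A'. (mat 1 :: complex^'a^'a) ** A' = mat 1 \<and> A' ** mat 1 = mat 1"]
    by (auto simp: matrix_inv_def)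
  then show ?thesis
    by (simp add: GL_metric_def)
qed

lemma real_form_orthogonal:
  assumes "z \<in> unitary_group"
  shows "real_form z ** transpose (real_form z) = mat 1"
proof -
  have z: "(\<Sum>k\<in>UNIV. z $ i $ k * cnj (z $ j $ k)) = (if i = j then 1 else 0)" for i j
    using assms
    by (simp add: unitary_group_def matrix_matrix_mult_def conj_transpose_def mat_def vec_eq_iff)
  have re: "(\<Sum>k\<in>UNIV. Re (z $ i $ k) * Re (z $ j $ k)) +
      (\<Sum>k\<in>UNIV. Im (z $ i $ k) * Im (z $ j $ k)) = (if i = j then 1 else 0)" for i j
    using arg_cong[OF z[of i j], of Re] by (simp add: sum.distrib split: if_splits)
  have re': "(\<Sum>k\<in>UNIV. Im (z $ i $ k) * Im (z $ j $ k)) +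
      (\<Sum>k\<in>UNIV. Re (z $ i $ k) * Re (z $ j $ k)) = (if i = j then 1 else 0)" for i j
    using re[of i j] by (simp add: add.commute)
  have im: "(\<Sum>k\<in>UNIV. Im (z $ i $ k) * Re (z $ j $ k)) =
      (\<Sum>k\<in>UNIV. Re (z $ i $ k) * Im (z $ j $ k))" for i j
    using arg_cong[OF z[of i j], of Im] by (simp add: sum_subtractf split: if_splits)
  have sum_Plus: "(\<Sum>k\<in>UNIV. f k) = (\<Sum>k\<in>UNIV. f (Inl k)) + (\<Sum>k\<in>UNIV. f (Inr k))"
    for f :: "'a + 'a \<Rightarrow> real"
    by (simp add: UNIV_Plus_UNIV[symmetric] sum.Plus del: UNIV_Plus_UNIV)
  have "(\<Sum>k\<in>UNIV. real_form z $ i $ k * real_form z $ j $ k) = (if i = j then 1 else 0)"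
    for i j
    by (cases i; cases j)
      (simp_all add: sum_Plus real_form_def block_def Let_def re re' im sum_negf split del: if_split)
  then show ?thesis
    by (simp add: vec_eq_iff matrix_matrix_mult_def transpose_def mat_def)
qed

lemma phi_coset:
  "phi a (coset U_group x) = trace (outer a ** cmat x ** transpose (cmat x))"
proof -
  have eq: "(x ** k) ** transpose (x ** k) = x ** transpose x" if "k \<in> U_group" for k
  proof -
    have "k ** transpose k = mat 1"
      using that real_form_orthogonal by (auto simp: U_group_def)
    then show ?thesis
      by (metis matrix_mul_assoc matrix_mul_lid matrix_transpose_mul)
  qed
  have "real_form (mat 1) \<in> U_group"
    by (simp add: U_group_def unitary_group_def conj_transpose_mat_1)
  moreover have "trace (outer a ** cmat y ** transpose (cmat y)) =
      trace (outer a ** cmat x ** transpose (cmat x))" if "y \<in> coset U_group x" for y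
    using that eq
    by (auto simp: coset_def matrix_mul_assoc[symmetric] simp flip: cmat_mult cmat_transpose)
  ultimately show ?thesis
    unfolding phi_def by (intro the_equality) (auto simp: coset_def)
qed

end

theory Submission
  imports Defs
begin

text \<open>
  A coset \<open>x U(n)\<close> is determined by \<open>S = x x\<^sup>t\<close>, so \<open>Sp(n,R)/U(n)\<close> is the space of symplectic positive
  definite matrices, and the function is \<open>a\<^sup>t S a\<close>.  Since \<open>S\<^sup>-\<^sup>1 = - J S J\<close>, the submersion metric is the
  pullback under \<open>S\<close> of the constant bilinear form \<open>tr (J A J C) / 4\<close>; hence, as for a submanifold of a flat
  space, the Christoffel term is the tangential part of the second derivative of \<open>S\<close>.  This gives the Hessian
  of \<open>a\<^sup>t S a\<close>, which is \<open>4 w\<^sup>t X\<^sup>2 w\<close> in the direction of the symmetric element \<open>X\<close> of the Lie algebra at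
  \<open>x\<close>, where \<open>w = x\<^sup>t a\<close>.

  On the zero set \<open>w\<^sup>t w = 0\<close>.  The complex gradient is a multiple of the projection \<open>P\<close> of \<open>w w\<^sup>t\<close> to the
  symmetric part of the Lie algebra.  The real and imaginary parts of \<open>P\<close> are nonzero, orthogonal and of equal
  norm, so that \<open>0\<close> is a regular value, and \<open>P w = 0\<close>, so that the trace of the Hessian over the tangent space
  of the zero set vanishes.

  For completeness, each \<open>ln (b\<^sup>t S b)\<close> is Lipschitz with constant \<open>2\<close>; a Cauchy sequence therefore has a limit
  in the ambient space, and near this limit the induced distance is controlled by segments in a slice chart.
\<close>

section \<open>Calculus of smooth maps\<close>

text \<open>Minimality is demanded in every slice chart of a maximal atlas, so neither the chart nor
  its linear space \<open>L\<close> can be chosen. Curvature is therefore computed in an arbitrary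
  chart, and \<open>L\<close> is recovered afterwards as the kernel of the differentials of the two
  real equations, by comparison with a chart in which these equations are linear. Building such
  charts requires a local inverse that is smooth of all orders. The trace of the Hessian over the
  whole symmetric part of the Lie algebra is a multiple of w^t w, which is zero on the locus; only
  the two normal directions remain, and there the contributions of the real and imaginary parts of P
  are opposite. A submanifold must also be nonempty. The symplectic group carries the pair (a1, a2)
  to any other independent pair with the same value of a1^t J a2, so orthogonal vectors of equal
  nonzero length with this value are enough; n >= 2 supplies two different symplectic planes from
  which to build them.\<close>

lemma Ck_on_SucI:
  assumes "open S" "\<And>x. x \<in> S \<Longrightarrow> (f has_derivative f' x) (at x)"
    and "\<And>v. Ck_on k (\<lambda>x. f' x v) S"
    and cong: "\<And>f g :: 'a::euclidean_space \<Rightarrow> 'b::real_normed_vector.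
      (\<And>x. x \<in> S \<Longrightarrow> f x = g x) \<Longrightarrow> Ck_on k f S \<Longrightarrow> Ck_on k g S"
  shows "Ck_on (Suc k) (f :: 'a \<Rightarrow> 'b) S"
proof -
  have "f' x = frechet_derivative f (at x)" if "x \<in> S" for x
    using assms(2) that by (simp add: frechet_derivative_at)
  then show ?thesis
    using assms(2,3) cong[of "\<lambda>x. f' x v" "\<lambda>x. frechet_derivative f (at x) v" for v]
    by (auto simp: differentiable_def)
qed

text \<open>\<open>Ck_on_SucI\<close> takes congruence at order k as a premise because congruence is
  itself proved with that rule: what is passed in is the induction hypothesis.\<close>

lemma Ck_on_cong:
  assumes "open S"
  shows "(\<And>x. x \<in> S \<Longrightarrow> f x = g x) \<Longrightarrow> Ck_on k f S \<Longrightarrow> Ck_on k g S"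
proof (induction k arbitrary: f g)
  case 0
  then show ?case using continuous_on_eq by fastforce
next
  case (Suc k)
  have "(g has_derivative frechet_derivative f (at x)) (at x)" if "x \<in> S" for x
  proof -
    have "(f has_derivative frechet_derivative f (at x)) (at x)"
      using Suc.prems(2) that unfolding Ck_on.simps frechet_derivative_works by blast
    then show ?thesis
      by (rule has_derivative_transform_within_open[OF _ assms that Suc.prems(1)])
  qed
  moreover have "Ck_on k (\<lambda>x. frechet_derivative f (at x) v) S" for v
    using Suc.prems(2) by simp
  ultimately show ?case
    by (rule Ck_on_SucI[OF assms _ _ Suc.IH])
qed

lemma Ck_on_SucI':
  assumes "open S" "\<And>x. x \<in> S \<Longrightarrow> (f has_derivative f' x) (at x)"
    and "\<And>v. Ck_on k (\<lambda>x. f' x v) S"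
  shows "Ck_on (Suc k) f S"
  using assms Ck_on_cong[OF assms(1)] by (rule Ck_on_SucI)

lemma Ck_on_Suc_has_derivative:
  "Ck_on (Suc k) f S \<Longrightarrow> x \<in> S \<Longrightarrow> (f has_derivative frechet_derivative f (at x)) (at x)"
  unfolding Ck_on.simps frechet_derivative_works by blast

lemma Ck_on_SucD: "Ck_on (Suc k) f S \<Longrightarrow> Ck_on k f S"
proof (induction k arbitrary: f)
  case 0
  then show ?case
    by (auto intro!: continuous_at_imp_continuous_on differentiable_imp_continuous_within)
next
  case (Suc k)
  then show ?case by (metis Ck_on.simps(2))
qed

lemma Ck_on_continuous: "Ck_on k f S \<Longrightarrow> continuous_on S f"
  by (induction k) (use Ck_on_SucD in auto)

lemma Ck_on_subset: "Ck_on k f S \<Longrightarrow> T \<subseteq> S \<Longrightarrow> Ck_on k f T"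
  by (induction k arbitrary: f) (auto intro: continuous_on_subset)

lemma Ck_on_local:
  "(\<And>x. x \<in> S \<Longrightarrow> \<exists>T. open T \<and> x \<in> T \<and> Ck_on k f T) \<Longrightarrow> Ck_on k f S"
proof (induction k arbitrary: f)
  case 0
  then show ?case
    by (metis Ck_on.simps(1) continuous_at_imp_continuous_on continuous_on_eq_continuous_at)
next
  case (Suc k)
  have "\<exists>T. open T \<and> x \<in> T \<and> Ck_on k (\<lambda>x. frechet_derivative f (at x) v) T" if "x \<in> S" for x v
    using Suc.prems[OF that] by auto
  with Suc show ?case by (fastforce)
qed

lemma Ck_on_const: "Ck_on k (\<lambda>x. c) S"
  by (induction k arbitrary: c) auto

lemma Ck_on_bounded_linear:
  assumes "bounded_linear h"
  shows "Ck_on k f S \<Longrightarrow> open S \<Longrightarrow> Ck_on k (\<lambda>x. h (f x)) S"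
proof (induction k arbitrary: f)
  case 0
  then show ?case
    using assms by (auto intro: bounded_linear.continuous_on)
next
  case (Suc k)
  show ?case
  proof (rule Ck_on_SucI')
    show "((\<lambda>x. h (f x)) has_derivative (\<lambda>v. h (frechet_derivative f (at x) v))) (at x)"
      if "x \<in> S" for x
      using Ck_on_Suc_has_derivative[OF Suc.prems(1) that]
      by (rule bounded_linear.has_derivative[OF assms])
  qed (use Suc in auto)
qed

lemma Ck_on_add:
  "Ck_on k f S \<Longrightarrow> Ck_on k g S \<Longrightarrow> open S \<Longrightarrow> Ck_on k (\<lambda>x. f x + g x) S"
proof (induction k arbitrary: f g)
  case 0
  then show ?case by (auto intro: continuous_intros)
next
  case (Suc k)
  show ?case
  proof (rule Ck_on_SucI')
    show "((\<lambda>x. f x + g x) has_derivative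
        (\<lambda>v. frechet_derivative f (at x) v + frechet_derivative g (at x) v)) (at x)"
      if "x \<in> S" for x
      using Suc.prems that by (intro has_derivative_add Ck_on_Suc_has_derivative)
  qed (use Suc in auto)
qed

lemma Ck_on_bounded_bilinear:
  assumes "bounded_bilinear b"
  shows "Ck_on k f S \<Longrightarrow> Ck_on k g S \<Longrightarrow> open S \<Longrightarrow> Ck_on k (\<lambda>x. b (f x) (g x)) S"
proof (induction k arbitrary: f g)
  case 0
  then show ?case
    using assms by (auto intro: bounded_bilinear.continuous_on)
next
  case (Suc k)
  show ?case
  proof (rule Ck_on_SucI')
    show "((\<lambda>x. b (f x) (g x)) has_derivative
        (\<lambda>v. b (f x) (frechet_derivative g (at x) v) + b (frechet_derivative f (at x) v) (g x))) (at x)"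
      if "x \<in> S" for x
      using Suc.prems that by (intro bounded_bilinear.FDERIV[OF assms] Ck_on_Suc_has_derivative)
    show "Ck_on k (\<lambda>x. b (f x) (frechet_derivative g (at x) v) + b (frechet_derivative f (at x) v) (g x)) S"
      for v
      using Suc.prems Ck_on_SucD[OF Suc.prems(1)] Ck_on_SucD[OF Suc.prems(2)]
      by (intro Ck_on_add Suc.IH) auto
  qed (use Suc in auto)
qed

lemma Ck_on_sum:
  "(\<And>i. i \<in> I \<Longrightarrow> Ck_on k (f i) S) \<Longrightarrow> open S \<Longrightarrow> Ck_on k (\<lambda>x. \<Sum>i\<in>I. f i x) S"
  by (induction I rule: infinite_finite_induct) (auto intro: Ck_on_add Ck_on_const)

lemma Ck_on_compose:
  fixes f :: "'a::euclidean_space \<Rightarrow> 'b::euclidean_space"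
    and g :: "'b \<Rightarrow> 'c::real_normed_vector"
  assumes "open S" "open T" "f ` S \<subseteq> T"
  shows "Ck_on k g T \<Longrightarrow> Ck_on k f S \<Longrightarrow> Ck_on k (\<lambda>x. g (f x)) S"
proof (induction k arbitrary: g)
  case 0
  then show ?case
    using assms continuous_on_compose2[of T g S f] by auto
next
  case (Suc k)
  have der: "((\<lambda>x. g (f x)) has_derivative
      (\<lambda>v. frechet_derivative g (at (f x)) (frechet_derivative f (at x) v))) (at x)"
    if "x \<in> S" for x
    using assms Suc.prems that
    by (intro has_derivative_compose[of f _ x UNIV g] Ck_on_Suc_has_derivative) auto
  show ?case
  proof (rule Ck_on_SucI')
    \<comment> \<open>In the chain rule both the point and the direction of the derivative of
      \<open>g\<close> vary with \<open>x\<close>. Expanding the direction in the basis leaves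
      derivatives in fixed directions \<open>b\<close>, to which the induction hypothesis
      applies.\<close>
    show "((\<lambda>x. g (f x)) has_derivative
      (\<lambda>v. \<Sum>b\<in>Basis. (frechet_derivative f (at x) v \<bullet> b) *\<^sub>R frechet_derivative g (at (f x)) b)) (at x)"
      if "x \<in> S" for x
    proof -
      have lin: "linear (frechet_derivative g (at (f x)))"
        using Suc.prems assms that by (auto intro: linear_frechet_derivative)
      have rep: "frechet_derivative g (at (f x)) w =
          (\<Sum>b\<in>Basis. (w \<bullet> b) *\<^sub>R frechet_derivative g (at (f x)) b)" for w
        by (subst (1) euclidean_representation[symmetric])
          (simp only: linear_sum[OF lin] linear_cmul[OF lin])
      show ?thesis using der[OF that] unfolding rep[of "frechet_derivative f (at x) v" for v] .
    qed
    show "Ck_on k (\<lambda>x. \<Sum>b\<in>Basis. (frechet_derivative f (at x) v \<bullet> b) *\<^sub>R frechet_derivative g (at (f x)) b) S"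
      for v
      using Suc.prems Suc.IH Ck_on_SucD[OF Suc.prems(2)] assms
      by (intro Ck_on_sum Ck_on_bounded_bilinear[OF bounded_bilinear_scaleR]
          Ck_on_bounded_linear[OF bounded_linear_inner_left]
          Suc.IH[where g = "\<lambda>y. frechet_derivative g (at y) b" for b]) auto
  qed (use assms in auto)
qed

lemma Ck_on_inverse:
  fixes f :: "'a::euclidean_space \<Rightarrow> real"
  assumes "open S" "\<And>x. x \<in> S \<Longrightarrow> f x \<noteq> 0"
  shows "Ck_on k f S \<Longrightarrow> Ck_on k (\<lambda>x. inverse (f x)) S"
proof (induction k)
  case 0
  then show ?case using assms by (auto intro: continuous_intros)
next
  case (Suc k)
  show ?case
  proof (rule Ck_on_SucI')
    show "((\<lambda>x. inverse (f x)) has_derivative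
      (\<lambda>v. - 1 * (inverse (f x) * frechet_derivative f (at x) v * inverse (f x)))) (at x)"
      if "x \<in> S" for x
      using Deriv.has_derivative_inverse[OF assms(2)[OF that] Ck_on_Suc_has_derivative[OF Suc.prems that]]
      by simp
    show "Ck_on k (\<lambda>x. - 1 * (inverse (f x) * frechet_derivative f (at x) v * inverse (f x))) S" for v
      using Suc Ck_on_SucD assms
      by (intro Ck_on_bounded_bilinear[OF bounded_bilinear_mult] Ck_on_const) auto
  qed (use assms in auto)
qed

section \<open>Closure properties of maps that are smooth of all orders\<close>

lemma smooth_on_has_derivative:
  "smooth_on S f \<Longrightarrow> x \<in> S \<Longrightarrow> (f has_derivative frechet_derivative f (at x)) (at x)"
  unfolding smooth_on_def using Ck_on_Suc_has_derivative by blast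

lemma smooth_on_frechet_derivative:
  "smooth_on S f \<Longrightarrow> smooth_on S (\<lambda>x. frechet_derivative f (at x) v)"
  unfolding smooth_on_def by (metis Ck_on.simps(2))

lemma smooth_on_continuous: "smooth_on S f \<Longrightarrow> continuous_on S f"
  unfolding smooth_on_def using Ck_on_continuous by blast

lemma smooth_on_subset: "smooth_on S f \<Longrightarrow> T \<subseteq> S \<Longrightarrow> smooth_on T f"
  unfolding smooth_on_def using Ck_on_subset by blast

lemma smooth_on_cong:
  "open S \<Longrightarrow> (\<And>x. x \<in> S \<Longrightarrow> f x = g x) \<Longrightarrow> smooth_on S f \<Longrightarrow> smooth_on S g"
  unfolding smooth_on_def using Ck_on_cong by blast

lemma smooth_on_local:
  "(\<And>x. x \<in> S \<Longrightarrow> \<exists>T. open T \<and> x \<in> T \<and> smooth_on T f) \<Longrightarrow> smooth_on S f"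
  unfolding smooth_on_def by (metis Ck_on_local)

lemma smooth_on_const: "smooth_on S (\<lambda>x. c)"
  unfolding smooth_on_def using Ck_on_const by blast

lemma smooth_on_id: "smooth_on S (\<lambda>x. x)"
proof -
  have "Ck_on k (\<lambda>x. x) S" for k
    by (cases k) (auto intro: Ck_on_const simp: frechet_derivative_ident)
  then show ?thesis by (simp add: smooth_on_def)
qed

lemma smooth_on_bounded_linear:
  "bounded_linear h \<Longrightarrow> smooth_on S f \<Longrightarrow> open S \<Longrightarrow> smooth_on S (\<lambda>x. h (f x))"
  unfolding smooth_on_def using Ck_on_bounded_linear by blast

lemma smooth_on_linear:
  fixes f :: "'a::euclidean_space \<Rightarrow> 'b::euclidean_space"
  shows "linear h \<Longrightarrow> smooth_on S f \<Longrightarrow> open S \<Longrightarrow> smooth_on S (\<lambda>x. h (f x))"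
  using smooth_on_bounded_linear linear_conv_bounded_linear by blast

lemma smooth_on_add:
  "smooth_on S f \<Longrightarrow> smooth_on S g \<Longrightarrow> open S \<Longrightarrow> smooth_on S (\<lambda>x. f x + g x)"
  unfolding smooth_on_def using Ck_on_add by blast

lemma smooth_on_bounded_bilinear:
  "bounded_bilinear b \<Longrightarrow> smooth_on S f \<Longrightarrow> smooth_on S g \<Longrightarrow> open S \<Longrightarrow>
    smooth_on S (\<lambda>x. b (f x) (g x))"
  unfolding smooth_on_def using Ck_on_bounded_bilinear by blast

lemma smooth_on_diff:
  assumes "smooth_on S f" "smooth_on S g" "open S"
  shows "smooth_on S (\<lambda>x. f x - g x)"
  using smooth_on_add[OF assms(1) smooth_on_bounded_linear[OF bounded_linear_minus[OF bounded_linear_ident] assms(2,3)] assms(3)]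
  by simp

lemma smooth_on_scaleR:
  "smooth_on S f \<Longrightarrow> smooth_on S g \<Longrightarrow> open S \<Longrightarrow> smooth_on S (\<lambda>x. f x *\<^sub>R g x)"
  by (rule smooth_on_bounded_bilinear[OF bounded_bilinear_scaleR])

lemma smooth_on_mult:
  fixes f g :: "'a::euclidean_space \<Rightarrow> real"
  shows "smooth_on S f \<Longrightarrow> smooth_on S g \<Longrightarrow> open S \<Longrightarrow> smooth_on S (\<lambda>x. f x * g x)"
  by (rule smooth_on_bounded_bilinear[OF bounded_bilinear_mult])

lemma smooth_on_sum:
  "(\<And>i. i \<in> I \<Longrightarrow> smooth_on S (f i)) \<Longrightarrow> open S \<Longrightarrow> smooth_on S (\<lambda>x. \<Sum>i\<in>I. f i x)"
  by (simp add: smooth_on_def Ck_on_sum)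

lemma smooth_on_prod:
  fixes f :: "'i \<Rightarrow> 'a::euclidean_space \<Rightarrow> real"
  shows "(\<And>i. i \<in> I \<Longrightarrow> smooth_on S (f i)) \<Longrightarrow> open S \<Longrightarrow> smooth_on S (\<lambda>x. \<Prod>i\<in>I. f i x)"
  by (induction I rule: infinite_finite_induct) (auto intro: smooth_on_mult smooth_on_const)

lemma smooth_on_inverse:
  fixes f :: "'a::euclidean_space \<Rightarrow> real"
  shows "smooth_on S f \<Longrightarrow> (\<And>x. x \<in> S \<Longrightarrow> f x \<noteq> 0) \<Longrightarrow> open S \<Longrightarrow> smooth_on S (\<lambda>x. inverse (f x))"
  unfolding smooth_on_def using Ck_on_inverse by blast

lemma smooth_on_compose:
  fixes f :: "'a::euclidean_space \<Rightarrow> 'b::euclidean_space"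
    and g :: "'b \<Rightarrow> 'c::real_normed_vector"
  shows "smooth_on T g \<Longrightarrow> smooth_on S f \<Longrightarrow> f ` S \<subseteq> T \<Longrightarrow> open S \<Longrightarrow> open T \<Longrightarrow>
    smooth_on S (\<lambda>x. g (f x))"
  unfolding smooth_on_def using Ck_on_compose by blast

lemma smooth_on_vec:
  fixes f :: "'a::euclidean_space \<Rightarrow> 'b::euclidean_space ^ 'k"
  assumes "\<And>i. smooth_on S (\<lambda>x. f x $ i)" "open S"
  shows "smooth_on S f"
proof -
  have lin: "linear (\<lambda>b::'b. axis i b)" for i :: 'k
    by (rule linearI) (auto simp: vec_eq_iff axis_def)
  have "smooth_on S (\<lambda>x. \<Sum>i\<in>UNIV. axis i (f x $ i))"
    using assms by (intro smooth_on_sum smooth_on_linear[OF lin])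
  moreover have "(\<Sum>i\<in>UNIV. axis i (f x $ i)) = f x" for x
    unfolding vec_eq_iff sum_component axis_def vec_lambda_beta by simp
  ultimately show ?thesis by simp
qed

lemma smooth_on_vec_nth:
  fixes f :: "'a::euclidean_space \<Rightarrow> 'b::euclidean_space ^ 'k"
  shows "smooth_on S f \<Longrightarrow> open S \<Longrightarrow> smooth_on S (\<lambda>x. f x $ i)"
  by (rule smooth_on_bounded_linear[OF bounded_linear_vec_nth])

lemma smooth_on_det:
  fixes M :: "'a::euclidean_space \<Rightarrow> real^'k^'k"
  assumes "smooth_on S M" "open S"
  shows "smooth_on S (\<lambda>x. det (M x))"
  unfolding det_def using assms
  by (intro smooth_on_sum smooth_on_mult smooth_on_prod smooth_on_vec_nth smooth_on_const)

section \<open>Smoothness of matrix inversion and of local inverses\<close>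

lemma matrix_inv_mult:
  assumes "invertible A"
  shows "A ** matrix_inv A = mat 1" "matrix_inv A ** A = mat 1"
  using assms someI_ex[of "\<lambda>B. A ** B = mat 1 \<and> B ** A = mat 1"]
  unfolding matrix_inv_def invertible_def by blast+

text \<open>Cramer's rule applied to the columns of the identity: the entries of the inverse are
  quotients of determinants, hence smooth functions of the matrix.\<close>

lemma matrix_inv_cramer:
  fixes A :: "real^'k^'k"
  assumes "det A \<noteq> 0"
  shows "matrix_inv A $ i $ j =
    det (\<chi> r c. if c = i then axis j 1 $ r else A $ r $ c) * inverse (det A)"
proof -
  have "A ** matrix_inv A = mat 1"
    using assms by (simp add: invertible_det_nz matrix_inv_mult)
  then have "A *v (matrix_inv A *v axis j 1) = axis j 1"
    by (simp add: matrix_vector_mul_assoc)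
  then have "matrix_inv A *v axis j 1 =
      (\<chi> k. det (\<chi> r c. if c = k then axis j 1 $ r else A $ r $ c) / det A)"
    using cramer[OF assms] by blast
  then show ?thesis
    by (simp add: vec_eq_iff matrix_vector_mult_basis column_def divide_inverse)
qed

lemma smooth_on_matrix_inv:
  fixes M :: "'a::euclidean_space \<Rightarrow> real^'k^'k"
  assumes M: "smooth_on S M" "open S" and det: "\<And>x. x \<in> S \<Longrightarrow> det (M x) \<noteq> 0"
  shows "smooth_on S (\<lambda>x. matrix_inv (M x))"
proof (intro smooth_on_vec \<open>open S\<close>)
  fix i j
  have entry: "smooth_on S (\<lambda>x. if c = i then axis j 1 $ r else M x $ r $ c)" for r c
    using M by (cases "c = i") (auto intro: smooth_on_const smooth_on_vec_nth)
  have "smooth_on S (\<lambda>x. det (\<chi> r c. if c = i then axis j 1 $ r else M x $ r $ c) * inverse (det (M x)))"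
    using M det entry
    by (intro smooth_on_mult smooth_on_inverse smooth_on_det smooth_on_vec)
      (auto intro!: smooth_on_vec_nth)
  then show "smooth_on S (\<lambda>x. matrix_inv (M x) $ i $ j)"
    by (rule smooth_on_cong[OF \<open>open S\<close>, rotated]) (simp add: matrix_inv_cramer det)
qed

lemma bounded_bilinear_matrix_vector_mult:
  "bounded_bilinear ((*v) :: real^'m^'k \<Rightarrow> real^'m \<Rightarrow> real^'k)"
  unfolding bilinear_conv_bounded_bilinear[symmetric] bilinear_def
  by (auto intro!: linearI simp: sum.distrib
      vec_eq_iff matrix_vector_mult_def sum_distrib_left algebra_simps)

lemma bounded_bilinear_matrix_mult:
  "bounded_bilinear ((**) :: real^'m^'k \<Rightarrow> real^'l^'m \<Rightarrow> real^'l^'k)"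
  unfolding bilinear_conv_bounded_bilinear[symmetric] bilinear_def
  by (auto intro!: linearI simp: vec_eq_iff matrix_matrix_mult_def sum_distrib_left
      sum.distrib algebra_simps)

lemma smooth_on_matrix_mult:
  fixes f :: "'a::euclidean_space \<Rightarrow> real^'m^'k" and g :: "'a \<Rightarrow> real^'l^'m"
  shows "smooth_on S f \<Longrightarrow> smooth_on S g \<Longrightarrow> open S \<Longrightarrow> smooth_on S (\<lambda>x. f x ** g x)"
  by (rule smooth_on_bounded_bilinear[OF bounded_bilinear_matrix_mult])

text \<open>The library provides the local inverse as a differentiable map; its derivative at \<open>y\<close> is the
  inverse of the Jacobian matrix of \<open>f\<close> at \<open>g y\<close>, so smoothness follows by induction.\<close>

theorem smooth_inverse_function:
  fixes f :: "real^'k \<Rightarrow> real^'k"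
  assumes U: "open U" "x0 \<in> U" and f: "smooth_on U f"
    and inj: "\<And>v. frechet_derivative f (at x0) v = 0 \<Longrightarrow> v = 0"
  obtains U' V g where "open U'" "U' \<subseteq> U" "x0 \<in> U'" "open V" "f x0 \<in> V"
    "homeomorphism U' V f g" "smooth_on V g"
proof -
  let ?D = "\<lambda>x. frechet_derivative f (at x)"
  have der: "(f has_derivative ?D x) (at x)" if "x \<in> U" for x
    using f that by (rule smooth_on_has_derivative)
  have app: "blinfun_apply (Blinfun (?D x)) = ?D x" if "x \<in> U" for x
    using der[OF that] by (simp add: bounded_linear_Blinfun_apply has_derivative_bounded_linear)
  have "continuous_on U (\<lambda>x. ?D x v)" for v
    using smooth_on_continuous smooth_on_frechet_derivative f by blast
  then have "continuous_on U (\<lambda>x. blinfun_apply (Blinfun (?D x)) v)" for v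
    by (rule continuous_on_eq) (simp add: app)
  then have cont: "continuous_on U (\<lambda>x. Blinfun (?D x))"
    by (intro continuous_on_blinfun_componentwise) auto
  have lin0: "linear (?D x0)"
    using der U(2) has_derivative_linear by blast
  then have "inj (?D x0)"
    using inj by (simp add: linear_injective_0)
  then obtain h where h: "linear h" "h \<circ> ?D x0 = id"
    using linear_injective_left_inverse[OF lin0] by blast
  have derB: "(f has_derivative blinfun_apply (Blinfun (?D x))) (at x)" if "x \<in> U" for x
    using der[OF that] app[OF that] by simp
  \<comment> \<open>Injectivity of the derivative enters here: the inverse function theorem asks for
    a left inverse as a bounded linear operator.\<close>
  have invh: "Blinfun h o\<^sub>L Blinfun (?D x0) = id_blinfun"
    using h app[OF U(2)]
    by (intro blinfun_eqI)
      (auto simp: bounded_linear_Blinfun_apply linear_conv_bounded_linear fun_eq_iff)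
  obtain U' V g g' where *: "open U'" "U' \<subseteq> U" "x0 \<in> U'" "open V" "f x0 \<in> V"
    "homeomorphism U' V f g"
    and g': "\<And>y. y \<in> V \<Longrightarrow> (g has_derivative (g' y)) (at y)"
    and inv: "\<And>y. y \<in> V \<Longrightarrow> g' y = inv (blinfun_apply (Blinfun (?D (g y))))"
    and bij: "\<And>y. y \<in> V \<Longrightarrow> bij (blinfun_apply (Blinfun (?D (g y))))"
    by (rule inverse_function_theorem[OF U(1) derB cont U(2) invh]) (assumption, rule that, assumption+)
  have gU: "g y \<in> U" if "y \<in> V" for y
    using that * by (auto simp: homeomorphism_def)
  have lin: "linear (?D (g y))" if "y \<in> V" for y
    using der gU has_derivative_linear that by blast
  define A where "A x = matrix (?D x)" for x
  have A: "smooth_on U A"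
  proof (intro smooth_on_vec \<open>open U\<close>)
    show "smooth_on U (\<lambda>x. A x $ i $ j)" for i j
      unfolding A_def matrix_def
      by (simp add: smooth_on_vec_nth smooth_on_frechet_derivative f \<open>open U\<close>)
  qed
  have Ainv: "det (A (g y)) \<noteq> 0 \<and> g' y = (*v) (matrix_inv (A (g y)))" if y: "y \<in> V" for y
  proof -
    have b: "bij (?D (g y))" using bij[OF y] app[OF gU[OF y]] by simp
    have AD: "A (g y) *v v = ?D (g y) v" for v
      unfolding A_def using lin[OF y] by (simp add: matrix_works)
    have d: "det (A (g y)) \<noteq> 0"
      using b lin[OF y] unfolding A_def
      by (metis bij_is_inj det_nz_iff_inj)
    have "A (g y) ** matrix_inv (A (g y)) = mat 1"
      using d by (simp add: invertible_det_nz matrix_inv_mult)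
    then have "?D (g y) (matrix_inv (A (g y)) *v v) = v" for v
      by (metis AD matrix_vector_mul_assoc matrix_vector_mul_lid)
    then have "inv (?D (g y)) = (*v) (matrix_inv (A (g y)))"
      using b by (metis bij_inv_eq_iff ext)
    with d show ?thesis using inv[OF y] app[OF gU[OF y]] by simp
  qed
  have Inv: "smooth_on {M. det M \<noteq> 0} (matrix_inv :: real^'k^'k \<Rightarrow> _)"
    and oI: "open {M :: real^'k^'k. det M \<noteq> 0}"
  proof -
    have "continuous_on UNIV (det :: real^'k^'k \<Rightarrow> real)"
      using smooth_on_continuous[OF smooth_on_det[OF smooth_on_id open_UNIV]] .
    then show o: "open {M :: real^'k^'k. det M \<noteq> 0}"
      by (intro open_Collect_neq) auto
    then show "smooth_on {M. det M \<noteq> 0} (matrix_inv :: real^'k^'k \<Rightarrow> _)"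
      using smooth_on_matrix_inv[OF smooth_on_id o] by auto
  qed
  have "Ck_on k g V" for k
  proof (induction k)
    case 0
    then show ?case using * by (simp add: homeomorphism_def)
  next
    case (Suc k)
    have AgV: "Ck_on k (\<lambda>y. A (g y)) V"
    proof (rule Ck_on_compose[OF \<open>open V\<close> \<open>open U\<close> _ _ Suc.IH])
      show "g ` V \<subseteq> U" using gU by blast
      show "Ck_on k A U" using A by (simp add: smooth_on_def)
    qed
    have "Ck_on k (\<lambda>y. matrix_inv (A (g y))) V"
    proof (rule Ck_on_compose[OF \<open>open V\<close> oI _ _ AgV])
      show "(\<lambda>y. A (g y)) ` V \<subseteq> {M. det M \<noteq> 0}" using Ainv by blast
      show "Ck_on k matrix_inv {M :: real^'k^'k. det M \<noteq> 0}" using Inv by (simp add: smooth_on_def)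
    qed
    then have "Ck_on k (\<lambda>y. matrix_inv (A (g y)) *v v) V" for v
      by (rule Ck_on_bounded_bilinear[OF bounded_bilinear_matrix_vector_mult _ Ck_on_const \<open>open V\<close>])
    moreover have "(g has_derivative (*v) (matrix_inv (A (g y)))) (at y)" if "y \<in> V" for y
      using g'[OF that] Ainv[OF that] by simp
    ultimately show ?case
      by (intro Ck_on_SucI'[OF \<open>open V\<close>])
  qed
  then have "smooth_on V g" by (simp add: smooth_on_def)
  with * show thesis by (rule that)
qed

section \<open>Symmetry of second derivatives\<close>

lemma has_real_derivative_along_line:
  fixes f :: "'a::real_normed_vector \<Rightarrow> real"
  assumes "(f has_derivative D) (at (p + s *\<^sub>R v))"
  shows "((\<lambda>s. f (p + s *\<^sub>R v)) has_real_derivative D v) (at s)"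
proof -
  have "((\<lambda>s. p + s *\<^sub>R v) has_derivative (\<lambda>t. t *\<^sub>R v)) (at s)"
    by (auto intro!: derivative_eq_intros)
  from has_derivative_compose[OF this assms]
  have "((\<lambda>s. f (p + s *\<^sub>R v)) has_derivative (\<lambda>t. D (t *\<^sub>R v))) (at s)" .
  moreover have "D (t *\<^sub>R v) = D v * t" for t
    using has_derivative_linear[OF assms] by (simp add: linear_cmul)
  ultimately show ?thesis by (simp add: has_field_derivative_def)
qed

text \<open>The mean value theorem is applied once in direction \<open>v\<close>, to the difference
  of \<open>f\<close> along two parallel segments, and once in direction \<open>w\<close>, to the
  derivative so obtained. The left-hand side of the equation is symmetric in \<open>v\<close> and
  \<open>w\<close>.\<close>

lemma second_difference_mean_value:
  fixes f :: "'a::euclidean_space \<Rightarrow> real"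
  assumes f: "smooth_on S f" and h: "h > 0"
    and S: "\<And>s t. 0 \<le> s \<Longrightarrow> s \<le> h \<Longrightarrow> 0 \<le> t \<Longrightarrow> t \<le> h \<Longrightarrow> x + s *\<^sub>R v + t *\<^sub>R w \<in> S"
  obtains s t where "0 \<le> s" "s \<le> h" "0 \<le> t" "t \<le> h"
    "f (x + h *\<^sub>R v + h *\<^sub>R w) - f (x + h *\<^sub>R v) - f (x + h *\<^sub>R w) + f x =
      h * h * frechet_derivative (\<lambda>y. frechet_derivative f (at y) v) (at (x + s *\<^sub>R v + t *\<^sub>R w)) w"
proof -
  let ?D = "\<lambda>y. frechet_derivative f (at y) v"
  let ?g = "\<lambda>s. f (x + h *\<^sub>R w + s *\<^sub>R v) - f (x + s *\<^sub>R v)"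
  have "\<exists>s. 0 < s \<and> s < h \<and> ?g h - ?g 0 =
      (h - 0) * (?D (x + h *\<^sub>R w + s *\<^sub>R v) - ?D (x + s *\<^sub>R v))"
  proof (rule MVT2[OF h])
    fix s assume s: "0 \<le> s" "s \<le> h"
    have "x + h *\<^sub>R w + s *\<^sub>R v \<in> S" "x + s *\<^sub>R v \<in> S"
      using S[of s h] S[of s 0] s h by (simp_all add: algebra_simps)
    then show "(?g has_real_derivative ?D (x + h *\<^sub>R w + s *\<^sub>R v) - ?D (x + s *\<^sub>R v)) (at s)"
      by (intro DERIV_diff has_real_derivative_along_line smooth_on_has_derivative[OF f])
  qed
  then obtain s where s: "0 < s" "s < h"
    "?g h - ?g 0 = h * (?D (x + h *\<^sub>R w + s *\<^sub>R v) - ?D (x + s *\<^sub>R v))"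
    by auto
  let ?k = "\<lambda>t. ?D (x + s *\<^sub>R v + t *\<^sub>R w)"
  have "\<exists>t. 0 < t \<and> t < h \<and> ?k h - ?k 0 =
      (h - 0) * frechet_derivative ?D (at (x + s *\<^sub>R v + t *\<^sub>R w)) w"
  proof (rule MVT2[OF h])
    fix t assume "0 \<le> t" "t \<le> h"
    then have "x + s *\<^sub>R v + t *\<^sub>R w \<in> S"
      using S[of s t] s by simp
    then show "(?k has_real_derivative frechet_derivative ?D (at (x + s *\<^sub>R v + t *\<^sub>R w)) w) (at t)"
      by (intro has_real_derivative_along_line smooth_on_has_derivative[OF smooth_on_frechet_derivative[OF f]])
  qed
  then obtain t where t: "0 < t" "t < h"
    "?k h - ?k 0 = h * frechet_derivative ?D (at (x + s *\<^sub>R v + t *\<^sub>R w)) w"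
    by auto
  have "?g h - ?g 0 = h * (?k h - ?k 0)"
    using s(3) by (simp add: add.commute add.left_commute)
  then have "?g h - ?g 0 = h * h * frechet_derivative ?D (at (x + s *\<^sub>R v + t *\<^sub>R w)) w"
    using t(3) by simp
  then show thesis
    using s t by (intro that[of s t]) (auto simp: algebra_simps)
qed

text \<open>The symmetric second difference, divided by the square of the step, is a value of either
  mixed derivative at a point close to \<open>x\<close>; continuity of both then forces them to
  agree at \<open>x\<close>.\<close>

lemma second_derivative_symmetric_real:
  fixes f :: "'a::euclidean_space \<Rightarrow> real"
  assumes S: "open S" "x \<in> S" and f: "smooth_on S f"
  shows "frechet_derivative (\<lambda>y. frechet_derivative f (at y) v) (at x) w =
    frechet_derivative (\<lambda>y. frechet_derivative f (at y) w) (at x) v"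
proof -
  define A where "A v w y = frechet_derivative (\<lambda>y. frechet_derivative f (at y) v) (at y) w" for v w y
  have cont: "isCont (A v w) x" for v w
    using smooth_on_continuous[OF smooth_on_frechet_derivative[OF smooth_on_frechet_derivative[OF f]], of v w] S
    unfolding A_def by (simp add: continuous_on_eq_continuous_at)
  have "\<bar>A v w x - A w v x\<bar> \<le> e" if e: "e > 0" for e
  proof -
    have "e / 2 > 0" using e by simp
    then obtain d1 where d1: "d1 > 0" "\<And>y. dist y x < d1 \<Longrightarrow> \<bar>A v w y - A v w x\<bar> < e / 2"
      using cont[of v w] unfolding continuous_at_eps_delta by (metis real_norm_def dist_norm)
    obtain d2 where d2: "d2 > 0" "\<And>y. dist y x < d2 \<Longrightarrow> \<bar>A w v y - A w v x\<bar> < e / 2"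
      using cont[of w v] \<open>e / 2 > 0\<close> unfolding continuous_at_eps_delta by (metis real_norm_def dist_norm)
    obtain d3 where d3: "d3 > 0" "ball x d3 \<subseteq> S"
      using S by (meson openE)
    define d where "d = min d1 (min d2 d3)"
    have d: "d > 0" using d1 d2 d3 by (simp add: d_def)
    \<comment> \<open>The summand 1 keeps the denominator positive when \<open>v\<close> and
      \<open>w\<close> vanish, and makes the displacement strictly shorter than
      \<open>d\<close>.\<close>
    define h where "h = d / (norm v + norm w + 1)"
    have h: "h > 0" unfolding h_def using d by (intro divide_pos_pos) (auto intro: add_nonneg_pos)
    have hd: "h * norm v + h * norm w < d"
    proof -
      have "norm v + norm w + 1 \<noteq> 0" using norm_ge_zero[of v] norm_ge_zero[of w] by linarith
      then have "h * (norm v + norm w + 1) = d" unfolding h_def by simp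
      then show ?thesis using h by (simp add: algebra_simps)
    qed
    have near: "dist (x + s *\<^sub>R v' + t *\<^sub>R w') x < d"
      if "0 \<le> s" "s \<le> h" "0 \<le> t" "t \<le> h" "{v', w'} = {v, w}" for s t v' w'
    proof -
      have "dist (x + s *\<^sub>R v' + t *\<^sub>R w') x \<le> s * norm v' + t * norm w'"
        using norm_triangle_ineq[of "s *\<^sub>R v'" "t *\<^sub>R w'"] that by (simp add: dist_norm)
      also have "\<dots> \<le> h * norm v' + h * norm w'"
        using that by (intro add_mono mult_right_mono) auto
      also have "\<dots> < d" using hd that(5) by (auto simp: doubleton_eq_iff)
      finally show ?thesis .
    qed
    have in_S: "y \<in> S" if "dist y x < d" for y
      using that d3(2) by (auto simp: d_def dist_commute)
    obtain s t where st: "0 \<le> s" "s \<le> h" "0 \<le> t" "t \<le> h"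
      "f (x + h *\<^sub>R v + h *\<^sub>R w) - f (x + h *\<^sub>R v) - f (x + h *\<^sub>R w) + f x =
        h * h * A v w (x + s *\<^sub>R v + t *\<^sub>R w)"
      unfolding A_def using second_difference_mean_value[OF f h in_S[OF near]] by blast
    obtain s' t' where st': "0 \<le> s'" "s' \<le> h" "0 \<le> t'" "t' \<le> h"
      "f (x + h *\<^sub>R w + h *\<^sub>R v) - f (x + h *\<^sub>R w) - f (x + h *\<^sub>R v) + f x =
        h * h * A w v (x + s' *\<^sub>R w + t' *\<^sub>R v)"
      unfolding A_def using second_difference_mean_value[OF f h in_S[OF near], of w v] by blast
    have "h * h * A v w (x + s *\<^sub>R v + t *\<^sub>R w) = h * h * A w v (x + s' *\<^sub>R w + t' *\<^sub>R v)"
      unfolding st(5)[symmetric] st'(5)[symmetric] by (simp add: algebra_simps)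
    then have eq: "A v w (x + s *\<^sub>R v + t *\<^sub>R w) = A w v (x + s' *\<^sub>R w + t' *\<^sub>R v)"
      using h by simp
    have "\<bar>A v w (x + s *\<^sub>R v + t *\<^sub>R w) - A v w x\<bar> < e / 2"
      using near[OF st(1-4)] by (intro d1(2)) (auto simp: d_def)
    moreover have "\<bar>A w v (x + s' *\<^sub>R w + t' *\<^sub>R v) - A w v x\<bar> < e / 2"
      using near[OF st'(1-4), of w v] by (intro d2(2)) (auto simp: d_def)
    ultimately show ?thesis using eq by linarith
  qed
  then have "\<bar>A v w x - A w v x\<bar> \<le> 0"
    using field_le_epsilon[of "\<bar>A v w x - A w v x\<bar>" 0] by simp
  then show ?thesis by (simp add: A_def)
qed

lemma frechet_derivative_bounded_linear:
  assumes "bounded_linear h" "f differentiable (at x)"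
  shows "frechet_derivative (\<lambda>x. h (f x)) (at x) = (\<lambda>v. h (frechet_derivative f (at x) v))"
  using bounded_linear.has_derivative[OF assms(1), of f _ "at x"] assms(2)
  by (metis frechet_derivative_at frechet_derivative_works)

lemma second_derivative_symmetric:
  fixes f :: "'a::euclidean_space \<Rightarrow> 'b::euclidean_space"
  assumes S: "open S" "x \<in> S" and f: "smooth_on S f"
  shows "frechet_derivative (\<lambda>y. frechet_derivative f (at y) v) (at x) w =
    frechet_derivative (\<lambda>y. frechet_derivative f (at y) w) (at x) v"
proof (rule euclidean_eqI)
  fix b :: 'b
  have diff: "f differentiable (at y)"
    "(\<lambda>y. frechet_derivative f (at y) u) differentiable (at y)" if "y \<in> S" for y u
    using smooth_on_has_derivative[OF f that]
      smooth_on_has_derivative[OF smooth_on_frechet_derivative[OF f] that]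
    by (auto simp: differentiable_def)
  have eq: "frechet_derivative (\<lambda>y. frechet_derivative f (at y) u) (at x) u' \<bullet> b =
      frechet_derivative (\<lambda>y. frechet_derivative (\<lambda>x. f x \<bullet> b) (at y) u) (at x) u'" for u u'
  proof -
    have "((\<lambda>y. frechet_derivative f (at y) u \<bullet> b) has_derivative
        (\<lambda>u'. frechet_derivative (\<lambda>y. frechet_derivative f (at y) u) (at x) u' \<bullet> b)) (at x)"
      using smooth_on_has_derivative[OF smooth_on_frechet_derivative[OF f] S(2)]
      by (rule bounded_linear.has_derivative[OF bounded_linear_inner_left])
    then have "((\<lambda>y. frechet_derivative (\<lambda>x. f x \<bullet> b) (at y) u) has_derivative
        (\<lambda>u'. frechet_derivative (\<lambda>y. frechet_derivative f (at y) u) (at x) u' \<bullet> b)) (at x)"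
    proof (rule has_derivative_transform_within_open[OF _ S])
      fix y assume "y \<in> S"
      then show "frechet_derivative f (at y) u \<bullet> b = frechet_derivative (\<lambda>x. f x \<bullet> b) (at y) u"
        using frechet_derivative_bounded_linear[OF bounded_linear_inner_left diff(1)] by metis
    qed
    then show ?thesis by (metis frechet_derivative_at)
  qed
  show "frechet_derivative (\<lambda>y. frechet_derivative f (at y) v) (at x) w \<bullet> b =
    frechet_derivative (\<lambda>y. frechet_derivative f (at y) w) (at x) v \<bullet> b"
    unfolding eq
    using second_derivative_symmetric_real[OF S smooth_on_bounded_linear[OF bounded_linear_inner_left f S(1)]] .
qed

section \<open>Matrix algebra\<close>

declare transpose_matrix_vector [simp del]

lemma matrix_mult_minus_left: "(- A) ** B = - (A ** (B :: real^'l^'m))"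
  and matrix_mult_minus_right: "A ** (- B) = - (A ** (B :: real^'l^'m))"
  and matrix_mult_add_left: "(A + A') ** B = A ** B + A' ** B"
  and matrix_mult_diff_left: "(A - A') ** B = A ** B - A' ** B"
  and matrix_mult_diff_right: "A ** (B - B') = A ** B - A ** B'"
  and matrix_mult_scaleR_left: "(c *\<^sub>R A) ** B = c *\<^sub>R (A ** B)"
  and matrix_mult_scaleR_right: "A ** (c *\<^sub>R B) = c *\<^sub>R (A ** B)"
  and matrix_mult_zero_left: "0 ** B = (0 :: real^'l^'k)"
  and matrix_mult_zero_right: "A ** 0 = (0 :: real^'l^'k)"
  and transpose_add: "transpose (A + A') = transpose A + transpose (A' :: real^'m^'k)"
  and transpose_diff: "transpose (A - A') = transpose A - transpose (A' :: real^'m^'k)"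
  and transpose_minus: "transpose (- A) = - transpose (A :: real^'m^'k)"
  and transpose_zero: "transpose (0 :: real^'m^'k) = 0"
  for A A' :: "real^'m^'k"
  by (simp_all add: vec_eq_iff matrix_matrix_mult_def transpose_def sum_negf left_diff_distrib distrib_right sum.distrib
      right_diff_distrib sum_subtractf sum_distrib_left mult.assoc mult.left_commute)

lemma matrix_vector_mult_minus_left: "(- A) *v x = - (A *v x)" for A :: "real^'m^'k"
  by (simp add: vec_eq_iff matrix_vector_mult_def sum_negf)

lemma matrix_vector_mult_scaleR_left: "(c *\<^sub>R A) *v x = c *\<^sub>R (A *v x)" for A :: "real^'m^'k"
  by (simp add: vec_eq_iff matrix_vector_mult_def sum_distrib_left mult.assoc)

text \<open>A normal form for matrix expressions: sums are distributed, products are bracketed to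
  the right, and transposes are pushed to the factors. This bracketing is why cancellation rules
  such as \<open>J_J_mult\<close> also come with a trailing factor.\<close>

lemmas matrix_expand = matrix_mul_assoc[symmetric] matrix_add_ldistrib matrix_mult_add_left
  matrix_mult_minus_left matrix_mult_minus_right matrix_mult_diff_left matrix_mult_diff_right
  matrix_mult_scaleR_left matrix_mult_scaleR_right matrix_mult_zero_left matrix_mult_zero_right
  transpose_add transpose_diff transpose_minus transpose_zero transpose_scalar matrix_transpose_mul

lemma linear_transpose: "linear (transpose :: real^'m^'k \<Rightarrow> _)"
  by (rule linearI) (simp_all add: transpose_add transpose_scalar)

lemma linear_matrix_mult_left: "linear (\<lambda>B. A ** (B :: real^'l^'m))" for A :: "real^'m^'k"
  by (rule linearI) (simp_all add: matrix_expand)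

lemma inner_matrix: "A \<bullet> B = trace (A ** transpose B)" for A B :: "real^'m^'k"
  by (simp add: inner_vec_def trace_def matrix_matrix_mult_def transpose_def)

lemma trace_minus: "trace (- A) = - trace (A :: real^'m^'m)"
  by (simp add: trace_def sum_negf)

lemma trace_scaleR: "trace (c *\<^sub>R A) = c * trace (A :: real^'m^'m)"
  by (simp add: trace_def sum_distrib_left)

lemma inner_transpose: "transpose A \<bullet> transpose B = A \<bullet> (B :: real^'m^'k)"
  unfolding inner_vec_def transpose_def by (simp, rule sum.swap)

lemma dot_matrix_mult: "(x :: real^'k) \<bullet> (A *v y) = (transpose A *v x) \<bullet> y"
  by (simp add: transpose_matrix_vector dot_lmul_matrix)

definition tensor :: "real^'k \<Rightarrow> real^'m \<Rightarrow> real^'m^'k" where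
  "tensor x y = (\<chi> i j. x $ i * y $ j)"

lemma tensor_mult_vec: "tensor x y *v z = (y \<bullet> z) *\<^sub>R x"
  by (simp add: vec_eq_iff tensor_def matrix_vector_mult_def inner_vec_def sum_distrib_right
      sum_distrib_left mult_ac)

lemma transpose_tensor: "transpose (tensor x y) = tensor y x"
  by (simp add: vec_eq_iff tensor_def transpose_def mult.commute)

lemma matrix_mult_tensor: "A ** tensor x y = tensor (A *v x) y"
  by (simp add: vec_eq_iff tensor_def matrix_matrix_mult_def matrix_vector_mult_def sum_distrib_left mult_ac)

lemma tensor_mult_matrix: "tensor x y ** A = tensor x (transpose A *v y)"
  by (simp add: vec_eq_iff tensor_def matrix_matrix_mult_def matrix_vector_mult_def transpose_def
      sum_distrib_left mult_ac)

text \<open>A bilinear form in the vectors is a linear functional of the matrix, represented by a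
  matrix of rank one; the gradient of such a form on a subspace of matrices is the projection of
  that representative.\<close>

lemma inner_tensor: "A \<bullet> tensor x y = x \<bullet> (A *v y)"
  by (simp add: inner_vec_def tensor_def matrix_vector_mult_def sum_distrib_left mult_ac)

section \<open>The symplectic group\<close>

lemma sum_Plus_UNIV:
  "(\<Sum>k\<in>(UNIV :: ('a::finite + 'a) set). f k) = (\<Sum>k\<in>UNIV. f (Inl k)) + (\<Sum>k\<in>UNIV. f (Inr k))"
  by (simp add: UNIV_Plus_UNIV[symmetric] sum.Plus del: UNIV_Plus_UNIV)

abbreviation J :: "real^('n::finite + 'n)^('n + 'n)" where "J \<equiv> symplectic_J"

lemma block_mult:
  "block A B C D ** block A' B' C' D' =
    block (A ** A' + B ** C') (A ** B' + B ** D') (C ** A' + D ** C') (C ** B' + D ** (D' :: real^'n^'n))"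
  by (simp add: vec_eq_iff block_def matrix_matrix_mult_def sum_Plus_UNIV split: sum.split)

lemma transpose_block:
  "transpose (block A B C D) = block (transpose A) (transpose C) (transpose B) (transpose (D :: real^'n^'n))"
  by (simp add: vec_eq_iff block_def transpose_def split: sum.split)

lemma minus_block: "- block A B C D = block (- A) (- B) (- C) (- (D :: real^'n^'n))"
  by (simp add: vec_eq_iff block_def split: sum.split)

lemma mat_1_block: "mat 1 = block (mat 1) 0 0 (mat 1 :: real^'n^'n)"
  by (simp add: vec_eq_iff block_def mat_def split: sum.split)

lemma block_eq_iff:
  "block A B C D = block A' B' C' D' \<longleftrightarrow> A = A' \<and> B = B' \<and> C = C' \<and> D = (D' :: real^'n^'n)"
  by (auto simp: vec_eq_iff block_def split: sum.split sum.split_asm)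

lemma matrix_block: "X = block (\<chi> i j. X $ Inl i $ Inl j) (\<chi> i j. X $ Inl i $ Inr j)
    (\<chi> i j. X $ Inr i $ Inl j) (\<chi> i j. X $ Inr i $ Inr j)"
  by (simp add: vec_eq_iff block_def split: sum.split)

lemma transpose_J: "transpose J = - J"
  by (simp add: symplectic_J_def transpose_block minus_block transpose_minus transpose_zero)

lemma J_J: "J ** J = - mat 1"
  by (simp add: symplectic_J_def block_mult mat_1_block minus_block matrix_expand)

lemma J_J_mult: "J ** (J ** A) = - A"
  by (simp add: matrix_mul_assoc J_J matrix_mult_minus_left)

lemma J_J_vec: "J *v (J *v x) = - x"
  by (simp add: matrix_vector_mul_assoc J_J matrix_vector_mult_minus_left)

lemma dot_J: "x \<bullet> (J *v y) = - ((J *v x) \<bullet> y)"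
  by (simp add: dot_matrix_mult transpose_J matrix_vector_mult_minus_left)

lemma dot_J_self: "x \<bullet> (J *v x) = 0"
  using dot_J[of x x] by (simp add: inner_commute)

lemma dot_J_J: "(J *v x) \<bullet> (J *v y) = x \<bullet> y"
  by (simp add: dot_J[of "J *v x"] J_J_vec)

lemmas J_simps = transpose_J J_J J_J_mult

lemma Sp_groupD: "x \<in> Sp_group \<Longrightarrow> x ** J ** transpose x = J"
  by (simp add: Sp_group_def)

lemma symplectic_right_inverse:
  fixes x :: "real^('n::finite + 'n)^('n + 'n)"
  assumes "x ** J ** transpose x = J"
  shows "x ** (- (J ** transpose x ** J)) = mat 1"
proof -
  have "x ** (- (J ** transpose x ** J)) = - ((x ** J ** transpose x) ** J)"
    by (simp add: matrix_expand)
  then show ?thesis by (simp add: assms J_J)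
qed

lemma symplectic_left_inverse:
  fixes x :: "real^('n::finite + 'n)^('n + 'n)"
  assumes "x ** J ** transpose x = J"
  shows "(- (J ** transpose x ** J)) ** x = mat 1"
  by (rule matrix_left_right_inverse1[OF symplectic_right_inverse[OF assms]])

lemma Sp_group_iff: "x \<in> Sp_group \<longleftrightarrow> x ** J ** transpose x = J"
  unfolding Sp_group_def invertible_def
  using symplectic_right_inverse symplectic_left_inverse by blast

lemma Sp_transpose_mult:
  assumes "x \<in> Sp_group"
  shows "transpose x ** J ** x = J"
proof -
  have "J ** ((- (J ** transpose x ** J)) ** x) = J"
    using symplectic_left_inverse[OF Sp_groupD[OF assms]] by simp
  then show ?thesis by (simp add: matrix_expand J_simps)
qed

lemma Sp_transpose: "x \<in> Sp_group \<Longrightarrow> transpose x \<in> Sp_group"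
  by (simp add: Sp_group_iff Sp_transpose_mult)

lemma Sp_mult:
  assumes "x \<in> Sp_group" "y \<in> Sp_group"
  shows "x ** y \<in> Sp_group"
proof -
  have "(x ** y) ** J ** transpose (x ** y) = x ** (y ** J ** transpose y) ** transpose x"
    by (simp add: matrix_expand)
  then show ?thesis using assms by (simp add: Sp_group_iff)
qed

lemma Sp_one: "mat 1 \<in> Sp_group"
  by (simp add: Sp_group_iff)

lemma Sp_invertible: "x \<in> Sp_group \<Longrightarrow> invertible x"
  by (simp add: Sp_group_def)

lemmas Sp_inv = matrix_inv_mult[OF Sp_invertible]

lemma Sp_matrix_inv:
  assumes "x \<in> Sp_group"
  shows "matrix_inv x = - (J ** transpose x ** J)"
proof -
  have "matrix_inv x = matrix_inv x ** (x ** (- (J ** transpose x ** J)))"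
    by (simp add: symplectic_right_inverse[OF Sp_groupD[OF assms]])
  then show ?thesis by (simp add: matrix_mul_assoc Sp_inv[OF assms])
qed

lemma Sp_mult_transpose_J:
  assumes "x \<in> Sp_group"
  shows "transpose x ** (J ** x) = J" "transpose x ** (J ** (x ** A)) = J ** A"
    "x ** (J ** transpose x) = J" "x ** (J ** (transpose x ** A)) = J ** A"
  using Sp_transpose_mult[OF assms] Sp_groupD[OF assms]
  by (simp_all add: matrix_mul_assoc)

lemma Sp_matrix_inv_in:
  "x \<in> Sp_group \<Longrightarrow> matrix_inv x \<in> Sp_group"
  by (simp add: Sp_group_iff Sp_matrix_inv matrix_expand J_simps Sp_mult_transpose_J)

lemma orthogonal_symplectic_commutes_J:
  assumes "k ** transpose k = mat 1" "k \<in> Sp_group"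
  shows "k ** J = J ** k"
proof -
  have "transpose k ** k = mat 1" using assms(1) matrix_left_right_inverse by blast
  then have "k ** J = k ** J ** (transpose k ** k)" by simp
  also have "\<dots> = J ** k" using Sp_groupD[OF assms(2)] by (simp add: matrix_mul_assoc)
  finally show ?thesis .
qed

text \<open>An orthogonal symplectic matrix commutes with \<open>J\<close>, which forces the block
  shape of a complex linear map; for that shape orthogonality is unitarity. From here on the fibres
  are described by these two equations instead of by \<open>real_form\<close>.\<close>

theorem U_group_eq: "U_group = {k \<in> Sp_group. k ** transpose k = mat 1}"
proof (intro set_eqI iffI)
  fix k :: "real^('n::finite + 'n)^('n + 'n)"
  assume "k \<in> U_group"
  then obtain z where z: "z \<in> unitary_group" "k = real_form z"
    by (auto simp: U_group_def)
  have o: "k ** transpose k = mat 1" using z real_form_orthogonal by blast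
  have "k ** J = J ** k"
    by (simp add: z(2) real_form_def Let_def symplectic_J_def block_mult block_eq_iff matrix_expand)
  then have "k ** J ** transpose k = J"
    by (metis matrix_mul_assoc matrix_mul_rid o)
  with o show "k \<in> {k \<in> Sp_group. k ** transpose k = mat 1}"
    by (simp add: Sp_group_iff)
next
  fix k :: "real^('n::finite + 'n)^('n + 'n)"
  assume "k \<in> {k \<in> Sp_group. k ** transpose k = mat 1}"
  then have k: "k ** transpose k = mat 1" "k ** J = J ** k"
    using orthogonal_symplectic_commutes_J by auto
  define A where "A = (\<chi> i j. k $ Inl i $ Inl j)"
  define B where "B = (\<chi> i j. k $ Inl i $ Inr j)"
  define C where "C = (\<chi> i j. k $ Inr i $ Inl j)"
  define D where "D = (\<chi> i j. k $ Inr i $ Inr j)"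
  have kb: "k = block A B C D"
    unfolding A_def B_def C_def D_def by (rule matrix_block)
  have "k ** J = block (- B) A (- D) C" "J ** k = block C D (- A) (- B)"
    unfolding kb by (simp_all add: symplectic_J_def block_mult matrix_expand)
  then have "block (- B) A (- D) C = block C D (- A) (- B)" using k(2) by metis
  then have "C = - B" "A = D" unfolding block_eq_iff by blast+
  note kb = kb[unfolded this(1) this(2)[symmetric]]
  define z where "z = (\<chi> i j. Complex (A $ i $ j) (B $ i $ j))"
  have rz: "real_form z = k"
    by (simp add: real_form_def Let_def z_def kb)
  have "k ** transpose k = block (A ** transpose A + B ** transpose B) (A ** transpose (- B) + B ** transpose A)
      (- B ** transpose A + A ** transpose B) (- B ** transpose (- B) + A ** transpose A)"
    unfolding kb by (simp only: transpose_block block_mult)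
  then have "A ** transpose A + B ** transpose B = mat 1" "A ** transpose (- B) + B ** transpose A = 0"
    using k(1) unfolding mat_1_block by (metis block_eq_iff)+
  then have "A ** transpose A + B ** transpose B = mat 1"
    "B ** transpose A - A ** transpose B = 0"
    by (simp_all add: matrix_expand)
  then have e: "(\<Sum>l\<in>UNIV. A $ i $ l * A $ j $ l) + (\<Sum>l\<in>UNIV. B $ i $ l * B $ j $ l) = (if i = j then 1 else 0)"
    "(\<Sum>l\<in>UNIV. B $ i $ l * A $ j $ l) - (\<Sum>l\<in>UNIV. A $ i $ l * B $ j $ l) = 0" for i j
    by (simp_all add: vec_eq_iff matrix_matrix_mult_def transpose_def mat_def)
  have "z ** conj_transpose z = mat 1"
    using e
    by (simp add: vec_eq_iff matrix_matrix_mult_def conj_transpose_def mat_def z_def complex_eq_iff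
        sum.distrib sum_subtractf)
  with rz show "k \<in> U_group"
    by (auto simp: U_group_def unitary_group_def)
qed

lemma U_group_subset: "U_group \<subseteq> Sp_group"
  by (auto simp: U_group_eq)

text \<open>If the two Gram matrices agree, the quotient \<open>matrix_inv y ** x\<close> is
  orthogonal as well as symplectic.\<close>

lemma coset_eq_iff:
  assumes "x \<in> Sp_group" "y \<in> Sp_group"
  shows "coset U_group x = coset U_group y \<longleftrightarrow> x ** transpose x = y ** transpose y"
proof
  assume "coset U_group x = coset U_group y"
  moreover have "mat 1 \<in> U_group" by (simp add: U_group_eq Sp_one)
  then have "x \<in> coset U_group x" by (force simp: coset_def)
  ultimately obtain k where "k \<in> U_group" "x = y ** k" by (auto simp: coset_def)
  then have "x ** transpose x = y ** (k ** transpose k) ** transpose y"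
    by (simp add: matrix_expand)
  with \<open>k \<in> U_group\<close> show "x ** transpose x = y ** transpose y" by (simp add: U_group_eq)
next
  have le: "coset U_group x \<subseteq> coset U_group y"
    if "x \<in> Sp_group" "y \<in> Sp_group" "x ** transpose x = y ** transpose y"
    for x y :: "real^('n::finite + 'n)^('n + 'n)"
  proof -
    define k where "k = matrix_inv y ** x"
    have x: "x = y ** k" by (simp add: k_def matrix_mul_assoc Sp_inv that)
    have "k ** transpose k = matrix_inv y ** (x ** transpose x) ** transpose (matrix_inv y)"
      by (simp add: k_def matrix_expand)
    also have "\<dots> = (matrix_inv y ** y) ** transpose (matrix_inv y ** y)"
      unfolding that(3) by (simp add: matrix_expand)
    finally have "k \<in> U_group"
      using that by (simp add: U_group_eq k_def Sp_inv Sp_mult Sp_matrix_inv_in)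
    moreover have "l ** l' \<in> U_group" if "l \<in> U_group" "l' \<in> U_group"
      for l l' :: "real^('n::finite + 'n)^('n + 'n)"
    proof -
      have "(l ** l') ** transpose (l ** l') = l ** (l' ** transpose l') ** transpose l"
        by (simp add: matrix_expand)
      with that show ?thesis by (simp add: U_group_eq Sp_mult)
    qed
    ultimately show ?thesis
      by (auto simp: coset_def x matrix_mul_assoc[symmetric])
  qed
  assume "x ** transpose x = y ** transpose y"
  then show "coset U_group x = coset U_group y"
    using le[of x y] le[of y x] assms by auto
qed

section \<open>The symmetric part of the symplectic Lie algebra\<close>

text \<open>The complement p in the Cartan decomposition, which models the tangent spaces of the
  quotient through horizontal lifts.\<close>

definition p_space :: "(real^('n::finite + 'n)^('n + 'n)) set" where
  "p_space = {X. transpose X = X \<and> X ** J = - (J ** X)}"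

text \<open>The average over the group generated by the commuting isometric involutions M to M^t and
  M to J M J. Their common fixed space is \<open>p_space\<close>, so this is the orthogonal
  projection onto it.\<close>

definition proj_p :: "real^('n::finite + 'n)^('n + 'n) \<Rightarrow> real^('n + 'n)^('n + 'n)" where
  "proj_p M = (1 / 4) *\<^sub>R (M + transpose M + J ** (M + transpose M) ** J)"

lemma inner_mult_left: "A \<bullet> (B ** C) = (transpose B ** A) \<bullet> C"
  for A :: "real^'m^'k"
  by (simp add: inner_matrix matrix_transpose_mul)
    (metis matrix_mul_assoc trace_mul_sym)

lemma inner_mult_right: "A \<bullet> (B ** C) = (A ** transpose C) \<bullet> B"
  for A :: "real^'m^'k"
  by (simp add: inner_matrix matrix_transpose_mul matrix_mul_assoc)

lemma p_space_J: "X \<in> p_space \<Longrightarrow> J ** (X ** J) = X"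
  by (simp add: p_space_def matrix_expand J_simps)

lemma p_space_J2:
  assumes "X \<in> p_space"
  shows "J ** (X ** (J ** A)) = X ** A"
  using arg_cong[OF p_space_J[OF assms], of "\<lambda>Y. Y ** A"] by (simp add: matrix_expand)

lemma p_space_transpose: "X \<in> p_space \<Longrightarrow> transpose X = X"
  by (simp add: p_space_def)

lemma subspace_p_space: "subspace p_space"
  by (rule subspaceI) (simp_all add: p_space_def matrix_expand)

lemma linear_proj_p: "linear proj_p"
proof (rule linearI)
  fix M N :: "real^('n::finite + 'n)^('n + 'n)" and c :: real
  show "proj_p (M + N) = proj_p M + proj_p N"
    by (simp add: proj_p_def matrix_expand scaleR_add_right[symmetric] del: scaleR_add_right)
  show "proj_p (c *\<^sub>R M) = c *\<^sub>R proj_p M"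
    by (simp add: proj_p_def matrix_expand scaleR_add_right mult.commute)
qed

lemma proj_p_in: "proj_p M \<in> p_space"
  by (simp add: p_space_def proj_p_def matrix_expand J_simps scaleR_add_right algebra_simps)

lemma proj_p_symmetric: "transpose M = M \<Longrightarrow> proj_p M = (1 / 2) *\<^sub>R (M + J ** M ** J)"
  by (simp only: proj_p_def scaleR_2[symmetric] matrix_mult_scaleR_left matrix_mult_scaleR_right
      scaleR_scaleR scaleR_add_right) simp

lemma inner_proj_p:
  assumes "X \<in> p_space"
  shows "X \<bullet> proj_p M = X \<bullet> M"
proof -
  have t: "X \<bullet> transpose M = X \<bullet> M"
    using inner_transpose[of X M] by (simp add: p_space_transpose[OF assms])
  have "X \<bullet> (J ** N ** J) = X \<bullet> N" for N
    by (simp only: inner_mult_right[of X "J ** N" J] inner_mult_left[of "X ** transpose J" J N])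
      (simp add: transpose_J matrix_expand p_space_J[OF assms])
  then show ?thesis
    by (simp add: proj_p_def inner_add_right t)
qed

lemma proj_p_tensor: "proj_p (tensor a b) *v y = (1 / 4) *\<^sub>R
    ((b \<bullet> y) *\<^sub>R a + (a \<bullet> y) *\<^sub>R b + (b \<bullet> (J *v y)) *\<^sub>R (J *v a) + (a \<bullet> (J *v y)) *\<^sub>R (J *v b))"
  by (simp add: proj_p_def matrix_vector_mult_scaleR_left matrix_vector_mult_add_rdistrib tensor_mult_vec
      transpose_tensor matrix_vector_mul_assoc[symmetric] matrix_vector_right_distrib matrix_vector_mult_scaleR
      add.assoc)

text \<open>The index type carries no order; an arbitrary injective numbering serves to tell the
  upper triangle from the lower one.\<close>

definition idx :: "'n::finite \<Rightarrow> nat" where "idx = (SOME f. inj f)"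

lemma inj_idx: "inj (idx :: 'n::finite \<Rightarrow> nat)"
  unfolding idx_def using finite_imp_inj_to_nat_seg[OF finite[of "UNIV :: 'n set"]]
  by (elim exE conjE) (rule someI[of inj])

lemma idx_cases: obtains "i = j" | "idx i < idx j" "\<not> idx j \<le> idx i" "i \<noteq> j" | "idx j < idx i" "\<not> idx i \<le> idx j" "i \<noteq> j"
  by (metis inj_idx injD linorder_neqE_nat not_le)

text \<open>An element of \<open>p_space\<close> has the form \<open>block A B B (- A)\<close> with symmetric \<open>A\<close> and \<open>B\<close>.  The upper
  triangle of a square matrix of coordinates stores \<open>A\<close>, its strict lower triangle stores the
  off-diagonal part of \<open>B\<close>, and the extra column indexed by \<open>None\<close> stores the diagonal of \<open>B\<close>.\<close>

definition from_coords :: "real^('n::finite \<times> 'n option) \<Rightarrow> real^('n + 'n)^('n + 'n)" where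
  "from_coords e =
    (let A = (\<chi> i j. if idx i \<le> idx j then e $ (i, Some j) else e $ (j, Some i));
         B = (\<chi> i j. if i = j then e $ (i, None)
              else if idx i < idx j then e $ (j, Some i) else e $ (i, Some j))
     in block A B B (- A))"

definition to_coords :: "real^('n::finite + 'n)^('n + 'n) \<Rightarrow> real^('n \<times> 'n option)" where
  "to_coords X = (\<chi> k. case snd k of
      None \<Rightarrow> X $ Inl (fst k) $ Inr (fst k)
    | Some j \<Rightarrow> if idx (fst k) \<le> idx j then X $ Inl (fst k) $ Inl j else X $ Inl (fst k) $ Inr j)"

lemma linear_to_coords: "linear to_coords"
  by (rule linearI) (simp_all add: to_coords_def vec_eq_iff split: option.split)

lemma linear_from_coords: "linear from_coords"
  by (rule linearI) (simp_all add: from_coords_def block_def Let_def vec_eq_iff split: sum.split)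

lemma to_from_coords: "to_coords (from_coords e) = e"
proof -
  have "to_coords (from_coords e) $ (i, k) = e $ (i, k)" for i k
  proof (cases k)
    case None
    then show ?thesis by (simp add: to_coords_def from_coords_def block_def Let_def)
  next
    case (Some j)
    then show ?thesis
      by (cases rule: idx_cases[of i j]) (simp_all add: to_coords_def from_coords_def block_def Let_def)
  qed
  then show ?thesis by (simp add: vec_eq_iff)
qed

lemma from_coords_in: "from_coords e \<in> p_space"
proof -
  define A where "A = (\<chi> i j. if idx i \<le> idx j then e $ (i, Some j) else e $ (j, Some i))"
  define B where "B = (\<chi> i j. if i = j then e $ (i, None)
              else if idx i < idx j then e $ (j, Some i) else e $ (i, Some j))"
  have f: "from_coords e = block A B B (- A)"
    by (simp add: from_coords_def A_def B_def Let_def)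
  have "A $ i $ j = A $ j $ i \<and> B $ i $ j = B $ j $ i" for i j
    by (cases rule: idx_cases[of i j]) (simp_all add: A_def B_def)
  then have "transpose A = A" "transpose B = B"
    by (simp_all add: vec_eq_iff transpose_def)
  then show ?thesis
    unfolding f p_space_def
    by (simp add: transpose_block transpose_minus symplectic_J_def block_mult minus_block matrix_expand)
qed

lemma from_to_coords:
  assumes "X \<in> p_space"
  shows "from_coords (to_coords X) = X"
proof -
  define A where "A = (\<chi> i j. X $ Inl i $ Inl j)"
  define B where "B = (\<chi> i j. X $ Inl i $ Inr j)"
  define C where "C = (\<chi> i j. X $ Inr i $ Inl j)"
  define D where "D = (\<chi> i j. X $ Inr i $ Inr j)"
  have Xb: "X = block A B C D"
    unfolding A_def B_def C_def D_def by (rule matrix_block)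
  have "X ** J = block (- B) A (- D) C" "- (J ** X) = block (- C) (- D) A B"
    unfolding Xb by (simp_all add: symplectic_J_def block_mult matrix_expand minus_block)
  moreover have "transpose X = block (transpose A) (transpose C) (transpose B) (transpose D)"
    unfolding Xb by (rule transpose_block)
  ultimately have b: "block (- B) A (- D) C = block (- C) (- D) A B"
    "block (transpose A) (transpose C) (transpose B) (transpose D) = block A B C D"
    using assms Xb unfolding p_space_def by auto
  have "C = B" using b(1) unfolding block_eq_iff by blast
  moreover have "D = - A" using b(1) unfolding block_eq_iff by (metis minus_minus)
  ultimately have X: "X = block A B B (- A)" using Xb by simp
  have "transpose A = A" "transpose B = B"
    using b(2) \<open>C = B\<close> unfolding block_eq_iff by simp_all
  then have sym: "A $ i $ j = A $ j $ i" "B $ i $ j = B $ j $ i" for i j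
    unfolding vec_eq_iff transpose_def by (metis vec_lambda_beta)+
  have "(if idx i \<le> idx j then to_coords X $ (i, Some j) else to_coords X $ (j, Some i)) = A $ i $ j"
    "(if i = j then to_coords X $ (i, None)
      else if idx i < idx j then to_coords X $ (j, Some i) else to_coords X $ (i, Some j)) = B $ i $ j" for i j
    unfolding X using sym(1)[of j i] sym(2)[of j i]
    by (cases rule: idx_cases[of i j]; simp add: to_coords_def block_def)+
  then have "from_coords (to_coords X) = block A B B (- A)"
    by (simp add: from_coords_def Let_def)
  then show ?thesis using X by simp
qed

text \<open>With \<open>S = x ** transpose x\<close>, the projection is \<open>(S - matrix_inv S) / 2\<close>, and this hyperbolic sine
  is injective on positive definite matrices.\<close>

lemma proj_p_inj:
  assumes "x \<in> Sp_group" "y \<in> Sp_group" and eq: "proj_p (x ** transpose x) = proj_p (y ** transpose y)"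
  shows "x ** transpose x = y ** transpose y"
proof -
  define Q R D where "Q = x ** transpose x" and "R = y ** transpose y" and "D = Q - R"
  have sym: "transpose Q = Q" "transpose R = R" "transpose D = D"
    by (simp_all add: Q_def R_def D_def matrix_expand)
  have "proj_p D = 0"
    using eq linear_diff[OF linear_proj_p, of Q R] by (simp add: D_def Q_def R_def)
  then have D: "D = - (J ** D ** J)"
    by (simp add: proj_p_symmetric[OF sym(3)] eq_neg_iff_add_eq_0)
  have QQ: "Q ** (J ** Q) = J" "R ** (J ** R) = J"
    using assms(1,2) by (simp_all add: Q_def R_def matrix_expand Sp_mult_transpose_J)
  \<comment> \<open>Replacing the middle factor by \<open>- (J ** D ** J)\<close> makes each product
    collapse through \<open>QQ\<close>, which expresses that \<open>Q\<close> and \<open>R\<close>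
    are symplectic and symmetric.\<close>
  have "Q ** D ** R = - (Q ** (J ** Q) ** J ** R) + Q ** J ** (R ** (J ** R))"
    by (subst D) (simp add: D_def matrix_expand)
  also have "\<dots> = R - Q"
    unfolding QQ by (simp add: matrix_expand J_simps)
  finally have "Q ** D ** R = - D" by (simp add: D_def)
  then have "D \<bullet> (Q ** D ** R) = - (D \<bullet> D)" by simp
  \<comment> \<open>Positivity of the Gram matrices makes this quantity a square norm, while it was
    just found to be minus the square norm of \<open>D\<close>.\<close>
  moreover have "D \<bullet> (Q ** D ** R) = (transpose x ** D ** y) \<bullet> (transpose x ** D ** y)"
  proof -
    have "D \<bullet> (Q ** D ** R) = D \<bullet> (x ** ((transpose x ** D ** y) ** transpose y))"
      by (simp add: Q_def R_def matrix_expand)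
    also have "\<dots> = (transpose x ** D ** y) \<bullet> (transpose x ** D ** y)"
      by (simp only: inner_mult_left[of D] inner_mult_right[of "transpose x ** D"] transpose_transpose)
    finally show ?thesis .
  qed
  ultimately have "D \<bullet> D \<le> 0"
    using inner_ge_zero[of "transpose x ** D ** y"] by linarith
  then have "D = 0" by (metis inner_gt_zero_iff not_le)
  then show ?thesis by (simp add: D_def Q_def R_def)
qed

text \<open>The infinitesimal counterpart of \<open>proj_p_inj\<close>, needed as the nondegeneracy
  condition for the inverse function theorem. The same conflict of signs decides it:
  \<open>S ** A ** S = - A\<close> against positivity of \<open>S\<close>.\<close>

lemma proj_p_conj_inj:
  assumes x: "x \<in> Sp_group" and X: "X \<in> p_space" and "proj_p (x ** X ** transpose x) = 0"
  shows "X = 0"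
proof -
  define S A where "S = x ** transpose x" and "A = x ** X ** transpose x"
  have sym: "transpose A = A"
    by (simp add: A_def matrix_expand p_space_transpose[OF X])
  have "proj_p A = 0" using assms(3) by (simp add: A_def)
  then have A: "A = - (J ** A ** J)"
    by (simp add: proj_p_symmetric[OF sym] eq_neg_iff_add_eq_0)
  have "S ** A ** S = - (S ** (J ** A ** J) ** S)"
    by (subst A) (simp add: matrix_expand)
  also have "S ** (J ** A ** J) ** S = A"
    by (simp add: S_def A_def matrix_expand Sp_mult_transpose_J[OF x] p_space_J2[OF X])
  finally have "S ** A ** S = - A" .
  then have "A \<bullet> (S ** A ** S) = - (A \<bullet> A)" by simp
  moreover have "A \<bullet> (S ** A ** S) = (transpose x ** A ** x) \<bullet> (transpose x ** A ** x)"
  proof -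
    have "A \<bullet> (S ** A ** S) = A \<bullet> (x ** ((transpose x ** A ** x) ** transpose x))"
      by (simp add: S_def matrix_expand)
    also have "\<dots> = (transpose x ** A ** x) \<bullet> (transpose x ** A ** x)"
      by (simp only: inner_mult_left[of A] inner_mult_right[of "transpose x ** A"] transpose_transpose)
    finally show ?thesis .
  qed
  ultimately have "A \<bullet> A \<le> 0"
    using inner_ge_zero[of "transpose x ** A ** x"] by linarith
  then have "A = 0" by (metis inner_gt_zero_iff not_le)
  have "X = matrix_inv x ** A ** transpose (matrix_inv x)"
  proof -
    have "matrix_inv x ** A ** transpose (matrix_inv x) =
        (matrix_inv x ** x) ** X ** transpose (matrix_inv x ** x)"
      by (simp add: A_def matrix_expand)
    then show ?thesis by (simp add: Sp_inv[OF x])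
  qed
  with \<open>A = 0\<close> show ?thesis by (simp add: matrix_expand)
qed

section \<open>A trace identity\<close>

text \<open>Parseval's identity in the orthogonal complement of \<open>P1\<close> and
  \<open>P2\<close>: the components of \<open>Z\<close> along these two vectors are removed, and the
  remainder \<open>Z'\<close> is expanded in \<open>B\<close>.\<close>

lemma codim_2_trace:
  fixes P1 P2 :: "'v::euclidean_space"
  assumes V: "subspace V" "P1 \<in> V" "P2 \<in> V"
    and P: "P1 \<bullet> P1 = N" "P2 \<bullet> P2 = N" "P1 \<bullet> P2 = 0" "N > 0"
    and B: "finite B" "pairwise orthogonal B" "\<And>b. b \<in> B \<Longrightarrow> norm b = 1"
      "span B = {X \<in> V. X \<bullet> P1 = 0 \<and> X \<bullet> P2 = 0}"
    and Z: "Z \<in> V"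
  shows "(\<Sum>b\<in>B. (Y \<bullet> b) * (Z \<bullet> b)) = Y \<bullet> Z - ((Y \<bullet> P1) * (Z \<bullet> P1) + (Y \<bullet> P2) * (Z \<bullet> P2)) / N"
proof -
  define Z' where "Z' = Z - (Z \<bullet> P1 / N) *\<^sub>R P1 - (Z \<bullet> P2 / N) *\<^sub>R P2"
  have "Z' \<in> V"
    unfolding Z'_def using V Z by (intro subspace_diff subspace_scale)
  moreover have "Z' \<bullet> P1 = 0" "Z' \<bullet> P2 = 0"
    using P by (simp_all add: Z'_def inner_diff_left inner_commute[of P2 P1])
  ultimately have Z': "Z' \<in> span B" using B(4) by simp
  have b: "Z' \<bullet> b = Z \<bullet> b" if "b \<in> B" for b
  proof -
    have "b \<in> span B" using that by (rule span_base)
    then have "P1 \<bullet> b = 0" "P2 \<bullet> b = 0" unfolding B(4) by (simp_all add: inner_commute)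
    then show ?thesis by (simp add: Z'_def inner_diff_left)
  qed
  have "Y \<bullet> Z' = Y \<bullet> (\<Sum>b\<in>B. (Z' \<bullet> b) *\<^sub>R b)"
    using orthonormal_basis_expand[OF B(2,3) Z' B(1)] by simp
  also have "\<dots> = (\<Sum>b\<in>B. (Y \<bullet> b) * (Z \<bullet> b))"
    by (simp add: inner_sum_right b mult.commute)
  finally have "(\<Sum>b\<in>B. (Y \<bullet> b) * (Z \<bullet> b)) = Y \<bullet> Z'" by simp
  also have "\<dots> = Y \<bullet> Z - ((Y \<bullet> P1) * (Z \<bullet> P1) + (Y \<bullet> P2) * (Z \<bullet> P2)) / N"
    by (simp add: Z'_def inner_diff_right add_divide_distrib mult.commute)
  finally show ?thesis .
qed

lemma sum_axis_inner: "(\<Sum>j\<in>UNIV. (axis j 1 \<bullet> x) * (axis j 1 \<bullet> y)) = x \<bullet> (y :: real^'m)"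
  by (subst inner_vec_def) (simp add: inner_axis')

text \<open>With w = u + i v the first two assumptions say w^t w = 0. Below, \<open>P1\<close> and
  \<open>P2\<close> are the real and imaginary parts of the projection of w w^t, and
  \<open>N\<close> turns out to be their common squared norm.\<close>

locale isotropic_pair =
  fixes u v :: "real^('n::finite + 'n)"
  assumes norm_eq: "u \<bullet> u = v \<bullet> v" and orth: "u \<bullet> v = 0" and nonzero: "u \<noteq> 0"
begin

definition P1 where "P1 = proj_p (tensor u u - tensor v v)"
definition P2 where "P2 = proj_p (tensor u v + tensor v u)"
definition N where "N = (u \<bullet> u) * (u \<bullet> u) + (u \<bullet> (J *v v)) * (u \<bullet> (J *v v))"

lemma N_pos: "N > 0"
  using nonzero unfolding N_def by (intro add_pos_nonneg) auto

lemma P_in: "P1 \<in> p_space" "P2 \<in> p_space"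
  by (simp_all add: P1_def P2_def proj_p_in)

lemma inner_P1: "X \<in> p_space \<Longrightarrow> X \<bullet> P1 = u \<bullet> (X *v u) - v \<bullet> (X *v v)"
  by (simp add: P1_def inner_proj_p inner_diff_right inner_tensor)

lemma inner_P2:
  assumes "X \<in> p_space"
  shows "X \<bullet> P2 = 2 * (u \<bullet> (X *v v))"
proof -
  have "v \<bullet> (X *v u) = u \<bullet> (X *v v)"
    using dot_matrix_mult[of v X u] by (simp add: p_space_transpose[OF assms] inner_commute)
  then show ?thesis
    using assms by (simp add: P2_def inner_proj_p inner_add_right inner_tensor)
qed

lemma dot_J_v_u: "v \<bullet> (J *v u) = - (u \<bullet> (J *v v))"
  by (simp add: dot_J[of v u] inner_commute)

text \<open>Compared pairwise, the right-hand sides give \<open>P1 *v u = P2 *v v\<close> and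
  \<open>P1 *v v = - (P2 *v u)\<close>, which is (P1 + i P2)(u + i v) = 0 written in real
  terms.\<close>

lemma P_apply:
  "P1 *v u = (1 / 2) *\<^sub>R ((u \<bullet> u) *\<^sub>R u + (u \<bullet> (J *v v)) *\<^sub>R (J *v v))"
  "P2 *v v = (1 / 2) *\<^sub>R ((u \<bullet> u) *\<^sub>R u + (u \<bullet> (J *v v)) *\<^sub>R (J *v v))"
  "P1 *v v = - (1 / 2) *\<^sub>R ((u \<bullet> u) *\<^sub>R v - (u \<bullet> (J *v v)) *\<^sub>R (J *v u))"
  "P2 *v u = (1 / 2) *\<^sub>R ((u \<bullet> u) *\<^sub>R v - (u \<bullet> (J *v v)) *\<^sub>R (J *v u))"
  using orth
  by (simp_all add: P1_def P2_def linear_diff[OF linear_proj_p] linear_add[OF linear_proj_p]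
      matrix_vector_mult_diff_rdistrib matrix_vector_mult_add_rdistrib proj_p_tensor dot_J_self
      dot_J_v_u norm_eq[symmetric] inner_commute[of v u] vec_eq_iff field_simps)

lemma inner_P: "P1 \<bullet> P1 = N" "P2 \<bullet> P2 = N" "P1 \<bullet> P2 = 0"
  using orth
  by (simp_all add: inner_P1 inner_P2 P_in P_apply N_def inner_add_right inner_diff_right dot_J_self
      dot_J_v_u norm_eq[symmetric] inner_commute[of v u] field_simps)

text \<open>Coordinate j of \<open>b *v y\<close> is the inner product of \<open>b\<close> with the
  projection of the rank one matrix built from the j-th axis and \<open>y\<close>, so
  \<open>codim_2_trace\<close> evaluates the sum over \<open>B\<close> for each j. The constant (2n
  + 2) / 4 arises from \<open>proj_p_tensor\<close>: summed over j, one term contributes 2n times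
  \<open>y \<bullet> z\<close>, and the terms from the identity and from \<open>J\<close> contribute
  it once each.\<close>

lemma trace_formula:
  assumes B: "finite B" "pairwise orthogonal B" "\<And>b. b \<in> B \<Longrightarrow> norm b = 1"
      "span B = {X \<in> p_space. u \<bullet> (X *v u) = v \<bullet> (X *v v) \<and> u \<bullet> (X *v v) = 0}"
  shows "(\<Sum>b\<in>B. (b *v y) \<bullet> (b *v z)) = (CARD('n + 'n) + 2) / 4 * (y \<bullet> z)
    - ((P1 *v y) \<bullet> (P1 *v z) + (P2 *v y) \<bullet> (P2 *v z)) / N"
proof -
  have span: "span B = {X \<in> p_space. X \<bullet> P1 = 0 \<and> X \<bullet> P2 = 0}"
    unfolding B(4) by (auto simp: inner_P1 inner_P2)
  have b: "b \<in> p_space" if "b \<in> B" for b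
    using span_base[OF that] unfolding B(4) by blast
  let ?e = "\<lambda>j. axis j 1 :: real^('n + 'n)"
  let ?A = "\<lambda>j y. proj_p (tensor (?e j) y)"
  have A: "?A j y \<bullet> X = ?e j \<bullet> (X *v y)" if "X \<in> p_space" for j y X
    using that by (simp add: inner_commute[of _ X] inner_proj_p inner_tensor)
  have "(\<Sum>b\<in>B. (b *v y) \<bullet> (b *v z)) = (\<Sum>b\<in>B. \<Sum>j\<in>UNIV. (?A j y \<bullet> b) * (?A j z \<bullet> b))"
    by (intro sum.cong refl) (simp add: A b sum_axis_inner)
  also have "\<dots> = (\<Sum>j\<in>UNIV. \<Sum>b\<in>B. (?A j y \<bullet> b) * (?A j z \<bullet> b))"
    by (rule sum.swap)
  also have "\<dots> = (\<Sum>j\<in>UNIV. ?A j y \<bullet> ?A j z -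
      ((?A j y \<bullet> P1) * (?A j z \<bullet> P1) + (?A j y \<bullet> P2) * (?A j z \<bullet> P2)) / N)"
    by (intro sum.cong refl codim_2_trace[OF subspace_p_space P_in inner_P N_pos B(1-3) span proj_p_in])
  also have "\<dots> = (\<Sum>j\<in>UNIV. ?A j y \<bullet> ?A j z) -
      ((\<Sum>j\<in>UNIV. (?e j \<bullet> (P1 *v y)) * (?e j \<bullet> (P1 *v z))) +
       (\<Sum>j\<in>UNIV. (?e j \<bullet> (P2 *v y)) * (?e j \<bullet> (P2 *v z)))) / N"
    by (simp add: A P_in sum_subtractf sum.distrib sum_divide_distrib[symmetric])
  also have "(\<Sum>j\<in>UNIV. ?A j y \<bullet> ?A j z) = (\<Sum>j\<in>UNIV. (1 / 4) *
      ((z \<bullet> y) + (?e j \<bullet> y) * (?e j \<bullet> z) + (?e j \<bullet> (J *v y)) * (?e j \<bullet> (J *v z))))"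
  proof (intro sum.cong refl)
    fix j
    have "?A j y \<bullet> ?A j z = ?e j \<bullet> (?A j z *v y)"
      by (rule A) (rule proj_p_in)
    then show "?A j y \<bullet> ?A j z = (1 / 4) *
      ((z \<bullet> y) + (?e j \<bullet> y) * (?e j \<bullet> z) + (?e j \<bullet> (J *v y)) * (?e j \<bullet> (J *v z)))"
      by (simp add: proj_p_tensor inner_add_right dot_J_self inner_axis_axis)
  qed
  also have "\<dots> = (CARD('n + 'n) + 2) / 4 * (y \<bullet> z)"
    by (simp only: sum_distrib_left[symmetric] sum.distrib sum_axis_inner dot_J_J inner_commute[of z y])
      (simp add: field_simps)
  finally show ?thesis by (simp add: sum_axis_inner)
qed

text \<open>The real and imaginary parts of the vanishing of the sum of (b w)^t (b w) over
  \<open>B\<close>. In \<open>trace_formula\<close> the main term drops out because w^t w = 0, and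
  the correction because (P1 + i P2) w = 0.\<close>

theorem harmonic_sum:
  assumes B: "finite B" "pairwise orthogonal B" "\<And>b. b \<in> B \<Longrightarrow> norm b = 1"
      "span B = {X \<in> p_space. u \<bullet> (X *v u) = v \<bullet> (X *v v) \<and> u \<bullet> (X *v v) = 0}"
  shows "(\<Sum>b\<in>B. (b *v u) \<bullet> (b *v u)) = (\<Sum>b\<in>B. (b *v v) \<bullet> (b *v v))"
    and "(\<Sum>b\<in>B. (b *v u) \<bullet> (b *v v)) = 0"
proof -
  have P: "P1 *v u = P2 *v v" "P1 *v v = - (P2 *v u)"
    by (simp_all add: P_apply)
  show "(\<Sum>b\<in>B. (b *v u) \<bullet> (b *v u)) = (\<Sum>b\<in>B. (b *v v) \<bullet> (b *v v))"
    by (simp only: trace_formula[OF B, of u u] trace_formula[OF B, of v v]) (simp add: P norm_eq add.commute)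
  show "(\<Sum>b\<in>B. (b *v u) \<bullet> (b *v v)) = 0"
    by (simp only: trace_formula[OF B, of u v]) (simp add: P orth inner_commute)
qed

end

section \<open>Tangent and horizontal vectors\<close>

definition sp_algebra :: "(real^('n::finite + 'n)^('n + 'n)) set" where
  "sp_algebra = {X. X ** J + J ** transpose X = 0}"

lemma sp_algebra_sym_part:
  assumes "X \<in> sp_algebra"
  shows "(1 / 2) *\<^sub>R (X + transpose X) \<in> p_space" and "X - transpose X \<in> sp_algebra"
proof -
  have 1: "X ** J = - (J ** transpose X)"
    using assms by (simp add: sp_algebra_def eq_neg_iff_add_eq_0)
  have "J ** (X ** J) ** J = J ** (- (J ** transpose X)) ** J" by (simp only: 1)
  then have 2: "transpose X ** J = - (J ** X)"
    by (simp add: matrix_expand J_simps)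
  show "(1 / 2) *\<^sub>R (X + transpose X) \<in> p_space"
    by (simp add: p_space_def matrix_expand 1 2 algebra_simps)
  show "X - transpose X \<in> sp_algebra"
    by (simp add: sp_algebra_def matrix_expand 1 2)
qed

lemma sp_algebra_scaleR: "X \<in> sp_algebra \<Longrightarrow> c *\<^sub>R X \<in> sp_algebra"
  by (simp add: sp_algebra_def matrix_expand scaleR_add_right[symmetric] del: scaleR_add_right)

lemma p_space_subset_sp_algebra: "p_space \<subseteq> sp_algebra"
  by (auto simp: p_space_def sp_algebra_def)

lemma symmetric_sp_algebra: "X \<in> sp_algebra \<Longrightarrow> transpose X = X \<Longrightarrow> X \<in> p_space"
  by (simp add: p_space_def sp_algebra_def eq_neg_iff_add_eq_0)

section \<open>The Cayley transform, used in place of the exponential map\<close>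

definition cayley :: "real^'m^'m \<Rightarrow> real^'m^'m" where
  "cayley X = matrix_inv (mat 1 - X) ** (mat 1 + X)"

text \<open>The transform carries infinitesimal isometries of the bilinear form \<open>K\<close> to
  isometries. It is applied with \<open>K = J\<close> for the symplectic group and with
  \<open>K = mat 1\<close> for orthogonality; being rational, it is smooth once matrix inversion
  is.\<close>

lemma cayley_preserves:
  fixes X :: "real^'m^'m"
  assumes det: "det (mat 1 - X) \<noteq> 0"
    and eq: "(mat 1 + X) ** K ** transpose (mat 1 + X) = (mat 1 - X) ** K ** transpose (mat 1 - X)"
  shows "cayley X ** K ** transpose (cayley X) = K"
proof -
  let ?R = "matrix_inv (mat 1 - X)"
  have R: "?R ** (mat 1 - X) = mat 1" using det by (simp add: invertible_det_nz matrix_inv_mult)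
  have "cayley X ** K ** transpose (cayley X) =
      ?R ** ((mat 1 + X) ** K ** transpose (mat 1 + X)) ** transpose ?R"
    unfolding cayley_def matrix_transpose_mul by (simp only: matrix_mul_assoc)
  also have "\<dots> = (?R ** (mat 1 - X)) ** K ** transpose (?R ** (mat 1 - X))"
    unfolding eq matrix_transpose_mul by (simp only: matrix_mul_assoc)
  finally show ?thesis by (simp add: R)
qed

lemma cayley_Sp:
  assumes "det (mat 1 - X) \<noteq> 0" "X \<in> sp_algebra"
  shows "cayley X \<in> Sp_group"
proof -
  have "X ** J = - (J ** transpose X)"
    using assms(2) by (simp add: sp_algebra_def eq_neg_iff_add_eq_0)
  then have "(mat 1 + X) ** J ** transpose (mat 1 + X) = (mat 1 - X) ** J ** transpose (mat 1 - X)"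
    by (simp add: matrix_expand)
  from cayley_preserves[OF assms(1) this] show ?thesis by (simp add: Sp_group_iff)
qed

lemma cayley_orthogonal:
  assumes "det (mat 1 - X) \<noteq> 0" "transpose X = - X"
  shows "cayley X ** transpose (cayley X) = mat 1"
proof -
  have "(mat 1 + X) ** mat 1 ** transpose (mat 1 + X) = (mat 1 - X) ** mat 1 ** transpose (mat 1 - X)"
    by (simp add: matrix_expand assms(2))
  from cayley_preserves[OF assms(1) this] show ?thesis by simp
qed

lemma open_cayley_domain: "open {X :: real^'m^'m. det (mat 1 - X) \<noteq> 0}"
proof -
  have "smooth_on UNIV (\<lambda>X :: real^'m^'m. mat 1 - X)"
    by (intro smooth_on_diff smooth_on_const smooth_on_id) auto
  from smooth_on_continuous[OF smooth_on_det[OF this open_UNIV]] show ?thesis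
    by (intro open_Collect_neq) auto
qed

lemma smooth_on_cayley: "smooth_on {X :: real^'m^'m. det (mat 1 - X) \<noteq> 0} cayley"
  unfolding cayley_def
  by (intro smooth_on_matrix_mult smooth_on_matrix_inv smooth_on_diff smooth_on_add smooth_on_const
      smooth_on_id open_cayley_domain) simp

lemma cayley_0: "cayley 0 = mat 1"
  using matrix_inv_mult(1)[of "mat 1 :: real^'a^'a"] by (simp add: cayley_def invertible_det_nz)

text \<open>Differentiating (1 - X) cayley(X) = 1 + X at 0 gives D H - H = H for the derivative D,
  hence the factor 2.\<close>

lemma has_derivative_cayley: "(cayley has_derivative (\<lambda>H :: real^'m^'m. 2 *\<^sub>R H)) (at 0)"
proof -
  let ?T = "{X :: real^'m^'m. det (mat 1 - X) \<noteq> 0}"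
  let ?D = "frechet_derivative cayley (at (0 :: real^'m^'m))"
  have T: "0 \<in> ?T" by simp
  have der: "(cayley has_derivative ?D) (at 0)"
    by (rule smooth_on_has_derivative[OF smooth_on_cayley T])
  have minus: "((\<lambda>X :: real^'m^'m. mat 1 - X) has_derivative (\<lambda>H. - H)) (at 0)"
    by (auto intro!: derivative_eq_intros)
  have plus: "((\<lambda>X :: real^'m^'m. mat 1 + X) has_derivative (\<lambda>H. H)) (at 0)"
    by (auto intro!: derivative_eq_intros)
  have "((\<lambda>X. (mat 1 - X) ** cayley X) has_derivative
      (\<lambda>H. (mat 1 - 0) ** ?D H + (- H) ** cayley 0)) (at 0)"
    by (rule bounded_bilinear.FDERIV[OF bounded_bilinear_matrix_mult minus der])
  then have "((\<lambda>X. mat 1 + X) has_derivative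
      (\<lambda>H. (mat 1 - 0) ** ?D H + (- H) ** cayley 0)) (at 0)"
  proof (rule has_derivative_transform_within_open[OF _ open_cayley_domain T])
    fix X :: "real^'m^'m"
    assume "X \<in> ?T"
    then show "(mat 1 - X) ** cayley X = mat 1 + X"
      by (simp add: cayley_def matrix_mul_assoc invertible_det_nz matrix_inv_mult)
  qed
  then have "(\<lambda>H. (mat 1 - 0) ** ?D H + (- H) ** cayley 0) = (\<lambda>H. H)"
    using plus by (rule has_derivative_unique)
  then have "?D H - H = H" for H
    by (simp add: fun_eq_iff cayley_0 matrix_mult_minus_left)
  then have "?D = (\<lambda>H. 2 *\<^sub>R H)"
    by (simp add: fun_eq_iff scaleR_2 diff_eq_eq del: mult_2)
  with der show ?thesis by simp
qed

text \<open>Velocities are defined by curves that stay in the set for all real times, so the curve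
  is held at the identity wherever the transform is undefined; this is the case
  \<open>s = 0\<close>. The parameter \<open>t / 2\<close> compensates the derivative 2 of the
  transform.\<close>

lemma cayley_curve:
  fixes X :: "real^'m^'m"
  obtains \<gamma> where "\<gamma> 0 = mat 1" "(\<gamma> has_vector_derivative X) (at 0)"
    "\<And>t. \<exists>s. det (mat 1 - s *\<^sub>R X) \<noteq> 0 \<and> \<gamma> t = cayley (s *\<^sub>R X)"
proof -
  let ?T = "{Y :: real^'m^'m. det (mat 1 - Y) \<noteq> 0}"
  let ?l = "\<lambda>t. (t / 2) *\<^sub>R X"
  let ?g = "\<lambda>t. if ?l t \<in> ?T then cayley (?l t) else mat 1"
  have 1: "?g 0 = mat 1" by (simp add: cayley_0)
  have l: "(?l has_derivative (\<lambda>h. (h / 2) *\<^sub>R X)) (at 0)"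
    by (auto intro!: derivative_eq_intros)
  have "((\<lambda>t. cayley (?l t)) has_derivative (\<lambda>h. 2 *\<^sub>R ((h / 2) *\<^sub>R X))) (at 0)"
    by (rule has_derivative_compose[OF l]) (simp add: has_derivative_cayley)
  then have "((\<lambda>t. cayley (?l t)) has_vector_derivative X) (at 0)"
    by (simp add: has_vector_derivative_def)
  moreover have "open (?l -` ?T)"
    by (intro open_vimage open_cayley_domain continuous_intros) auto
  ultimately have 2: "(?g has_vector_derivative X) (at 0)"
    by (rule has_vector_derivative_transform_within_open) auto
  have 3: "\<exists>s. det (mat 1 - s *\<^sub>R X) \<noteq> 0 \<and> ?g t = cayley (s *\<^sub>R X)" for t
  proof (cases "?l t \<in> ?T")
    case True
    then show ?thesis by (intro exI[of _ "t / 2"]) simp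
  next
    case False
    then show ?thesis by (intro exI[of _ 0]) (simp add: cayley_0)
  qed
  show thesis by (rule that[OF 1 2 3])
qed

section \<open>Tangent vectors of the group and of the fibres\<close>

lemma has_vector_derivative_matrix_mult:
  fixes f :: "real \<Rightarrow> real^'m^'k" and g :: "real \<Rightarrow> real^'l^'m"
  shows "(f has_vector_derivative f') (at t) \<Longrightarrow> (g has_vector_derivative g') (at t) \<Longrightarrow>
    ((\<lambda>t. f t ** g t) has_vector_derivative (f t ** g' + f' ** g t)) (at t)"
  by (rule bounded_bilinear.has_vector_derivative[OF bounded_bilinear_matrix_mult])

lemma has_vector_derivative_transpose:
  fixes f :: "real \<Rightarrow> real^'m^'k"
  shows "(f has_vector_derivative f') F \<Longrightarrow> ((\<lambda>t. transpose (f t)) has_vector_derivative transpose f') F"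
  by (rule bounded_linear.has_vector_derivative)
    (simp_all add: linear_conv_bounded_linear[symmetric] linear_transpose)

lemma has_vector_derivative_left_mult:
  fixes f :: "real \<Rightarrow> real^'l^'m"
  shows "(f has_vector_derivative f') F \<Longrightarrow> ((\<lambda>t. A ** f t) has_vector_derivative A ** f') F"
  by (rule bounded_linear.has_vector_derivative)
    (simp_all add: linear_conv_bounded_linear[symmetric] linear_matrix_mult_left)

lemma Sp_curve:
  assumes "x \<in> Sp_group" "X \<in> sp_algebra"
  obtains \<gamma> where "curve_with_velocity Sp_group \<gamma> x (x ** X)"
proof -
  obtain \<gamma> where \<gamma>: "\<gamma> 0 = mat 1" "(\<gamma> has_vector_derivative X) (at 0)"
    "\<And>t. \<exists>s. det (mat 1 - s *\<^sub>R X) \<noteq> 0 \<and> \<gamma> t = cayley (s *\<^sub>R X)"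
    using cayley_curve[of X] by blast
  have sp: "s *\<^sub>R X \<in> sp_algebra" for s
    using assms(2) by (rule sp_algebra_scaleR)
  have "\<gamma> t \<in> Sp_group" for t
    using \<gamma>(3)[of t] cayley_Sp[OF _ sp] by metis
  then have "curve_with_velocity Sp_group (\<lambda>t. x ** \<gamma> t) x (x ** X)"
    using assms \<gamma> by (simp add: curve_with_velocity_def Sp_mult has_vector_derivative_left_mult)
  then show thesis by (rule that)
qed

lemma fibre_curve:
  assumes "x \<in> Sp_group" "X \<in> sp_algebra" "transpose X = - X"
  obtains \<gamma> where "curve_with_velocity (coset U_group x) \<gamma> x (x ** X)"
proof -
  obtain \<gamma> where \<gamma>: "\<gamma> 0 = mat 1" "(\<gamma> has_vector_derivative X) (at 0)"
    "\<And>t. \<exists>s. det (mat 1 - s *\<^sub>R X) \<noteq> 0 \<and> \<gamma> t = cayley (s *\<^sub>R X)"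
    using cayley_curve[of X] by blast
  have sp: "s *\<^sub>R X \<in> sp_algebra" "transpose (s *\<^sub>R X) = - (s *\<^sub>R X)" for s
    using assms(2,3) by (simp_all add: sp_algebra_scaleR transpose_scalar)
  have "cayley (s *\<^sub>R X) \<in> U_group" if "det (mat 1 - s *\<^sub>R X) \<noteq> 0" for s
    unfolding U_group_eq using cayley_Sp[OF that sp(1)] cayley_orthogonal[OF that sp(2)] by blast
  then have "\<gamma> t \<in> U_group" for t
    using \<gamma>(3)[of t] by metis
  then have "curve_with_velocity (coset U_group x) (\<lambda>t. x ** \<gamma> t) x (x ** X)"
    using assms \<gamma> by (simp add: curve_with_velocity_def has_vector_derivative_left_mult coset_def)
  then show thesis by (rule that)
qed

text \<open>The linearization of the quadratic equations that cut out the group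
  (\<open>K = J\<close>) and the fibre through a point (\<open>K = mat 1\<close>).\<close>

lemma constant_product_derivative:
  fixes \<gamma> :: "real \<Rightarrow> real^'m^'m"
  assumes "\<And>t. \<gamma> t ** K ** transpose (\<gamma> t) = C" "(\<gamma> has_vector_derivative X) (at 0)"
  shows "X ** K ** transpose (\<gamma> 0) + \<gamma> 0 ** K ** transpose X = 0"
proof -
  have "((\<lambda>t. \<gamma> t ** (K ** transpose (\<gamma> t))) has_vector_derivative
      (\<gamma> 0 ** (K ** transpose X) + X ** (K ** transpose (\<gamma> 0)))) (at 0)"
    using assms(2)
    by (intro has_vector_derivative_matrix_mult has_vector_derivative_left_mult has_vector_derivative_transpose)
  then have "((\<lambda>t. C) has_vector_derivative
      (\<gamma> 0 ** (K ** transpose X) + X ** (K ** transpose (\<gamma> 0)))) (at 0)"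
    unfolding matrix_mul_assoc assms(1) .
  then have "\<gamma> 0 ** (K ** transpose X) + X ** (K ** transpose (\<gamma> 0)) = 0"
    using has_vector_derivative_const vector_derivative_unique_at by blast
  then show ?thesis by (simp add: matrix_mul_assoc add.commute)
qed

lemma conj_eq_0_iff:
  assumes "x \<in> Sp_group"
  shows "x ** A ** transpose x = 0 \<longleftrightarrow> A = 0"
proof
  assume "x ** A ** transpose x = 0"
  then have "matrix_inv x ** (x ** A ** transpose x) ** transpose (matrix_inv x) = 0"
    by (simp add: matrix_expand)
  moreover have "matrix_inv x ** (x ** A ** transpose x) ** transpose (matrix_inv x) =
     (matrix_inv x ** x) ** A ** transpose (matrix_inv x ** x)"
    by (simp add: matrix_expand)
  ultimately show "A = 0" by (simp add: Sp_inv[OF assms])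
qed (simp add: matrix_expand)

lemma Sp_tangent:
  assumes "x \<in> Sp_group" "x ** X \<in> tangent_space Sp_group x"
  shows "X \<in> sp_algebra"
proof -
  obtain \<gamma> where \<gamma>: "\<gamma> 0 = x" "\<And>t. \<gamma> t \<in> Sp_group" "(\<gamma> has_vector_derivative x ** X) (at 0)"
    using assms(2) by (auto simp: tangent_space_def curve_with_velocity_def)
  have "x ** X ** J ** transpose x + x ** J ** transpose (x ** X) = 0"
    using constant_product_derivative[OF _ \<gamma>(3), of J J] \<gamma>(1,2) Sp_groupD by blast
  then have "x ** (X ** J + J ** transpose X) ** transpose x = 0"
    by (simp add: matrix_expand)
  then show ?thesis
    by (simp add: conj_eq_0_iff assms(1) sp_algebra_def)
qed

lemma fibre_tangent:
  assumes "x \<in> Sp_group" "x ** X \<in> tangent_space (coset U_group x) x"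
  shows "transpose X = - X"
proof -
  obtain \<gamma> where \<gamma>: "\<gamma> 0 = x" "\<And>t. \<gamma> t \<in> coset U_group x" "(\<gamma> has_vector_derivative x ** X) (at 0)"
    using assms(2) by (auto simp: tangent_space_def curve_with_velocity_def)
  have "\<gamma> t ** mat 1 ** transpose (\<gamma> t) = x ** transpose x" for t
  proof -
    obtain k where k: "k \<in> U_group" "\<gamma> t = x ** k" using \<gamma>(2)[of t] by (auto simp: coset_def)
    have "\<gamma> t ** transpose (\<gamma> t) = x ** (k ** transpose k) ** transpose x"
      by (simp add: k(2) matrix_expand)
    with k(1) show ?thesis by (simp add: U_group_eq)
  qed
  from constant_product_derivative[OF this \<gamma>(3)]
  have "x ** (X + transpose X) ** transpose x = 0"
    by (simp add: \<gamma>(1) matrix_expand)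
  then show ?thesis
    by (simp add: conj_eq_0_iff assms(1) eq_neg_iff_add_eq_0 add.commute)
qed

section \<open>The left-invariant metric and horizontal vectors\<close>

lemma GL_metric_cmat:
  fixes x :: "real^'m^'m"
  assumes "invertible x"
  shows "GL_metric (cmat x) (cmat X) (cmat Y) = (matrix_inv x ** X) \<bullet> (matrix_inv x ** Y)"
proof -
  have one: "cmat (mat 1 :: real^'m^'m) = mat 1"
    by (simp add: cmat_def mat_def vec_eq_iff)
  have r: "cmat x ** cmat (matrix_inv x) = mat 1" "cmat (matrix_inv x) ** cmat x = mat 1"
    using matrix_inv_mult[OF assms] one by (simp_all flip: cmat_mult)
  then have "invertible (cmat x)" unfolding invertible_def by blast
  then have "matrix_inv (cmat x) = matrix_inv (cmat x) ** (cmat x ** cmat (matrix_inv x))"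
    by (simp add: r)
  also have "\<dots> = cmat (matrix_inv x)"
    using \<open>invertible (cmat x)\<close> by (simp add: matrix_mul_assoc matrix_inv_mult)
  finally have inv: "matrix_inv (cmat x) = cmat (matrix_inv x)" .
  have "Re (trace (cmat A ** conj_transpose (cmat B))) = A \<bullet> B" for A B :: "real^'m^'m"
    by (simp add: trace_def matrix_matrix_mult_def cmat_def conj_transpose_def inner_vec_def)
  then show ?thesis
    unfolding GL_metric_def inv by (simp flip: cmat_mult)
qed

lemma GL_metric_left_translate:
  assumes "x \<in> Sp_group"
  shows "GL_metric (cmat x) (cmat (x ** X)) (cmat (x ** Y)) = X \<bullet> Y"
  by (simp add: GL_metric_cmat Sp_invertible assms matrix_mul_assoc Sp_inv)

text \<open>Vertical vectors at \<open>x\<close> are \<open>x\<close> times skew elements of the Lie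
  algebra. A horizontal vector is tested against its own skew part, which must then vanish;
  conversely symmetric and skew matrices are orthogonal.\<close>

lemma horizontal_space_iff:
  assumes x: "x \<in> Sp_group"
  shows "x ** X \<in> horizontal_space Sp_group U_group x \<longleftrightarrow> X \<in> p_space"
proof
  assume h: "x ** X \<in> horizontal_space Sp_group U_group x"
  then have X: "X \<in> sp_algebra" using Sp_tangent[OF x] by (simp add: horizontal_space_def)
  define Y where "Y = X - transpose X"
  have Y: "Y \<in> sp_algebra" "transpose Y = - Y"
    using sp_algebra_sym_part(2)[OF X] by (simp_all add: Y_def transpose_diff)
  obtain \<gamma> where "curve_with_velocity (coset U_group x) \<gamma> x (x ** Y)"
    using fibre_curve[OF x Y] by blast
  then have "x ** Y \<in> tangent_space (coset U_group x) x"
    by (auto simp: tangent_space_def)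
  then have "GL_metric (cmat x) (cmat (x ** X)) (cmat (x ** Y)) = 0"
    using h by (auto simp: horizontal_space_def)
  then have XY: "X \<bullet> Y = 0" by (simp add: GL_metric_left_translate x)
  moreover have "transpose X \<bullet> Y = - (X \<bullet> Y)"
    using inner_transpose[of X Y] Y(2) by simp
  ultimately have "Y \<bullet> Y = 0" by (simp add: Y_def inner_diff_left)
  then have "transpose X = X" by (simp add: Y_def)
  with X show "X \<in> p_space" by (rule symmetric_sp_algebra)
next
  assume X: "X \<in> p_space"
  then have "X \<in> sp_algebra" using p_space_subset_sp_algebra by blast
  then obtain \<gamma> where "curve_with_velocity Sp_group \<gamma> x (x ** X)"
    using Sp_curve[OF x] by blast
  then have t: "x ** X \<in> tangent_space Sp_group x" by (auto simp: tangent_space_def)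
  have "GL_metric (cmat x) (cmat (x ** X)) (cmat Y) = 0"
    if "Y \<in> tangent_space (coset U_group x) x" for Y
  proof -
    define Z where "Z = matrix_inv x ** Y"
    have Y: "Y = x ** Z" by (simp add: Z_def matrix_mul_assoc Sp_inv x)
    have "transpose Z = - Z" using that unfolding Y by (rule fibre_tangent[OF x])
    then have "X \<bullet> Z = - (X \<bullet> Z)"
      using inner_transpose[of X Z] p_space_transpose[OF X] by simp
    then show ?thesis by (simp add: Y GL_metric_left_translate x)
  qed
  with t show "x ** X \<in> horizontal_space Sp_group U_group x"
    by (simp add: horizontal_space_def)
qed

section \<open>The metric in a chart\<close>

definition gram :: "(real^'m^'m) set \<Rightarrow> real^'m^'m" where
  "gram C = (THE S. \<forall>x\<in>C. S = x ** transpose x)"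

lemma one_in_U_group: "mat 1 \<in> U_group"
  by (simp add: U_group_eq Sp_one)

lemma in_own_coset: "x \<in> coset U_group x"
  using one_in_U_group by (force simp: coset_def)

lemma coset_gram: "y \<in> coset U_group x \<Longrightarrow> y ** transpose y = x ** transpose x"
proof -
  assume "y \<in> coset U_group x"
  then obtain k where k: "k \<in> U_group" "y = x ** k" by (auto simp: coset_def)
  have "y ** transpose y = x ** (k ** transpose k) ** transpose x"
    by (simp add: k(2) matrix_expand)
  with k(1) show ?thesis by (simp add: U_group_eq)
qed

lemma gram_coset: "gram (coset U_group x) = x ** transpose x"
  unfolding gram_def
proof (rule the_equality)
  show "\<forall>y\<in>coset U_group x. x ** transpose x = y ** transpose y"
    using coset_gram[of _ x] by simp
  show "S = x ** transpose x" if "\<forall>y\<in>coset U_group x. S = y ** transpose y" for S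
    using that in_own_coset by blast
qed

lemma coset_subset_Sp: "x \<in> Sp_group \<Longrightarrow> coset U_group x \<subseteq> Sp_group"
  using U_group_subset by (auto simp: coset_def Sp_mult)

lemma coset_eq_of_mem:
  assumes "x \<in> Sp_group" "y \<in> coset U_group x"
  shows "coset U_group y = coset U_group x"
proof -
  have "y \<in> Sp_group" using assms coset_subset_Sp by blast
  then show ?thesis using assms coset_gram by (simp add: coset_eq_iff)
qed

text \<open>For A and C tangent at a symplectic symmetric S, differentiating the formula for the
  inverse of S shows that J A J is A multiplied by the inverse of S on both sides, so this is a
  quarter of the usual invariant metric on positive definite matrices. In the present form it has
  constant coefficients. The quarter compensates the factor 2 in the derivative
  \<open>2 *\<^sub>R (x ** X ** transpose x)\<close> of the Gram matrix.\<close>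

definition bform :: "real^('n::finite + 'n)^('n + 'n) \<Rightarrow> real^('n + 'n)^('n + 'n) \<Rightarrow> real" where
  "bform A C = trace (J ** A ** J ** C) / 4"

lemma trace_conj:
  assumes "x \<in> Sp_group"
  shows "trace (J ** (x ** A ** transpose x) ** J ** (x ** C ** transpose x)) = trace (J ** A ** J ** C)"
proof -
  have "trace (J ** (x ** A ** transpose x) ** J ** (x ** C ** transpose x)) =
      trace ((J ** x ** A ** transpose x ** J ** x ** C) ** transpose x)"
    by (simp add: matrix_mul_assoc)
  also have "\<dots> = trace (transpose x ** (J ** x ** A ** transpose x ** J ** x ** C))"
    by (rule trace_mul_sym)
  finally show ?thesis by (simp add: matrix_expand Sp_mult_transpose_J[OF assms])
qed

lemma bform_conj:
  assumes "x \<in> Sp_group" "X \<in> p_space" "Y \<in> p_space"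
  shows "bform (2 *\<^sub>R (x ** X ** transpose x)) (2 *\<^sub>R (x ** Y ** transpose x)) = X \<bullet> Y"
proof -
  have "J ** X ** J ** Y = X ** Y"
    using p_space_J[OF assms(2)] by (simp add: matrix_mul_assoc)
  then show ?thesis
    using trace_conj[OF assms(1), of X Y] p_space_transpose[OF assms(3)]
    by (simp add: bform_def matrix_mult_scaleR_left matrix_mult_scaleR_right trace_scaleR inner_matrix)
qed

lemma linear_trace: "linear (trace :: real^'m^'m \<Rightarrow> real)"
  by (rule linearI) (simp_all add: trace_add trace_scaleR)

lemma bounded_bilinear_bform: "bounded_bilinear bform"
  unfolding bilinear_conv_bounded_bilinear[symmetric] bilinear_def bform_def
  by (auto intro!: linearI simp: matrix_expand trace_add trace_scaleR add_divide_distrib)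

lemma bform_commute: "bform A C = bform C A"
proof -
  have "trace ((J ** A) ** (J ** C)) = trace ((J ** C) ** (J ** A))" by (rule trace_mul_sym)
  then show ?thesis by (simp add: bform_def matrix_mul_assoc)
qed

section \<open>An arbitrary chart of the quotient and its horizontal lifts\<close>

locale sp_chart =
  fixes U :: "(real^('n::finite + 'n)^('n + 'n)) set set"
    and \<phi> :: "(real^('n + 'n)^('n + 'n)) set \<Rightarrow> 'e::euclidean_space"
  assumes chart: "(U, \<phi>) \<in> quotient_atlas Sp_group U_group"
begin

lemma openin_U: "openin (quotient_topology Sp_group U_group) U"
  and inj_\<phi>: "inj_on \<phi> U" and open_image: "open (\<phi> ` U)"
  and forward: "x \<in> Sp_group \<Longrightarrow> coset U_group x \<in> U \<Longrightarrow>
    \<exists>V F. open V \<and> x \<in> V \<and> smooth_on V F \<and>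
      (\<forall>x' \<in> V \<inter> Sp_group. coset U_group x' \<in> U \<longrightarrow> F x' = \<phi> (coset U_group x'))"
  and lift: "y \<in> \<phi> ` U \<Longrightarrow> \<exists>W \<sigma>. open W \<and> y \<in> W \<and> W \<subseteq> \<phi> ` U \<and> smooth_on W \<sigma> \<and>
    (\<forall>z\<in>W. \<sigma> z \<in> Sp_group \<and> coset U_group (\<sigma> z) \<in> U \<and> \<phi> (coset U_group (\<sigma> z)) = z)"
  using chart unfolding quotient_atlas_def mem_Collect_eq case_prod_conv by blast+

definition S :: "'e \<Rightarrow> real^('n + 'n)^('n + 'n)" where
  "S z = gram (inv_into U \<phi> z)"

definition D :: "'e \<Rightarrow> 'e \<Rightarrow> real^('n + 'n)^('n + 'n)" where
  "D z v = frechet_derivative S (at z) v"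

lemma S_coset: "coset U_group x \<in> U \<Longrightarrow> S (\<phi> (coset U_group x)) = x ** transpose x"
  by (simp add: S_def inv_into_f_f inj_\<phi> gram_coset)

lemma smooth_S: "smooth_on (\<phi> ` U) S"
proof (rule smooth_on_local)
  fix y assume "y \<in> \<phi> ` U"
  from lift[OF this] obtain W \<sigma> where W: "open W" "y \<in> W" "smooth_on W \<sigma>"
    "\<And>z. z \<in> W \<Longrightarrow> coset U_group (\<sigma> z) \<in> U \<and> \<phi> (coset U_group (\<sigma> z)) = z" by blast
  have "smooth_on W (\<lambda>z. \<sigma> z ** transpose (\<sigma> z))"
    by (intro smooth_on_matrix_mult smooth_on_linear[OF linear_transpose] W)
  moreover have "\<sigma> z ** transpose (\<sigma> z) = S z" if "z \<in> W" for z
    using S_coset W(4)[OF that] by metis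
  ultimately have "smooth_on W S" using W(1) by (intro smooth_on_cong[of W _ S])
  with W show "\<exists>T. open T \<and> y \<in> T \<and> smooth_on T S" by blast
qed

lemma has_derivative_S: "y \<in> \<phi> ` U \<Longrightarrow> (S has_derivative D y) (at y)"
  unfolding D_def using smooth_on_has_derivative[OF smooth_S] by blast

lemma linear_D: "y \<in> \<phi> ` U \<Longrightarrow> linear (D y)"
  using has_derivative_S has_derivative_linear by blast

lemma smooth_D: "smooth_on (\<phi> ` U) (\<lambda>y. D y v)"
  unfolding D_def by (rule smooth_on_frechet_derivative[OF smooth_S])

lemma preimage_open: obtains T where "open T" "{x \<in> Sp_group. coset U_group x \<in> U} = Sp_group \<inter> T"
  using openin_U unfolding openin_quotient_topology openin_open by blast

lemma curve_in_domain:
  assumes "x \<in> Sp_group" "coset U_group x \<in> U" "curve_with_velocity Sp_group \<gamma> x X"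
    and "open V" "x \<in> V"
  obtains T where "open T" "0 \<in> T" "\<And>t. t \<in> T \<Longrightarrow> \<gamma> t \<in> V \<and> coset U_group (\<gamma> t) \<in> U"
proof -
  obtain V' where V': "open V'" "{x \<in> Sp_group. coset U_group x \<in> U} = Sp_group \<inter> V'"
    by (rule preimage_open)
  have \<gamma>: "\<gamma> 0 = x" "\<And>t. \<gamma> t \<in> Sp_group" "isCont \<gamma> 0"
    using assms(3) has_vector_derivative_continuous by (auto simp: curve_with_velocity_def)
  have "x \<in> V \<inter> V'" using assms V' by blast
  then have "eventually (\<lambda>t. \<gamma> t \<in> V \<inter> V') (nhds 0)"
    using topological_tendstoD[OF \<gamma>(3)[unfolded isCont_def tendsto_at_iff_tendsto_nhds], of "V \<inter> V'"]
      assms(4) V'(1) \<gamma>(1) by auto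
  then obtain T where "open T" "0 \<in> T" "\<And>t. t \<in> T \<Longrightarrow> \<gamma> t \<in> V \<inter> V'"
    by (auto simp: eventually_nhds)
  then show thesis using V'(2) \<gamma>(2) by (intro that[of T]) blast+
qed

text \<open>A single linear map, the derivative of a local smooth extension of the chart, serves all
  curves through \<open>x\<close>. It permits adding velocities of different curves and discarding
  their vertical parts.\<close>

lemma chart_derivative:
  assumes x: "x \<in> Sp_group" "coset U_group x \<in> U"
  obtains DF where "linear DF"
    "\<And>\<gamma> X. curve_with_velocity Sp_group \<gamma> x X \<Longrightarrow>
      ((\<lambda>t. \<phi> (coset U_group (\<gamma> t))) has_vector_derivative DF X) (at 0)"
proof -
  obtain V F where V: "open V" "x \<in> V" "smooth_on V F"
    "\<And>x'. x' \<in> V \<Longrightarrow> x' \<in> Sp_group \<Longrightarrow> coset U_group x' \<in> U \<Longrightarrow> F x' = \<phi> (coset U_group x')"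
    using forward[OF x] by blast
  let ?DF = "frechet_derivative F (at x)"
  have F: "(F has_derivative ?DF) (at x)" by (rule smooth_on_has_derivative[OF V(3,2)])
  have "((\<lambda>t. \<phi> (coset U_group (\<gamma> t))) has_vector_derivative ?DF X) (at 0)"
    if \<gamma>: "curve_with_velocity Sp_group \<gamma> x X" for \<gamma> X
  proof -
    obtain T where T: "open T" "0 \<in> T" "\<And>t. t \<in> T \<Longrightarrow> \<gamma> t \<in> V \<and> coset U_group (\<gamma> t) \<in> U"
      using curve_in_domain[OF x \<gamma> V(1,2)] by blast
    have \<gamma>': "\<gamma> 0 = x" "\<And>t. \<gamma> t \<in> Sp_group" "(\<gamma> has_vector_derivative X) (at 0)"
      using \<gamma> by (auto simp: curve_with_velocity_def)
    have "((\<lambda>t. F (\<gamma> t)) has_derivative (\<lambda>h. ?DF (h *\<^sub>R X))) (at 0)"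
      using has_derivative_compose[of \<gamma> "\<lambda>h. h *\<^sub>R X" 0 UNIV F ?DF] \<gamma>' F
      by (simp add: has_vector_derivative_def)
    then have "((\<lambda>t. F (\<gamma> t)) has_vector_derivative ?DF X) (at 0)"
      using linear_cmul[OF has_derivative_linear[OF F]] by (simp add: has_vector_derivative_def)
    then show ?thesis
      by (rule has_vector_derivative_transform_within_open[OF _ T(1,2)]) (use V(4) T(3) \<gamma>'(2) in blast)
  qed
  with has_derivative_linear[OF F] show thesis by (rule that)
qed

lemma D_of_curve:
  assumes x: "x \<in> Sp_group" "coset U_group x \<in> U"
    and \<gamma>: "curve_with_velocity Sp_group \<gamma> x X"
    and v: "((\<lambda>t. \<phi> (coset U_group (\<gamma> t))) has_vector_derivative v) (at 0)"
  shows "D (\<phi> (coset U_group x)) v = X ** transpose x + x ** transpose X"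
proof -
  let ?y = "\<phi> (coset U_group x)"
  obtain T where T: "open T" "0 \<in> T" "\<And>t. t \<in> T \<Longrightarrow> \<gamma> t \<in> UNIV \<and> coset U_group (\<gamma> t) \<in> U"
    using curve_in_domain[OF x \<gamma> open_UNIV UNIV_I] by blast
  have \<gamma>': "\<gamma> 0 = x" "(\<gamma> has_vector_derivative X) (at 0)"
    using \<gamma> by (auto simp: curve_with_velocity_def)
  have S: "(S has_derivative D ?y) (at ?y)" using x by (intro has_derivative_S) blast
  have "((\<lambda>t. S (\<phi> (coset U_group (\<gamma> t)))) has_derivative (\<lambda>h. D ?y (h *\<^sub>R v))) (at 0)"
    using has_derivative_compose[of "\<lambda>t. \<phi> (coset U_group (\<gamma> t))" "\<lambda>h. h *\<^sub>R v" 0 UNIV S "D ?y"] v S \<gamma>'(1)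
    by (simp add: has_vector_derivative_def)
  then have "((\<lambda>t. S (\<phi> (coset U_group (\<gamma> t)))) has_vector_derivative D ?y v) (at 0)"
    using linear_cmul[OF has_derivative_linear[OF S]] by (simp add: has_vector_derivative_def)
  then have "((\<lambda>t. \<gamma> t ** transpose (\<gamma> t)) has_vector_derivative D ?y v) (at 0)"
    by (rule has_vector_derivative_transform_within_open[OF _ T(1,2)]) (use T(3) S_coset in blast)
  moreover have "((\<lambda>t. \<gamma> t ** transpose (\<gamma> t)) has_vector_derivative
      (\<gamma> 0 ** transpose X + X ** transpose (\<gamma> 0))) (at 0)"
    by (intro has_vector_derivative_matrix_mult has_vector_derivative_transpose \<gamma>')
  ultimately have "D ?y v = \<gamma> 0 ** transpose X + X ** transpose (\<gamma> 0)"
    by (rule vector_derivative_unique_at)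
  then show ?thesis by (simp add: \<gamma>'(1) add.commute)
qed

lemma D_horizontal_lift:
  assumes x: "x \<in> Sp_group" "coset U_group x \<in> U"
    and h: "horizontal_lift Sp_group U_group (U, \<phi>) x v (x ** X)"
  shows "X \<in> p_space" "D (\<phi> (coset U_group x)) v = 2 *\<^sub>R (x ** X ** transpose x)"
proof -
  show X: "X \<in> p_space"
    using h horizontal_space_iff[OF x(1)] by (simp add: horizontal_lift_def)
  show "D (\<phi> (coset U_group x)) v = 2 *\<^sub>R (x ** X ** transpose x)"
    using h D_of_curve[OF x, of _ "x ** X" v]
    by (auto simp: horizontal_lift_def matrix_expand p_space_transpose[OF X] scaleR_2 simp del: mult_2)
qed

text \<open>A local section lifts the coordinate line through \<open>y\<close> in direction
  \<open>v\<close> to the group. The vertical part of its velocity is tangent to the fibre, along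
  which the chart is constant, so dropping it leaves the velocity in the chart unchanged.\<close>

lemma horizontal_lift_exists:
  assumes y: "y \<in> \<phi> ` U"
  obtains x where "x \<in> Sp_group" "coset U_group x \<in> U" "\<phi> (coset U_group x) = y"
    "\<And>v. \<exists>X. horizontal_lift Sp_group U_group (U, \<phi>) x v (x ** X)"
proof -
  from lift[OF y] obtain W \<sigma> where W: "open W" "y \<in> W" "smooth_on W \<sigma>"
    "\<And>z. z \<in> W \<Longrightarrow> \<sigma> z \<in> Sp_group \<and> coset U_group (\<sigma> z) \<in> U \<and> \<phi> (coset U_group (\<sigma> z)) = z" by blast
  define x where "x = \<sigma> y"
  have x: "x \<in> Sp_group" "coset U_group x \<in> U" "\<phi> (coset U_group x) = y"
    using W(4)[OF W(2)] by (simp_all add: x_def)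
  obtain DF where DF: "linear DF" "\<And>\<gamma> X. curve_with_velocity Sp_group \<gamma> x X \<Longrightarrow>
      ((\<lambda>t. \<phi> (coset U_group (\<gamma> t))) has_vector_derivative DF X) (at 0)"
    using chart_derivative[OF x(1,2)] by blast
  have "\<exists>X. horizontal_lift Sp_group U_group (U, \<phi>) x v (x ** X)" for v
  proof -
    define Z where "Z = frechet_derivative \<sigma> (at y) v"
    define T where "T = (\<lambda>t. y + t *\<^sub>R v) -` W"
    \<comment> \<open>Outside \<open>T\<close> the curve rests at \<open>x\<close>, since it has to
      lie in the group for every real \<open>t\<close>.\<close>
    define \<gamma> where "\<gamma> t = (if t \<in> T then \<sigma> (y + t *\<^sub>R v) else x)" for t
    have T: "open T" "0 \<in> T"
      using W(1,2) by (auto simp: T_def intro!: open_vimage continuous_intros)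
    have "(\<sigma> has_derivative frechet_derivative \<sigma> (at y)) (at y)"
      by (rule smooth_on_has_derivative[OF W(3,2)])
    then have \<sigma>: "(\<sigma> has_derivative frechet_derivative \<sigma> (at y)) (at (y + 0 *\<^sub>R v))" by simp
    have "((\<lambda>t. y + t *\<^sub>R v) has_derivative (\<lambda>h. h *\<^sub>R v)) (at 0)"
      by (auto intro!: derivative_eq_intros)
    from has_derivative_compose[OF this \<sigma>]
    have "((\<lambda>t. \<sigma> (y + t *\<^sub>R v)) has_vector_derivative Z) (at 0)"
      using linear_cmul[OF has_derivative_linear[OF \<sigma>]] by (simp add: has_vector_derivative_def Z_def)
    then have "(\<gamma> has_vector_derivative Z) (at 0)"
      by (rule has_vector_derivative_transform_within_open[OF _ T]) (simp add: \<gamma>_def)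
    then have \<gamma>: "curve_with_velocity Sp_group \<gamma> x Z"
      using W(4) x(1) T(2) by (auto simp: curve_with_velocity_def \<gamma>_def T_def x_def)
    have "((\<lambda>t. y + t *\<^sub>R v) has_vector_derivative v) (at 0)"
      by (auto intro!: derivative_eq_intros simp: has_vector_derivative_def)
    then have "((\<lambda>t. \<phi> (coset U_group (\<gamma> t))) has_vector_derivative v) (at 0)"
      by (rule has_vector_derivative_transform_within_open[OF _ T]) (use W(4) in \<open>simp add: \<gamma>_def T_def\<close>)
    with DF(2)[OF \<gamma>] have v: "DF Z = v" by (rule vector_derivative_unique_at)
    define Y where "Y = matrix_inv x ** Z"
    have Z: "Z = x ** Y" by (simp add: Y_def matrix_mul_assoc Sp_inv x)
    have Y: "Y \<in> sp_algebra"
      using \<gamma> Sp_tangent[OF x(1), of Y] by (auto simp: tangent_space_def Z)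
    define X where "X = (1 / 2) *\<^sub>R (Y + transpose Y)"
    define K where "K = (1 / 2) *\<^sub>R (Y - transpose Y)"
    have X: "X \<in> p_space" unfolding X_def by (rule sp_algebra_sym_part(1)[OF Y])
    have K: "K \<in> sp_algebra" "transpose K = - K"
      unfolding K_def using sp_algebra_sym_part(2)[OF Y]
      by (rule sp_algebra_scaleR) (simp add: transpose_scalar transpose_diff scaleR_diff_right)
    have "Y = X + K" by (simp add: X_def K_def vec_eq_iff field_simps)
    obtain \<beta> where \<beta>: "curve_with_velocity (coset U_group x) \<beta> x (x ** K)"
      using fibre_curve[OF x(1) K] by blast
    then have \<beta>': "curve_with_velocity Sp_group \<beta> x (x ** K)"
      using coset_subset_Sp[OF x(1)] by (auto simp: curve_with_velocity_def)
    have "\<phi> (coset U_group (\<beta> t)) = y" for t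
      using \<beta> coset_eq_of_mem[OF x(1)] x(3) by (simp add: curve_with_velocity_def)
    with DF(2)[OF \<beta>'] have "((\<lambda>t. y) has_vector_derivative DF (x ** K)) (at 0)" by simp
    then have "DF (x ** K) = 0"
      using has_vector_derivative_const vector_derivative_unique_at by blast
    then have "DF (x ** X) = v"
      using v linear_add[OF DF(1), of "x ** X" "x ** K"] by (simp add: Z \<open>Y = X + K\<close> matrix_add_ldistrib)
    obtain \<delta> where \<delta>: "curve_with_velocity Sp_group \<delta> x (x ** X)"
      using Sp_curve[OF x(1)] X p_space_subset_sp_algebra by blast
    have "horizontal_lift Sp_group U_group (U, \<phi>) x v (x ** X)"
      unfolding horizontal_lift_def
      using \<delta> DF(2)[OF \<delta>] \<open>DF (x ** X) = v\<close> horizontal_space_iff[OF x(1)] X by auto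
    then show ?thesis by blast
  qed
  with x show thesis by (rule that)
qed

text \<open>The definite description denotes because, whatever the representative \<open>x\<close>
  and the lifts, the value depends only on \<open>D y v\<close> and \<open>D y w\<close>: the
  representative cancels in \<open>bform_conj\<close>.\<close>

lemma submersion_metric_eq:
  assumes y: "y \<in> \<phi> ` U"
  shows "submersion_metric Sp_group U_group (U, \<phi>) y v w = bform (D y v) (D y w)"
proof -
  have val: "GL_metric (cmat x) (cmat X) (cmat Y) = bform (D y v) (D y w)"
    if "x \<in> Sp_group" "coset U_group x \<in> U" "\<phi> (coset U_group x) = y"
      "horizontal_lift Sp_group U_group (U, \<phi>) x v X" "horizontal_lift Sp_group U_group (U, \<phi>) x w Y"
    for x X Y
  proof -
    define X' Y' where "X' = matrix_inv x ** X" and "Y' = matrix_inv x ** Y"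
    have XY: "X = x ** X'" "Y = x ** Y'"
      by (simp_all add: X'_def Y'_def matrix_mul_assoc Sp_inv that)
    have X': "X' \<in> p_space" "D y v = 2 *\<^sub>R (x ** X' ** transpose x)"
      using D_horizontal_lift[OF that(1,2) that(4)[unfolded XY]] that(3) by simp_all
    have Y': "Y' \<in> p_space" "D y w = 2 *\<^sub>R (x ** Y' ** transpose x)"
      using D_horizontal_lift[OF that(1,2) that(5)[unfolded XY]] that(3) by simp_all
    show ?thesis
      unfolding XY GL_metric_left_translate[OF that(1)] X'(2) Y'(2) bform_conj[OF that(1) X'(1) Y'(1)] ..
  qed
  obtain x where x: "x \<in> Sp_group" "coset U_group x \<in> U" "\<phi> (coset U_group x) = y"
    "\<And>v. \<exists>X. horizontal_lift Sp_group U_group (U, \<phi>) x v (x ** X)"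
    using horizontal_lift_exists[OF y] by blast
  obtain X Y where XY: "horizontal_lift Sp_group U_group (U, \<phi>) x v (x ** X)"
    "horizontal_lift Sp_group U_group (U, \<phi>) x w (x ** Y)"
    using x(4) by blast
  show ?thesis
    unfolding submersion_metric_def fst_conv snd_conv
  proof (rule the_equality)
    show "\<exists>x X Y. x \<in> Sp_group \<and> coset U_group x \<in> U \<and> \<phi> (coset U_group x) = y \<and>
        horizontal_lift Sp_group U_group (U, \<phi>) x v X \<and> horizontal_lift Sp_group U_group (U, \<phi>) x w Y \<and>
        bform (D y v) (D y w) = GL_metric (cmat x) (cmat X) (cmat Y)"
      using x(1-3) XY val[OF x(1-3) XY] by metis
  qed (use val in metis)
qed

text \<open>\<open>T\<close> sends a coordinate vector to its horizontal lift at the representative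
  \<open>x\<close>, translated to the identity. By \<open>bform_conj\<close> it is an isometry onto
  \<open>p_space\<close>, and the pointwise computations that follow are carried out in its
  image.\<close>

lemma frame:
  assumes y: "y \<in> \<phi> ` U"
  obtains x T where "x \<in> Sp_group" "coset U_group x \<in> U" "\<phi> (coset U_group x) = y"
    "linear T" "inj T" "range T = p_space"
    "\<And>v. D y v = 2 *\<^sub>R (x ** T v ** transpose x)"
proof -
  obtain x where x: "x \<in> Sp_group" "coset U_group x \<in> U" "\<phi> (coset U_group x) = y"
    "\<And>v. \<exists>X. horizontal_lift Sp_group U_group (U, \<phi>) x v (x ** X)"
    using horizontal_lift_exists[OF y] by blast
  obtain DF where DF: "linear DF" "\<And>\<gamma> X. curve_with_velocity Sp_group \<gamma> x X \<Longrightarrow>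
      ((\<lambda>t. \<phi> (coset U_group (\<gamma> t))) has_vector_derivative DF X) (at 0)"
    using chart_derivative[OF x(1,2)] by blast
  define T where "T v = (1 / 2) *\<^sub>R (matrix_inv x ** D y v ** transpose (matrix_inv x))" for v
  have TX: "T v = X" if "D y v = 2 *\<^sub>R (x ** X ** transpose x)" for v X
  proof -
    have "T v = (matrix_inv x ** x) ** X ** transpose (matrix_inv x ** x)"
      by (simp add: T_def that matrix_expand)
    then show ?thesis by (simp add: Sp_inv x)
  qed
  have T: "T v \<in> p_space" "D y v = 2 *\<^sub>R (x ** T v ** transpose x)"
    "horizontal_lift Sp_group U_group (U, \<phi>) x v (x ** T v)" for v
  proof -
    obtain X where X: "horizontal_lift Sp_group U_group (U, \<phi>) x v (x ** X)" using x(4) by blast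
    note D = D_horizontal_lift[OF x(1,2) X, unfolded x(3)]
    show "T v \<in> p_space" "D y v = 2 *\<^sub>R (x ** T v ** transpose x)"
      "horizontal_lift Sp_group U_group (U, \<phi>) x v (x ** T v)"
      using D X TX[OF D(2)] by simp_all
  qed
  have "linear T"
  proof (rule linearI)
    show "T (v + w) = T v + T w" for v w
      using linear_add[OF linear_D[OF y]] by (simp add: T_def matrix_expand scaleR_add_right)
    show "T (r *\<^sub>R v) = r *\<^sub>R T v" for r v
      using linear_cmul[OF linear_D[OF y]] by (simp add: T_def matrix_expand)
  qed
  moreover have "v = 0" if "T v = 0" for v
  proof -
    have "horizontal_lift Sp_group U_group (U, \<phi>) x v 0"
      using T(3)[of v] that by (simp add: matrix_mult_zero_right)
    then obtain \<gamma> where \<gamma>: "curve_with_velocity Sp_group \<gamma> x 0"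
      "((\<lambda>t. \<phi> (coset U_group (\<gamma> t))) has_vector_derivative v) (at 0)"
      by (auto simp: horizontal_lift_def)
    from DF(2)[OF \<gamma>(1)] \<gamma>(2) have "DF 0 = v" by (rule vector_derivative_unique_at)
    then show ?thesis using linear_0[OF DF(1)] by simp
  qed
  then have "inj T" using \<open>linear T\<close> linear_injective_0 by blast
  moreover have "X \<in> range T" if X: "X \<in> p_space" for X
  proof -
    obtain \<delta> where \<delta>: "curve_with_velocity Sp_group \<delta> x (x ** X)"
      using Sp_curve[OF x(1)] X p_space_subset_sp_algebra by blast
    have "D y (DF (x ** X)) = x ** X ** transpose x + x ** transpose (x ** X)"
      using D_of_curve[OF x(1,2) \<delta> DF(2)[OF \<delta>]] x(3) by simp
    then have "D y (DF (x ** X)) = 2 *\<^sub>R (x ** X ** transpose x)"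
      by (simp add: matrix_expand p_space_transpose[OF X] scaleR_2 del: mult_2)
    from TX[OF this] show ?thesis by (metis rangeI)
  qed
  then have "range T = p_space" using T(1) by blast
  ultimately show thesis by (rule that[OF x(1-3) _ _ _ T(2)])
qed

section \<open>The symplectic equation for \<open>S\<close> and its first two derivatives\<close>

lemma S_J_S:
  assumes "y \<in> \<phi> ` U"
  shows "S y ** J ** S y = J"
proof -
  obtain x where "x \<in> Sp_group" "coset U_group x \<in> U" "\<phi> (coset U_group x) = y"
    using horizontal_lift_exists[OF assms] by blast
  then show ?thesis
    using S_coset[of x] by (simp add: matrix_expand Sp_mult_transpose_J)
qed

lemma D_constraint:
  assumes y: "y \<in> \<phi> ` U"
  shows "S y ** J ** D y v + D y v ** J ** S y = 0"
proof -
  have "((\<lambda>y. S y ** (J ** S y)) has_derivative (\<lambda>v. S y ** (J ** D y v) + D y v ** (J ** S y))) (at y)"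
    by (intro bounded_bilinear.FDERIV[OF bounded_bilinear_matrix_mult] has_derivative_S y
        bounded_linear.has_derivative[OF linear_matrix_mult_left[unfolded linear_conv_bounded_linear]])
  then have "((\<lambda>y. J) has_derivative (\<lambda>v. S y ** (J ** D y v) + D y v ** (J ** S y))) (at y)"
    by (rule has_derivative_transform_within_open[OF _ open_image y])
      (simp add: matrix_mul_assoc S_J_S)
  then have "(\<lambda>v. S y ** (J ** D y v) + D y v ** (J ** S y)) = (\<lambda>v. 0)"
    using has_derivative_const has_derivative_unique by blast
  then have "S y ** (J ** D y v) + D y v ** (J ** S y) = 0" by (rule fun_cong)
  then show ?thesis by (simp only: matrix_mul_assoc)
qed

definition D2 :: "'e \<Rightarrow> 'e \<Rightarrow> 'e \<Rightarrow> real^('n + 'n)^('n + 'n)" where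
  "D2 y v w = frechet_derivative (\<lambda>y. D y v) (at y) w"

lemma has_derivative_D: "y \<in> \<phi> ` U \<Longrightarrow> ((\<lambda>y. D y v) has_derivative D2 y v) (at y)"
  unfolding D2_def using smooth_on_has_derivative[OF smooth_D] by blast

lemma D2_commute: "y \<in> \<phi> ` U \<Longrightarrow> D2 y v w = D2 y w v"
  unfolding D2_def D_def using second_derivative_symmetric[OF open_image _ smooth_S] by blast

text \<open>The second derivative of \<open>S y ** J ** S y = J\<close>. It fixes the part of
  \<open>D2 y v v\<close> transverse to the image of \<open>S\<close>, and so shows in
  \<open>christoffel_eq\<close> which correction makes it tangent.\<close>

lemma D2_constraint:
  assumes y: "y \<in> \<phi> ` U"
  shows "S y ** J ** D2 y v v + D2 y v v ** J ** S y = - 2 *\<^sub>R (D y v ** J ** D y v)"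
proof -
  note lin = bounded_linear.has_derivative[OF linear_matrix_mult_left[unfolded linear_conv_bounded_linear]]
  note bil = bounded_bilinear.FDERIV[OF bounded_bilinear_matrix_mult]
  have "((\<lambda>y. S y ** (J ** D y v) + D y v ** (J ** S y)) has_derivative
    (\<lambda>w. (S y ** (J ** D2 y v w) + D y w ** (J ** D y v)) +
         (D y v ** (J ** D y w) + D2 y v w ** (J ** S y)))) (at y)"
    by (intro has_derivative_add bil lin has_derivative_S has_derivative_D y)
  then have "((\<lambda>y. 0) has_derivative
    (\<lambda>w. (S y ** (J ** D2 y v w) + D y w ** (J ** D y v)) +
         (D y v ** (J ** D y w) + D2 y v w ** (J ** S y)))) (at y)"
    by (rule has_derivative_transform_within_open[OF _ open_image y])
      (use D_constraint in \<open>simp add: matrix_mul_assoc\<close>)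
  then have eq: "(\<lambda>w. (S y ** (J ** D2 y v w) + D y w ** (J ** D y v)) +
         (D y v ** (J ** D y w) + D2 y v w ** (J ** S y))) = (\<lambda>w. 0)"
    using has_derivative_const has_derivative_unique by blast
  have "(S y ** (J ** D2 y v v) + D y v ** (J ** D y v)) +
         (D y v ** (J ** D y v) + D2 y v v ** (J ** S y)) = 0"
    using fun_cong[OF eq, of v] .
  then have "S y ** J ** D2 y v v + D2 y v v ** J ** S y + 2 *\<^sub>R (D y v ** J ** D y v) = 0"
    by (simp add: matrix_mul_assoc scaleR_2 algebra_simps del: mult_2)
  then show ?thesis by (metis eq_neg_iff_add_eq_0 scaleR_minus_left)
qed

lemma transpose_D:
  assumes y: "y \<in> \<phi> ` U"
  shows "transpose (D y v) = D y v"
proof (rule frame[OF y])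
  fix x :: "real^('n + 'n)^('n + 'n)" and T :: "'e \<Rightarrow> real^('n + 'n)^('n + 'n)"
  assume T: "range T = p_space" "\<And>v. D y v = 2 *\<^sub>R (x ** T v ** transpose x)"
  have "transpose (T v) = T v" using T(1) p_space_transpose by blast
  then show ?thesis by (simp add: T(2) matrix_expand)
qed

lemma transpose_D2:
  assumes y: "y \<in> \<phi> ` U"
  shows "transpose (D2 y v w) = D2 y v w"
proof -
  have "((\<lambda>y. transpose (D y v)) has_derivative (\<lambda>w. transpose (D2 y v w))) (at y)"
    by (intro bounded_linear.has_derivative[OF linear_transpose[unfolded linear_conv_bounded_linear]]
        has_derivative_D y)
  then have "((\<lambda>y. D y v) has_derivative (\<lambda>w. transpose (D2 y v w))) (at y)"
    by (rule has_derivative_transform_within_open[OF _ open_image y]) (rule transpose_D)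
  from has_derivative_unique[OF this has_derivative_D[OF y]] show ?thesis by (rule fun_cong)
qed

text \<open>The chart is an isometric immersion \<open>S\<close> into the flat space of all matrices with the
  pseudo-Riemannian metric \<open>bform\<close>, so that the Christoffel term is the tangential part of the
  second derivative of \<open>S\<close> (Gauss formula).\<close>

theorem christoffel_eq:
  assumes y: "y \<in> \<phi> ` U"
    and x: "x \<in> Sp_group" "coset U_group x \<in> U" "\<phi> (coset U_group x) = y"
    and T: "linear T" "inj T" "range T = p_space" "\<And>v. D y v = 2 *\<^sub>R (x ** T v ** transpose x)"
  shows "D y (christoffel (submersion_metric Sp_group U_group (U, \<phi>)) y v v) =
    D2 y v v - 4 *\<^sub>R (x ** T v ** T v ** transpose x)"
proof -
  let ?g = "submersion_metric Sp_group U_group (U, \<phi>)"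
  have Tp: "T w \<in> p_space" for w using T(3) by blast
  have Sy: "S y = x ** transpose x" using S_coset[OF x(2)] x(3) by simp
  \<comment> \<open>\<open>R\<close> is the candidate for the tangential part: the next steps show
    that it is tangent, and \<open>normal\<close> shows that the subtracted term is orthogonal to
    the tangent space.\<close>
  define R where "R = D2 y v v - 4 *\<^sub>R (x ** T v ** T v ** transpose x)"
  define X where "X = (1 / 2) *\<^sub>R (matrix_inv x ** R ** transpose (matrix_inv x))"
  have RX: "R = 2 *\<^sub>R (x ** X ** transpose x)"
  proof -
    have "2 *\<^sub>R (x ** X ** transpose x) = (x ** matrix_inv x) ** R ** transpose (x ** matrix_inv x)"
      by (simp add: X_def matrix_expand)
    then show ?thesis by (simp add: Sp_inv x)
  qed
  have symR: "transpose R = R"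
    by (simp add: R_def matrix_expand transpose_D2[OF y] p_space_transpose[OF Tp])
  have "X \<in> p_space"
  proof -
    have tX: "transpose X = X"
      by (simp add: X_def matrix_expand symR)
    have 1: "D y v ** J ** D y v = 4 *\<^sub>R (x ** (T v ** (J ** (T v ** transpose x))))"
      by (simp add: T(4) matrix_expand Sp_mult_transpose_J[OF x(1)])
    have TJ: "T v ** (J ** A) = - (J ** (T v ** A))" for A :: "real^('n + 'n)^('n + 'n)"
      using Tp[of v] by (simp add: p_space_def matrix_mul_assoc matrix_mult_minus_left)
    have "S y ** J ** R + R ** J ** S y = (S y ** J ** D2 y v v + D2 y v v ** J ** S y)
      - 4 *\<^sub>R (x ** (J ** (T v ** (T v ** transpose x))) + x ** (T v ** (T v ** (J ** transpose x))))"
      by (simp add: R_def Sy matrix_expand Sp_mult_transpose_J[OF x(1)] algebra_simps)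
    also have "\<dots> = 0"
      unfolding D2_constraint[OF y] 1
      by (simp add: TJ matrix_expand algebra_simps)
    finally have "2 *\<^sub>R (x ** (J ** X + X ** J) ** transpose x) = 0"
      by (simp add: Sy RX matrix_expand Sp_mult_transpose_J[OF x(1)] scaleR_add_right)
    then have "x ** (J ** X + X ** J) ** transpose x = 0" by simp
    then have "J ** X + X ** J = 0" by (simp add: conj_eq_0_iff x)
    then show ?thesis using tX by (simp add: p_space_def eq_neg_iff_add_eq_0 add.commute)
  qed
  then obtain u where u: "T u = X" using T(3) by (metis imageE)
  then have Du: "D y u = R" by (simp add: T(4) RX)
  have gT: "?g y w z = T w \<bullet> T z" for w z
    by (simp add: submersion_metric_eq[OF y] T(4) bform_conj[OF x(1) Tp Tp])
  have dg: "frechet_derivative (\<lambda>y'. ?g y' w z) (at y) h =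
      bform (D y w) (D2 y z h) + bform (D2 y w h) (D y z)" for w z h
  proof -
    have "((\<lambda>y'. bform (D y' w) (D y' z)) has_derivative
        (\<lambda>h. bform (D y w) (D2 y z h) + bform (D2 y w h) (D y z))) (at y)"
      by (intro bounded_bilinear.FDERIV[OF bounded_bilinear_bform] has_derivative_D y)
    then have "((\<lambda>y'. ?g y' w z) has_derivative
        (\<lambda>h. bform (D y w) (D2 y z h) + bform (D2 y w h) (D y z))) (at y)"
      by (rule has_derivative_transform_within_open[OF _ open_image y]) (simp add: submersion_metric_eq)
    from fun_cong[OF frechet_derivative_at[OF this]] show ?thesis by (rule sym)
  qed
  \<comment> \<open>\<open>T v ** T v\<close> commutes with \<open>J\<close> while
    \<open>T z\<close> anticommutes with it, so moving \<open>J\<close> around the trace in the two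
    possible ways shows that the trace equals its own negative.\<close>
  have normal: "bform (4 *\<^sub>R (x ** T v ** T v ** transpose x)) (D y z) = 0" for z
  proof -
    have TJ: "T w ** J = - (J ** T w)" for w using Tp by (simp add: p_space_def)
    have TJA: "T w ** (J ** A) = - (J ** (T w ** A))" for w and A :: "real^('n + 'n)^('n + 'n)"
      by (simp add: matrix_mul_assoc TJ matrix_mult_minus_left)
    have "J ** (T v ** T v) ** J = - (T v ** T v)"
      by (simp add: matrix_expand TJ TJA J_simps)
    then have "trace (J ** (T v ** T v) ** J ** T z) = - trace (T v ** T v ** T z)"
      by (simp add: matrix_mult_minus_left trace_minus)
    moreover have "trace (J ** (T v ** T v) ** J ** T z) = trace (T v ** T v ** T z)"
    proof -
      have "trace (J ** (T v ** T v) ** J ** T z) = trace (J ** ((T v ** T v) ** (J ** T z)))"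
        by (simp only: matrix_mul_assoc)
      also have "\<dots> = trace (((T v ** T v) ** (J ** T z)) ** J)" by (rule trace_mul_sym)
      also have "((T v ** T v) ** (J ** T z)) ** J = (T v ** T v) ** (J ** (T z ** J))"
        by (simp only: matrix_mul_assoc)
      finally show ?thesis by (simp add: p_space_J[OF Tp])
    qed
    ultimately have "trace (J ** (T v ** T v) ** J ** T z) = 0" by simp
    then show ?thesis
      using trace_conj[OF x(1), of "T v ** T v" "T z"]
      by (simp add: bform_def T(4) matrix_mult_scaleR_left matrix_mult_scaleR_right trace_scaleR matrix_mul_assoc)
  qed
  \<comment> \<open>By the symmetry of second derivatives the terms that pair \<open>D y v\<close>
    with a mixed second derivative cancel, which leaves the pairing of \<open>D2 y v v\<close> with
    \<open>D y z\<close>.\<close>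
  have koszul: "?g y u z = (frechet_derivative (\<lambda>y'. ?g y' v z) (at y) v
      + frechet_derivative (\<lambda>y'. ?g y' v z) (at y) v
      - frechet_derivative (\<lambda>y'. ?g y' v v) (at y) z) / 2" for z
  proof -
    have "?g y u z = bform (D2 y v v) (D y z)"
      using normal[of z]
      by (simp add: submersion_metric_eq[OF y] Du R_def bounded_bilinear.diff_left[OF bounded_bilinear_bform])
    moreover have "bform (D y v) (D2 y z v) = bform (D y v) (D2 y v z)"
      using D2_commute[OF y] by metis
    ultimately show ?thesis
      unfolding dg by (simp add: bform_commute[of "D2 y v z" "D y v"])
  qed
  have "christoffel ?g y v v = u"
    unfolding christoffel_def
  proof (rule the_equality)
    fix u' assume u': "\<forall>z. ?g y u' z = (frechet_derivative (\<lambda>y'. ?g y' v z) (at y) v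
      + frechet_derivative (\<lambda>y'. ?g y' v z) (at y) v
      - frechet_derivative (\<lambda>y'. ?g y' v v) (at y) z) / 2"
    then have "T u' \<bullet> T z = T u \<bullet> T z" for z using koszul[of z] gT by metis
    then have "(T u' - T u) \<bullet> T (u' - u) = 0" by (simp add: inner_diff_left)
    then have "T u' = T u" by (simp add: linear_diff[OF T(1)])
    then show "u' = u" using T(2) by (simp add: inj_eq)
  qed (use koszul in blast)
  then show ?thesis by (simp add: Du R_def)
qed

end

section \<open>Charts of the symmetric space\<close>

context sp_chart
begin

definition pt :: "'e \<Rightarrow> (real^('n + 'n)^('n + 'n)) set" where
  "pt = inv_into U \<phi>"

lemma pt_in: "z \<in> \<phi> ` U \<Longrightarrow> pt z \<in> U" and chart_pt: "z \<in> \<phi> ` U \<Longrightarrow> \<phi> (pt z) = z"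
  and pt_chart: "C \<in> U \<Longrightarrow> pt (\<phi> C) = C"
  by (simp_all add: pt_def inv_into_into f_inv_into_f inj_\<phi>)

lemma S_pt: "S z = gram (pt z)"
  by (simp add: S_def pt_def)

lemma S_chart: "C \<in> U \<Longrightarrow> S (\<phi> C) = gram C"
  by (simp add: S_pt pt_chart)

lemma U_cosets: "C \<in> U \<Longrightarrow> \<exists>x\<in>Sp_group. C = coset U_group x"
  using openin_U unfolding openin_quotient_topology by blast

text \<open>The atlas asks for injectivity, open domain and image, smooth extensions and smooth
  lifts. That charts are homeomorphisms is derived: continuity comes here from the extensions, and
  continuity of the inverse comes in \<open>open_pt_preimage\<close> from the lifts.\<close>

lemma openin_preimage:
  assumes "open V"
  shows "openin (quotient_topology Sp_group U_group) {C \<in> U. \<phi> C \<in> V}"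
proof -
  let ?A = "{x \<in> Sp_group. coset U_group x \<in> {C \<in> U. \<phi> C \<in> V}}"
  obtain T where T: "open T" "{x \<in> Sp_group. coset U_group x \<in> U} = Sp_group \<inter> T"
    by (rule preimage_open)
  have "openin (top_of_set Sp_group) ?A"
  proof (subst openin_subopen, intro ballI)
    fix x assume x: "x \<in> ?A"
    then obtain V' F where V': "open V'" "x \<in> V'" "smooth_on V' F"
      "\<And>x'. x' \<in> V' \<Longrightarrow> x' \<in> Sp_group \<Longrightarrow> coset U_group x' \<in> U \<Longrightarrow> F x' = \<phi> (coset U_group x')"
      using forward[of x] by blast
    have "open (V' \<inter> F -` V)"
      using continuous_open_preimage[OF smooth_on_continuous[OF V'(3)] V'(1) assms] .
    then have "openin (top_of_set Sp_group) (Sp_group \<inter> (T \<inter> (V' \<inter> F -` V)))"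
      using T(1) by (intro openin_open_Int) (rule open_Int)
    moreover have "x \<in> Sp_group \<inter> (T \<inter> (V' \<inter> F -` V))"
      using x V'(2,4) T(2) by auto
    moreover have "Sp_group \<inter> (T \<inter> (V' \<inter> F -` V)) \<subseteq> ?A"
    proof
      fix y assume y: "y \<in> Sp_group \<inter> (T \<inter> (V' \<inter> F -` V))"
      then have "coset U_group y \<in> U" using T(2) by blast
      then show "y \<in> ?A" using y V'(4)[of y] by auto
    qed
    ultimately show "\<exists>T. openin (top_of_set Sp_group) T \<and> x \<in> T \<and> T \<subseteq> ?A" by blast
  qed
  moreover have "{C \<in> U. \<phi> C \<in> V} \<subseteq> coset U_group ` Sp_group" using U_cosets by blast
  ultimately show ?thesis by (simp add: openin_quotient_topology)
qed

lemma open_pt_preimage: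
  assumes "openin (quotient_topology Sp_group U_group) W'"
  shows "open {z \<in> \<phi> ` U. pt z \<in> W'}"
proof (subst open_subopen, intro ballI)
  fix y assume y: "y \<in> {z \<in> \<phi> ` U. pt z \<in> W'}"
  then obtain W \<sigma> where W: "open W" "y \<in> W" "W \<subseteq> \<phi> ` U" "smooth_on W \<sigma>"
    "\<And>z. z \<in> W \<Longrightarrow> \<sigma> z \<in> Sp_group \<and> coset U_group (\<sigma> z) \<in> U \<and> \<phi> (coset U_group (\<sigma> z)) = z"
    using lift[of y] by blast
  have b: "pt z = coset U_group (\<sigma> z)" if "z \<in> W" for z
    using pt_chart W(5)[OF that] by metis
  obtain T where T: "open T" "{x \<in> Sp_group. coset U_group x \<in> W'} = Sp_group \<inter> T"
    using assms unfolding openin_quotient_topology openin_open by blast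
  have "open (W \<inter> \<sigma> -` T)"
    using continuous_open_preimage[OF smooth_on_continuous[OF W(4)] W(1) T(1)] .
  moreover have "y \<in> W \<inter> \<sigma> -` T"
    using y W(2) W(5)[OF W(2)] b[OF W(2)] T(2) by auto
  moreover have "W \<inter> \<sigma> -` T \<subseteq> {z \<in> \<phi> ` U. pt z \<in> W'}"
  proof
    fix z assume z: "z \<in> W \<inter> \<sigma> -` T"
    then have "\<sigma> z \<in> Sp_group \<inter> T" using W(5) by blast
    then have "coset U_group (\<sigma> z) \<in> W'" using T(2) by blast
    then show "z \<in> {z \<in> \<phi> ` U. pt z \<in> W'}" using z b W(3) by auto
  qed
  ultimately show "\<exists>T. open T \<and> y \<in> T \<and> T \<subseteq> {z \<in> \<phi> ` U. pt z \<in> W'}" by blast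
qed

text \<open>Locally the change of chart is a lift of the inverse of the first chart followed by a
  smooth extension of the second.\<close>

lemma transition:
  assumes c: "(U', \<phi>' :: _ \<Rightarrow> 'f::euclidean_space) \<in> quotient_atlas Sp_group U_group"
  shows "open {z \<in> \<phi> ` U. pt z \<in> U'}" "smooth_on {z \<in> \<phi> ` U. pt z \<in> U'} (\<lambda>z. \<phi>' (pt z))"
proof -
  interpret c': sp_chart U' \<phi>' using c by unfold_locales
  let ?A = "{z \<in> \<phi> ` U. pt z \<in> U'}"
  show A: "open ?A" by (rule open_pt_preimage[OF c'.openin_U])
  show "smooth_on ?A (\<lambda>z. \<phi>' (pt z))"
  proof (rule smooth_on_local)
    fix y assume y: "y \<in> ?A"
    then obtain W \<sigma> where W: "open W" "y \<in> W" "W \<subseteq> \<phi> ` U" "smooth_on W \<sigma>"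
      "\<And>z. z \<in> W \<Longrightarrow> \<sigma> z \<in> Sp_group \<and> coset U_group (\<sigma> z) \<in> U \<and> \<phi> (coset U_group (\<sigma> z)) = z"
      using lift[of y] by blast
    have b: "pt z = coset U_group (\<sigma> z)" if "z \<in> W" for z
      using pt_chart W(5)[OF that] by metis
    have \<sigma>y: "\<sigma> y \<in> Sp_group" "coset U_group (\<sigma> y) \<in> U'"
      using W(5)[OF W(2)] b[OF W(2)] y by auto
    then obtain V F where V: "open V" "\<sigma> y \<in> V" "smooth_on V F"
      "\<And>x'. x' \<in> V \<Longrightarrow> x' \<in> Sp_group \<Longrightarrow> coset U_group x' \<in> U' \<Longrightarrow> F x' = \<phi>' (coset U_group x')"
      using c'.forward[OF \<sigma>y] by blast
    let ?T = "(W \<inter> \<sigma> -` V) \<inter> ?A"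
    have T: "open ?T"
      using continuous_open_preimage[OF smooth_on_continuous[OF W(4)] W(1) V(1)] A by (rule open_Int)
    have "smooth_on ?T (\<lambda>z. F (\<sigma> z))"
      by (rule smooth_on_compose[OF V(3) smooth_on_subset[OF W(4)] _ T V(1)]) auto
    moreover have "F (\<sigma> z) = \<phi>' (pt z)" if "z \<in> ?T" for z
      using that W(5) b V(4)[of "\<sigma> z"] by auto
    ultimately have "smooth_on ?T (\<lambda>z. \<phi>' (pt z))"
      by (rule smooth_on_cong[OF T, rotated])
    moreover have "y \<in> ?T" using y W(2) V(2) by auto
    ultimately show "\<exists>T. open T \<and> y \<in> T \<and> smooth_on T (\<lambda>z. \<phi>' (pt z))" using T by blast
  qed
qed

text \<open>The source of new charts: since the atlas is maximal, it contains every chart obtained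
  by restriction and a diffeomorphism of the model space. The extensions are composed with
  \<open>\<kappa>\<close> and the lifts with \<open>g\<close>.\<close>

lemma compose_chart:
  fixes \<kappa> g :: "'e \<Rightarrow> 'e"
  assumes V: "open V" "V \<subseteq> \<phi> ` U" and W: "open W" and h: "homeomorphism V W \<kappa> g"
    and \<kappa>: "smooth_on V \<kappa>" and g: "smooth_on W g"
  shows "({C \<in> U. \<phi> C \<in> V}, \<kappa> \<circ> \<phi>) \<in> quotient_atlas Sp_group U_group"
proof -
  let ?U = "{C \<in> U. \<phi> C \<in> V}"
  have h': "\<And>x. x \<in> V \<Longrightarrow> g (\<kappa> x) = x" "\<And>y. y \<in> W \<Longrightarrow> \<kappa> (g y) = y" "\<kappa> ` V = W" "g ` W = V"
    using h by (auto simp: homeomorphism_def)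
  have im: "\<phi> ` ?U = V" using V(2) by auto
  then have im': "(\<kappa> \<circ> \<phi>) ` ?U = W" using h'(3) by (metis image_comp)
  have opi: "open ((\<kappa> \<circ> \<phi>) ` ?U)" unfolding im' by (rule W)
  have "inj_on \<kappa> V" using h'(1) by (metis inj_on_inverseI)
  then have inj: "inj_on (\<kappa> \<circ> \<phi>) ?U"
    using inj_\<phi> im by (intro comp_inj_on) (auto intro: inj_on_subset)
  have fw: "\<exists>V' F. open V' \<and> x \<in> V' \<and> smooth_on V' F \<and>
      (\<forall>x' \<in> V' \<inter> Sp_group. coset U_group x' \<in> ?U \<longrightarrow> F x' = (\<kappa> \<circ> \<phi>) (coset U_group x'))"
    if x: "x \<in> Sp_group" "coset U_group x \<in> ?U" for x
  proof -
    obtain V' F where V': "open V'" "x \<in> V'" "smooth_on V' F"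
      "\<And>x'. x' \<in> V' \<Longrightarrow> x' \<in> Sp_group \<Longrightarrow> coset U_group x' \<in> U \<Longrightarrow> F x' = \<phi> (coset U_group x')"
      using forward[of x] x by blast
    let ?T = "V' \<inter> F -` V"
    have T: "open ?T"
      using continuous_open_preimage[OF smooth_on_continuous[OF V'(3)] V'(1) V(1)] .
    have "smooth_on ?T (\<lambda>x. \<kappa> (F x))"
      by (rule smooth_on_compose[OF \<kappa> smooth_on_subset[OF V'(3)] _ T V(1)]) auto
    moreover have "x \<in> ?T" using V'(2,4) x by auto
    moreover have "\<forall>x' \<in> ?T \<inter> Sp_group. coset U_group x' \<in> ?U \<longrightarrow> \<kappa> (F x') = (\<kappa> \<circ> \<phi>) (coset U_group x')"
      using V'(4) by auto
    ultimately show ?thesis using T by blast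
  qed
  have bw: "\<exists>W' \<sigma>. open W' \<and> y \<in> W' \<and> W' \<subseteq> (\<kappa> \<circ> \<phi>) ` ?U \<and> smooth_on W' \<sigma> \<and>
      (\<forall>z\<in>W'. \<sigma> z \<in> Sp_group \<and> coset U_group (\<sigma> z) \<in> ?U \<and> (\<kappa> \<circ> \<phi>) (coset U_group (\<sigma> z)) = z)"
    if y: "y \<in> (\<kappa> \<circ> \<phi>) ` ?U" for y
  proof -
    have yW: "y \<in> W" using y im' by blast
    then have gy: "g y \<in> V" using h'(4) by blast
    then obtain W1 \<sigma> where W1: "open W1" "g y \<in> W1" "W1 \<subseteq> \<phi> ` U" "smooth_on W1 \<sigma>"
      "\<And>z. z \<in> W1 \<Longrightarrow> \<sigma> z \<in> Sp_group \<and> coset U_group (\<sigma> z) \<in> U \<and> \<phi> (coset U_group (\<sigma> z)) = z"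
      using lift[of "g y"] V(2) by blast
    let ?T = "W \<inter> g -` W1"
    have T: "open ?T"
      using continuous_open_preimage[OF smooth_on_continuous[OF g] W W1(1)] .
    have "smooth_on ?T (\<lambda>z. \<sigma> (g z))"
      by (rule smooth_on_compose[OF W1(4) smooth_on_subset[OF g] _ T W1(1)]) auto
    moreover have "\<sigma> (g z) \<in> Sp_group \<and> coset U_group (\<sigma> (g z)) \<in> ?U \<and> (\<kappa> \<circ> \<phi>) (coset U_group (\<sigma> (g z))) = z"
      if "z \<in> ?T" for z
      using that W1(5)[of "g z"] h'(2)[of z] h'(4) by auto
    moreover have "y \<in> ?T" "?T \<subseteq> (\<kappa> \<circ> \<phi>) ` ?U" using yW W1(2) im' by auto
    ultimately show ?thesis using T by blast
  qed
  show ?thesis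
    unfolding quotient_atlas_def mem_Collect_eq case_prod_conv
    by (intro conjI openin_preimage[OF V(1)] inj opi ballI impI)
      (erule (1) fw[unfolded mem_Collect_eq], erule bw[unfolded mem_Collect_eq])
qed

text \<open>\<open>curve_speed\<close> uses a chart picked by \<open>SOME\<close>. Both charts
  express the same Gram matrix, so the derivative of \<open>S\<close> along the curve is the same in
  both, and the speed depends on nothing else.\<close>

lemma speed_in_chart:
  fixes \<gamma> :: "real \<Rightarrow> (real^('n + 'n)^('n + 'n)) set"
  assumes T: "open T" "t \<in> T" "\<And>s. s \<in> T \<Longrightarrow> \<gamma> s \<in> U"
    and v: "((\<lambda>s. \<phi> (\<gamma> s)) has_vector_derivative v) (at t)"
  shows "curve_speed (coset_space Sp_group U_group :: (_, 'e) riemannian) \<gamma> t =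
    sqrt (bform (D (\<phi> (\<gamma> t)) v) (D (\<phi> (\<gamma> t)) v))"
proof -
  let ?M = "coset_space Sp_group U_group :: (_, 'e) riemannian"
  let ?P = "\<lambda>c :: (_, 'e) chart. c \<in> atlas ?M \<and> \<gamma> t \<in> fst c"
  have "?P (U, \<phi>)" using chart T(2,3) by (simp add: coset_space_def)
  define c0 where "c0 = (SOME c. ?P c)"
  have P: "?P c0" unfolding c0_def by (rule someI[of ?P]) fact
  obtain U' \<phi>' where c': "c0 = (U', \<phi>')" by (cases c0)
  have c: "(U', \<phi>') \<in> quotient_atlas Sp_group U_group" "\<gamma> t \<in> U'"
    using P unfolding c' by (simp_all add: coset_space_def)
  interpret c': sp_chart U' \<phi>' using c(1) by unfold_locales
  let ?A = "{z \<in> \<phi> ` U. pt z \<in> U'}"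
  let ?\<tau> = "\<lambda>z. \<phi>' (pt z)"
  let ?y = "\<phi> (\<gamma> t)"
  have Ut: "\<gamma> t \<in> U" using T by blast
  have y: "?y \<in> \<phi> ` U" "?y \<in> ?A" using Ut c(2) by (auto simp: pt_chart)
  have \<tau>y: "?\<tau> ?y = \<phi>' (\<gamma> t)" using Ut by (simp add: pt_chart)
  have y': "\<phi>' (\<gamma> t) \<in> \<phi>' ` U'" using c(2) by blast
  let ?D\<tau> = "frechet_derivative ?\<tau> (at ?y)"
  have \<tau>: "(?\<tau> has_derivative ?D\<tau>) (at ?y)"
    by (rule smooth_on_has_derivative[OF transition(2)[OF c(1)] y(2)])
  have "((\<lambda>s. ?\<tau> (\<phi> (\<gamma> s))) has_derivative (\<lambda>h. ?D\<tau> (h *\<^sub>R v))) (at t)"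
    by (rule has_derivative_compose[OF v[unfolded has_vector_derivative_def] \<tau>])
  then have "((\<lambda>s. ?\<tau> (\<phi> (\<gamma> s))) has_vector_derivative ?D\<tau> v) (at t)"
    using linear_cmul[OF has_derivative_linear[OF \<tau>]] by (simp add: has_vector_derivative_def)
  then have "((\<phi>' \<circ> \<gamma>) has_vector_derivative ?D\<tau> v) (at t)"
    by (rule has_vector_derivative_transform_within_open[OF _ T(1,2)]) (simp add: pt_chart T(3))
  then have vd: "vector_derivative (\<phi>' \<circ> \<gamma>) (at t) = ?D\<tau> v"
    by (rule vector_derivative_at)
  have "((\<lambda>z. c'.S (?\<tau> z)) has_derivative (\<lambda>w. c'.D (\<phi>' (\<gamma> t)) (?D\<tau> w))) (at ?y)"
    by (rule has_derivative_compose[OF \<tau>]) (simp only: \<tau>y c'.has_derivative_S[OF y'])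
  then have "(S has_derivative (\<lambda>w. c'.D (\<phi>' (\<gamma> t)) (?D\<tau> w))) (at ?y)"
    by (rule has_derivative_transform_within_open[OF _ transition(1)[OF c(1)] y(2)])
      (simp add: S_pt c'.S_chart)
  then have "D ?y = (\<lambda>w. c'.D (\<phi>' (\<gamma> t)) (?D\<tau> w))"
    using has_derivative_S[OF y(1)] by (rule has_derivative_unique[symmetric])
  then have "D ?y v = c'.D (\<phi>' (\<gamma> t)) (?D\<tau> v)" by (rule fun_cong)
  then show ?thesis
    unfolding curve_speed_def c0_def[symmetric] c' Let_def snd_conv vd
    by (simp add: coset_space_def c'.submersion_metric_eq[OF y'])
qed

end

section \<open>A chart that covers the whole quotient\<close>

definition psi :: "(real^('n::finite + 'n)^('n + 'n)) set \<Rightarrow> real^('n \<times> 'n option)" where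
  "psi C = to_coords (proj_p (gram C))"

lemma psi_coset: "psi (coset U_group x) = to_coords (proj_p (x ** transpose x))"
  by (simp add: psi_def gram_coset)

text \<open>A local inverse of \<open>psi\<close> near the coset of \<open>x0\<close> comes from the parametrization of a
  neighbourhood by Cayley transforms.\<close>

lemma psi_local_lift:
  fixes x0 :: "real^('n::finite + 'n)^('n + 'n)"
  assumes x0: "x0 \<in> Sp_group"
  obtains W \<sigma> where "open W" "psi (coset U_group x0) \<in> W" "smooth_on W \<sigma>"
    "\<And>z. z \<in> W \<Longrightarrow> \<sigma> z \<in> Sp_group \<and> psi (coset U_group (\<sigma> z)) = z"
proof -
  let ?T = "{X :: real^('n + 'n)^('n + 'n). det (mat 1 - X) \<noteq> 0}"
  let ?L = "\<lambda>M. to_coords (proj_p (x0 ** M ** transpose x0)) :: real^('n \<times> 'n option)"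
  define C where "C e = cayley (from_coords e)" for e :: "real^('n \<times> 'n option)"
  define H where "H e = ?L (C e ** transpose (C e))" for e
  define A where "A = from_coords -` ?T"
  have linL: "linear ?L"
    by (rule linearI) (simp_all add: matrix_expand linear_add[OF linear_proj_p] linear_add[OF linear_to_coords]
        linear_cmul[OF linear_proj_p] linear_cmul[OF linear_to_coords])
  have cont: "continuous_on UNIV (from_coords :: real^('n \<times> 'n option) \<Rightarrow> _)"
    by (rule linear_continuous_on) (simp add: linear_conv_bounded_linear[symmetric] linear_from_coords)
  have A: "open A" "0 \<in> A"
    unfolding A_def by (rule open_vimage[OF open_cayley_domain cont]) (simp add: linear_0[OF linear_from_coords])
  have C: "smooth_on A C"
    unfolding C_def
    by (rule smooth_on_compose[OF smooth_on_cayley smooth_on_linear[OF linear_from_coords smooth_on_id A(1)] _ A(1) open_cayley_domain])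
      (auto simp: A_def)
  have smH: "smooth_on A H"
    unfolding H_def
    by (intro smooth_on_linear[OF linL] smooth_on_matrix_mult smooth_on_linear[OF linear_transpose] C A)
  have C0: "C 0 = mat 1" by (simp add: C_def linear_0[OF linear_from_coords] cayley_0)
  have "((\<lambda>e :: real^('n \<times> 'n option). from_coords e) has_derivative from_coords) (at 0)"
    by (rule linear_imp_has_derivative[OF linear_from_coords])
  moreover have "(cayley has_derivative (\<lambda>H. 2 *\<^sub>R H)) (at (from_coords (0 :: real^('n \<times> 'n option))))"
    by (simp add: linear_0[OF linear_from_coords] has_derivative_cayley)
  ultimately have dC: "(C has_derivative (\<lambda>v. 2 *\<^sub>R from_coords v)) (at 0)"
    unfolding C_def by (rule has_derivative_compose)
  have "((\<lambda>e. C e ** transpose (C e)) has_derivative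
      (\<lambda>v. C 0 ** transpose (2 *\<^sub>R from_coords v) + (2 *\<^sub>R from_coords v) ** transpose (C 0))) (at 0)"
    by (intro bounded_bilinear.FDERIV[OF bounded_bilinear_matrix_mult] dC
        bounded_linear.has_derivative[OF linear_transpose[unfolded linear_conv_bounded_linear]])
  \<comment> \<open>One factor 2 is the derivative of the Cayley transform, the other comes from the
    two equal terms of the product rule for symmetric directions.\<close>
  then have "((\<lambda>e. C e ** transpose (C e)) has_derivative (\<lambda>v. 4 *\<^sub>R from_coords v)) (at 0)"
    by (simp add: C0 transpose_scalar p_space_transpose[OF from_coords_in] scaleR_add_left[symmetric])
  from bounded_linear.has_derivative[OF linL[unfolded linear_conv_bounded_linear] this]
  have dH: "(H has_derivative (\<lambda>v. ?L (4 *\<^sub>R from_coords v))) (at 0)"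
    unfolding H_def .
  have inj: "v = 0" if "frechet_derivative H (at 0) v = 0" for v
  proof -
    have "?L (4 *\<^sub>R from_coords v) = 0"
      using that frechet_derivative_at[OF dH] by metis
    then have "to_coords (proj_p (x0 ** from_coords v ** transpose x0)) = 0"
      by (simp add: matrix_expand linear_cmul[OF linear_proj_p] linear_cmul[OF linear_to_coords])
    then have "proj_p (x0 ** from_coords v ** transpose x0) = 0"
      using from_to_coords[OF proj_p_in] linear_0[OF linear_from_coords] by metis
    then have "from_coords v = 0" by (rule proj_p_conj_inj[OF x0 from_coords_in])
    then show ?thesis using to_from_coords[of v] linear_0[OF linear_to_coords] by metis
  qed
  obtain U' V g where V: "open U'" "U' \<subseteq> A" "0 \<in> U'" "open V" "H 0 \<in> V"
    "homeomorphism U' V H g" "smooth_on V g"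
    using smooth_inverse_function[OF A smH inj] by blast
  have g: "\<And>z. z \<in> V \<Longrightarrow> g z \<in> A \<and> H (g z) = z"
    using V(2,6) by (auto simp: homeomorphism_def)
  define \<sigma> where "\<sigma> z = x0 ** C (g z)" for z
  have "smooth_on V \<sigma>"
    unfolding \<sigma>_def using g
    by (intro smooth_on_matrix_mult smooth_on_const smooth_on_compose[OF C V(7)] V A) blast
  moreover have "psi (coset U_group x0) \<in> V"
    using V(5) by (simp add: psi_coset H_def C0)
  moreover have "\<sigma> z \<in> Sp_group \<and> psi (coset U_group (\<sigma> z)) = z" if "z \<in> V" for z
  proof -
    have "C (g z) \<in> Sp_group"
      unfolding C_def using g[OF that] p_space_subset_sp_algebra from_coords_in
      by (intro cayley_Sp) (auto simp: A_def)
    moreover have "psi (coset U_group (\<sigma> z)) = H (g z)"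
      by (simp add: psi_coset \<sigma>_def H_def matrix_expand)
    ultimately show ?thesis using g[OF that] x0 by (simp add: \<sigma>_def Sp_mult)
  qed
  ultimately show thesis using V(4) by (intro that[of V \<sigma>])
qed

text \<open>Injectivity is \<open>proj_p_inj\<close>, and the lifts of \<open>psi_local_lift\<close>
  give both openness of the image and smoothness of the inverse. With a global chart, every curve
  can be measured in one coordinate system and convergence of Gram matrices becomes convergence of
  coordinates.\<close>

lemma global_chart:
  "(coset U_group ` (Sp_group :: (real^('n::finite + 'n)^('n + 'n)) set), psi) \<in> quotient_atlas Sp_group U_group"
proof -
  let ?M = "coset U_group ` (Sp_group :: (real^('n + 'n)^('n + 'n)) set)"
  have op: "openin (quotient_topology Sp_group U_group) ?M"
    using openin_topspace by (metis topspace_quotient_topology)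
  have inj: "inj_on psi ?M"
  proof (rule inj_onI)
    fix p q assume "p \<in> ?M" "q \<in> ?M" and eq: "psi p = psi q"
    then obtain x y where x: "x \<in> Sp_group" "p = coset U_group x" and y: "y \<in> Sp_group" "q = coset U_group y"
      by blast
    have "proj_p (x ** transpose x) = proj_p (y ** transpose y)"
      using eq from_to_coords[OF proj_p_in] unfolding x y psi_coset by metis
    then show "p = q" using proj_p_inj coset_eq_iff x y by metis
  qed
  have bw: "\<exists>W \<sigma>. open W \<and> y \<in> W \<and> W \<subseteq> psi ` ?M \<and> smooth_on W \<sigma> \<and>
      (\<forall>z\<in>W. \<sigma> z \<in> Sp_group \<and> coset U_group (\<sigma> z) \<in> ?M \<and> psi (coset U_group (\<sigma> z)) = z)"
    if y: "y \<in> psi ` ?M" for y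
  proof -
    obtain x0 where x0: "x0 \<in> Sp_group" "y = psi (coset U_group x0)" using y by blast
    obtain W \<sigma> where W: "open W" "psi (coset U_group x0) \<in> W" "smooth_on W \<sigma>"
      "\<And>z. z \<in> W \<Longrightarrow> \<sigma> z \<in> Sp_group \<and> psi (coset U_group (\<sigma> z)) = z"
      using psi_local_lift[OF x0(1)] by blast
    have "z \<in> psi ` ?M" if "z \<in> W" for z
      using W(4)[OF that] by (metis imageI)
    then show ?thesis using W x0(2) by blast
  qed
  have opi: "open (psi ` ?M)"
    using bw by (subst open_subopen) blast
  let ?F = "\<lambda>x :: real^('n + 'n)^('n + 'n). to_coords (proj_p (x ** transpose x))"
  have F: "smooth_on UNIV ?F"
    by (intro smooth_on_linear[OF linear_to_coords] smooth_on_linear[OF linear_proj_p] smooth_on_matrix_mult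
        smooth_on_linear[OF linear_transpose] smooth_on_id open_UNIV)
  have fw: "\<exists>V F. open V \<and> x \<in> V \<and> smooth_on V F \<and>
      (\<forall>x' \<in> V \<inter> Sp_group. coset U_group x' \<in> ?M \<longrightarrow> F x' = psi (coset U_group x'))" for x
    using F by (intro exI[of _ UNIV] exI[of _ ?F]) (simp add: psi_coset)
  show ?thesis
    unfolding quotient_atlas_def mem_Collect_eq case_prod_conv
    by (intro conjI op inj opi ballI impI) (rule fw, erule bw)
qed

section \<open>Straightening a pair of functions\<close>

text \<open>The map \<open>\<kappa>\<close> is the identity, corrected along \<open>\<nu>1\<close>
  and \<open>\<nu>2\<close> so that the linear forms take the values of \<open>F1\<close> and
  \<open>F2\<close>. The correction has derivative zero at \<open>y\<close>, so the derivative of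
  \<open>\<kappa>\<close> there is the identity and a smooth local inverse exists.\<close>

lemma straightening:
  fixes F1 F2 :: "real^'k \<Rightarrow> real"
  assumes \<Omega>: "open \<Omega>" "y \<in> \<Omega>" and F: "smooth_on \<Omega> F1" "smooth_on \<Omega> F2"
    and dF: "(F1 has_derivative l1) (at y)" "(F2 has_derivative l2) (at y)"
    and \<nu>: "l1 \<nu>1 = 1" "l1 \<nu>2 = 0" "l2 \<nu>1 = 0" "l2 \<nu>2 = 1"
  obtains V W \<kappa> g where "open V" "V \<subseteq> \<Omega>" "y \<in> V" "open W" "homeomorphism V W \<kappa> g"
    "smooth_on V \<kappa>" "smooth_on W g" "\<And>z. z \<in> V \<Longrightarrow> l1 (\<kappa> z) = F1 z \<and> l2 (\<kappa> z) = F2 z"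
    "(g has_derivative (\<lambda>v. v)) (at (\<kappa> y))"
proof -
  define \<kappa> where "\<kappa> z = z + (F1 z - l1 z) *\<^sub>R \<nu>1 + (F2 z - l2 z) *\<^sub>R \<nu>2" for z
  have lin: "linear l1" "linear l2" using dF has_derivative_linear by blast+
  have lsm: "smooth_on \<Omega> l1" "smooth_on \<Omega> l2"
    using smooth_on_linear[OF lin(1) smooth_on_id \<Omega>(1)] smooth_on_linear[OF lin(2) smooth_on_id \<Omega>(1)] .
  have sm: "smooth_on \<Omega> \<kappa>"
    unfolding \<kappa>_def by (intro smooth_on_add smooth_on_scaleR smooth_on_diff smooth_on_id smooth_on_const F lsm \<Omega>)
  have "(\<kappa> has_derivative (\<lambda>v. v + (l1 v - l1 v) *\<^sub>R \<nu>1 + (l2 v - l2 v) *\<^sub>R \<nu>2)) (at y)"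
    unfolding \<kappa>_def
    by (intro has_derivative_add has_derivative_scaleR_left has_derivative_diff dF has_derivative_ident
        linear_imp_has_derivative lin)
  then have d\<kappa>: "(\<kappa> has_derivative (\<lambda>v. v)) (at y)" by simp
  have "v = 0" if "frechet_derivative \<kappa> (at y) v = 0" for v
    using that fun_cong[OF frechet_derivative_at[OF d\<kappa>], of v] by simp
  then obtain V W g where V: "open V" "V \<subseteq> \<Omega>" "y \<in> V" "open W" "\<kappa> y \<in> W" "homeomorphism V W \<kappa> g" "smooth_on W g"
    using smooth_inverse_function[OF \<Omega> sm] by blast
  have l\<kappa>: "l1 (\<kappa> z) = F1 z \<and> l2 (\<kappa> z) = F2 z" for z
    by (simp add: \<kappa>_def linear_add[OF lin(1)] linear_add[OF lin(2)] linear_cmul[OF lin(1)] linear_cmul[OF lin(2)] \<nu>)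
  let ?G = "frechet_derivative g (at (\<kappa> y))"
  have g: "(g has_derivative ?G) (at (\<kappa> y))" by (rule smooth_on_has_derivative[OF V(7,5)])
  have "((\<lambda>z. g (\<kappa> z)) has_derivative (\<lambda>v. ?G v)) (at y)"
    by (rule has_derivative_compose[OF d\<kappa> g])
  then have "((\<lambda>z. z) has_derivative (\<lambda>v. ?G v)) (at y)"
    by (rule has_derivative_transform_within_open[OF _ V(1,3)]) (use V(6) in \<open>simp add: homeomorphism_def\<close>)
  from has_derivative_unique[OF this has_derivative_ident] have "?G = (\<lambda>v. v)" .
  then have "(g has_derivative (\<lambda>v. v)) (at (\<kappa> y))" using g by simp
  with V l\<kappa> smooth_on_subset[OF sm V(2)] show thesis by (intro that[of V W \<kappa> g]) auto
qed

text \<open>The dual vectors \<open>\<nu>1\<close> and \<open>\<nu>2\<close> span a complement of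
  the common kernel.\<close>

lemma dim_common_kernel:
  fixes l1 l2 :: "'e::euclidean_space \<Rightarrow> real"
  assumes lin: "linear l1" "linear l2"
    and \<nu>: "l1 \<nu>1 = 1" "l1 \<nu>2 = 0" "l2 \<nu>1 = 0" "l2 \<nu>2 = 1"
  shows "subspace {v. l1 v = 0 \<and> l2 v = 0}" "dim {v. l1 v = 0 \<and> l2 v = 0} + 2 = DIM('e)"
proof -
  let ?L = "{v. l1 v = 0 \<and> l2 v = 0}" and ?T = "span {\<nu>1, \<nu>2}"
  show L: "subspace ?L"
    by (rule subspaceI) (simp_all add: linear_0[OF lin(1)] linear_0[OF lin(2)] linear_add[OF lin(1)]
        linear_add[OF lin(2)] linear_cmul[OF lin(1)] linear_cmul[OF lin(2)])
  have T: "\<exists>s t. x = s *\<^sub>R \<nu>1 + t *\<^sub>R \<nu>2" if "x \<in> ?T" for x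
    using that unfolding span_insert[of \<nu>1] span_singleton by (auto simp: algebra_simps) (metis add.commute diff_add_cancel)
  have lT: "l1 (s *\<^sub>R \<nu>1 + t *\<^sub>R \<nu>2) = s" "l2 (s *\<^sub>R \<nu>1 + t *\<^sub>R \<nu>2) = t" for s t
    by (simp_all add: linear_add[OF lin(1)] linear_add[OF lin(2)] linear_cmul[OF lin(1)] linear_cmul[OF lin(2)] \<nu>)
  have int: "?L \<inter> ?T = {0}"
  proof (intro equalityI subsetI)
    fix x assume x: "x \<in> ?L \<inter> ?T"
    then obtain s t where "x = s *\<^sub>R \<nu>1 + t *\<^sub>R \<nu>2" using T by blast
    with x lT[of s t] show "x \<in> {0}" by auto
  qed (use L subspace_0 span_zero in auto)
  have "x \<in> {a + b |a b. a \<in> ?L \<and> b \<in> ?T}" for x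
  proof -
    let ?b = "l1 x *\<^sub>R \<nu>1 + l2 x *\<^sub>R \<nu>2"
    have "?b \<in> ?T" by (intro span_add span_scale span_base) auto
    moreover have "x - ?b \<in> ?L"
      using lT[of "l1 x" "l2 x"] by (simp add: linear_diff[OF lin(1)] linear_diff[OF lin(2)])
    ultimately show ?thesis by (intro CollectI exI[of _ "x - ?b"] exI[of _ ?b]) simp
  qed
  then have sum: "{a + b |a b. a \<in> ?L \<and> b \<in> ?T} = UNIV" by blast
  have "\<nu>1 \<noteq> \<nu>2" using \<nu> by auto
  have "independent {\<nu>1, \<nu>2}"
  proof (rule independent_insertI)
    show "\<nu>1 \<notin> span {\<nu>2}"
    proof
      assume "\<nu>1 \<in> span {\<nu>2}"
      then obtain t where "\<nu>1 = t *\<^sub>R \<nu>2" by (auto simp: span_singleton)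
      then show False using \<nu> linear_cmul[OF lin(1), of t \<nu>2] by simp
    qed
    show "independent {\<nu>2}"
      using \<nu>(4) linear_0[OF lin(2)] by (auto simp: dependent_single)
  qed
  then have "dim ?T = 2" using \<open>\<nu>1 \<noteq> \<nu>2\<close> by (simp add: dim_eq_card_independent)
  with dim_sums_Int[OF L subspace_span[of "{\<nu>1, \<nu>2}"]] show "dim ?L + 2 = DIM('e)"
    unfolding int sum by simp
qed

section \<open>The zero locus in a chart\<close>

definition locus_re :: "real^'m \<Rightarrow> real^'m \<Rightarrow> real^'m^'m \<Rightarrow> real" where
  "locus_re a1 a2 M = a1 \<bullet> (M *v a1) - a2 \<bullet> (M *v a2)"

text \<open>For symmetric \<open>M\<close> this is half the imaginary part of a^t M a, with the same
  zeros.\<close>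

definition locus_im :: "real^'m \<Rightarrow> real^'m \<Rightarrow> real^'m^'m \<Rightarrow> real" where
  "locus_im a1 a2 M = a1 \<bullet> (M *v a2)"

lemma linear_locus: "linear (locus_re a1 a2)" "linear (locus_im a1 a2)"
  by (auto intro!: linearI simp: locus_re_def locus_im_def matrix_vector_mult_add_rdistrib
      matrix_vector_mult_scaleR_left inner_add_right right_diff_distrib)

lemma trace_outer:
  fixes a1 a2 :: "real^'m"
  assumes "a = (\<chi> i. complex_of_real (a1 $ i) + \<i> * complex_of_real (a2 $ i))"
  shows "trace (outer a ** cmat M) = Complex (locus_re a1 a2 M) (locus_im a1 a2 M + locus_im a2 a1 M)"
proof -
  have q: "b \<bullet> (M *v c) = (\<Sum>i\<in>UNIV. \<Sum>j\<in>UNIV. b $ j * c $ i * M $ j $ i)" for b c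
    unfolding inner_vec_def matrix_vector_mult_def
    by (subst sum.swap) (simp add: sum_distrib_left mult_ac)
  have "trace (outer a ** cmat M) = (\<Sum>i\<in>UNIV. \<Sum>j\<in>UNIV. a $ i * a $ j * complex_of_real (M $ j $ i))"
    by (simp add: trace_def matrix_matrix_mult_def outer_def cmat_def)
  also have "\<dots> = Complex (locus_re a1 a2 M) (locus_im a1 a2 M + locus_im a2 a1 M)"
    unfolding locus_re_def locus_im_def q
    by (simp add: complex_eq_iff assms sum_subtractf[symmetric] sum.distrib[symmetric] algebra_simps)
  finally show ?thesis .
qed

lemma phi_eq_0_iff:
  fixes a1 a2 :: "real^('n::finite + 'n)"
  assumes a: "a = (\<chi> i. complex_of_real (a1 $ i) + \<i> * complex_of_real (a2 $ i))"
  shows "phi a (coset U_group x) = 0 \<longleftrightarrow>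
    locus_re a1 a2 (x ** transpose x) = 0 \<and> locus_im a1 a2 (x ** transpose x) = 0"
proof -
  have "locus_im a2 a1 (x ** transpose x) = locus_im a1 a2 (x ** transpose x)"
    using dot_matrix_mult[of a2 "x ** transpose x" a1]
    by (simp add: locus_im_def matrix_transpose_mul inner_commute)
  then have "phi a (coset U_group x) = Complex (locus_re a1 a2 (x ** transpose x)) (2 * locus_im a1 a2 (x ** transpose x))"
    using trace_outer[OF a, of "x ** transpose x"]
    by (simp add: phi_coset matrix_mul_assoc[symmetric] cmat_mult[symmetric] cmat_transpose[symmetric])
  then show ?thesis by (simp add: complex_eq_iff)
qed

definition zero_locus :: "real^('n::finite + 'n) \<Rightarrow> real^('n + 'n) \<Rightarrow> (real^('n + 'n)^('n + 'n)) set set" where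
  "zero_locus a1 a2 = {C \<in> coset U_group ` Sp_group. locus_re a1 a2 (gram C) = 0 \<and> locus_im a1 a2 (gram C) = 0}"

text \<open>Passing to x^t a1 and x^t a2 moves the representative off the matrix, so that both
  equations and their differentials are expressed by the pair treated in
  \<open>isotropic_pair\<close>.\<close>

lemma locus_conj:
  "locus_re a1 a2 (x ** X ** transpose x) =
    (transpose x *v a1) \<bullet> (X *v (transpose x *v a1)) - (transpose x *v a2) \<bullet> (X *v (transpose x *v a2))"
  "locus_im a1 a2 (x ** X ** transpose x) = (transpose x *v a1) \<bullet> (X *v (transpose x *v a2))"
  by (simp_all add: locus_re_def locus_im_def matrix_vector_mul_assoc[symmetric] dot_matrix_mult[of _ x])

section \<open>Derivatives along linear subspaces\<close>

lemma subspace_contains_derivative: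
  fixes h :: "real \<Rightarrow> 'e::euclidean_space"
  assumes L: "subspace L" and T: "open T" "0 \<in> T" "\<And>t. t \<in> T \<Longrightarrow> h t \<in> L"
    and v: "(h has_vector_derivative v) (at 0)"
  shows "v \<in> L"
proof -
  obtain p z where pz: "p \<in> span L" "\<And>w. w \<in> span L \<Longrightarrow> orthogonal z w" "v = p + z"
    using orthogonal_subspace_decomp_exists[of L v] by blast
  have "((\<lambda>t. h t \<bullet> z) has_vector_derivative v \<bullet> z) (at 0)"
    by (rule bounded_linear.has_vector_derivative[OF bounded_linear_inner_left v])
  moreover have "h t \<bullet> z = 0" if "t \<in> T" for t
    using pz(2)[OF span_base[OF T(3)[OF that]]] by (simp add: orthogonal_def inner_commute)
  ultimately have "((\<lambda>t. 0) has_vector_derivative v \<bullet> z) (at 0)"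
    by (rule has_vector_derivative_transform_within_open[OF _ T(1,2)])
  then have "v \<bullet> z = 0" using has_vector_derivative_const vector_derivative_unique_at by blast
  moreover have "p \<bullet> z = 0" using pz(1,2) by (simp add: orthogonal_def inner_commute)
  ultimately have "z = 0" using pz(3) by (simp add: inner_add_left)
  then show ?thesis using pz(1,3) L by (simp add: span_eq_iff[THEN iffD2])
qed

lemma vanishing_derivative:
  fixes h :: "'e::real_normed_vector \<Rightarrow> real"
  assumes \<Omega>: "open \<Omega>" "z \<in> \<Omega>" and L: "subspace L" "z \<in> L" "e \<in> L"
    and h: "(h has_derivative h') (at z)" and 0: "\<And>z. z \<in> \<Omega> \<Longrightarrow> z \<in> L \<Longrightarrow> h z = 0"
  shows "h' e = 0"
proof -
  let ?T = "(\<lambda>t. z + t *\<^sub>R e) -` \<Omega>"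
  have T: "open ?T" "0 \<in> ?T" using \<Omega> by (auto intro!: open_vimage continuous_intros)
  have "((\<lambda>t. h (z + t *\<^sub>R e)) has_real_derivative h' e) (at 0)"
    using h by (intro has_real_derivative_along_line) simp
  then have "((\<lambda>t. 0) has_real_derivative h' e) (at 0)"
    by (rule has_field_derivative_transform_within_open[OF _ T])
      (use L 0 in \<open>auto intro: subspace_add subspace_scale\<close>)
  then show ?thesis using DERIV_unique DERIV_const by blast
qed

lemma subspace_orthonormal_basis:
  fixes S :: "'e::euclidean_space set"
  assumes "subspace S"
  shows "\<exists>B. B \<subseteq> S \<and> pairwise orthogonal B \<and> (\<forall>b\<in>B. norm b = 1) \<and> finite B \<and> span B = S"
proof (rule orthonormal_basis_subspace[OF assms])
  fix B assume "B \<subseteq> S" "pairwise orthogonal B" "\<And>x. x \<in> B \<Longrightarrow> norm x = 1" "independent B" "span B = S"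
  then show ?thesis using independent_imp_finite by (intro exI[of _ B]) simp
qed

section \<open>Regularity of the zero locus and existence of slice charts\<close>

locale zero_locus_chart = sp_chart U \<phi>
  for U and \<phi> :: "(real^('n::finite + 'n)^('n + 'n)) set \<Rightarrow> real^'k" +
  fixes a1 a2 :: "real^('n + 'n)"
  assumes a1: "a1 \<noteq> 0"
begin

abbreviation "F1 \<equiv> locus_re a1 a2"
abbreviation "F2 \<equiv> locus_im a1 a2"
abbreviation "Z \<equiv> zero_locus a1 a2"
abbreviation "g \<equiv> submersion_metric Sp_group U_group (U, \<phi>)"

lemma chart_in_Z: "z \<in> \<phi> ` U \<Longrightarrow> pt z \<in> Z \<longleftrightarrow> F1 (S z) = 0 \<and> F2 (S z) = 0"
  using pt_in U_cosets unfolding zero_locus_def S_pt by blast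

lemma image_Z: "\<phi> ` (U \<inter> Z) = {z \<in> \<phi> ` U. F1 (S z) = 0 \<and> F2 (S z) = 0}"
proof (intro equalityI subsetI)
  fix z assume "z \<in> \<phi> ` (U \<inter> Z)"
  then obtain C where "C \<in> U" "C \<in> Z" "z = \<phi> C" by blast
  then show "z \<in> {z \<in> \<phi> ` U. F1 (S z) = 0 \<and> F2 (S z) = 0}"
    using chart_in_Z[of z] by (simp add: pt_chart)
next
  fix z assume z: "z \<in> {z \<in> \<phi> ` U. F1 (S z) = 0 \<and> F2 (S z) = 0}"
  then have "pt z \<in> U \<inter> Z" using chart_in_Z pt_in by blast
  then show "z \<in> \<phi> ` (U \<inter> Z)" using z chart_pt[of z] by (metis (no_types, lifting) imageI mem_Collect_eq)
qed

lemma has_derivative_F: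
  assumes "z \<in> \<phi> ` U"
  shows "((\<lambda>z. F1 (S z)) has_derivative (\<lambda>v. F1 (D z v))) (at z)"
    "((\<lambda>z. F2 (S z)) has_derivative (\<lambda>v. F2 (D z v))) (at z)"
    "((\<lambda>z. F1 (D z w)) has_derivative (\<lambda>v. F1 (D2 z w v))) (at z)"
    "((\<lambda>z. F2 (D z w)) has_derivative (\<lambda>v. F2 (D2 z w v))) (at z)"
  using has_derivative_S[OF assms] has_derivative_D[OF assms]
    bounded_linear.has_derivative[OF linear_locus(1)[unfolded linear_conv_bounded_linear]]
    bounded_linear.has_derivative[OF linear_locus(2)[unfolded linear_conv_bounded_linear]]
  by blast+

lemma frame_at_zero:
  assumes y: "y \<in> \<phi> ` U" and 0: "F1 (S y) = 0" "F2 (S y) = 0"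
    and x: "x \<in> Sp_group" "coset U_group x \<in> U" "\<phi> (coset U_group x) = y"
  shows "isotropic_pair (transpose x *v a1) (transpose x *v a2)"
proof
  have S: "S y = x ** mat 1 ** transpose x" using S_coset[OF x(2)] x(3) by simp
  show "(transpose x *v a1) \<bullet> (transpose x *v a1) = (transpose x *v a2) \<bullet> (transpose x *v a2)"
    "(transpose x *v a1) \<bullet> (transpose x *v a2) = 0"
    using 0 unfolding S locus_conj by simp_all
  show "transpose x *v a1 \<noteq> 0"
  proof
    assume "transpose x *v a1 = 0"
    then have "matrix_inv (transpose x) *v (transpose x *v a1) = 0" by simp
    then show False using a1 by (simp add: matrix_vector_mul_assoc Sp_inv Sp_transpose x)
  qed
qed

text \<open>In the frame the two differentials are inner products with \<open>2 *\<^sub>R P1\<close>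
  and \<open>P2\<close>. These are orthogonal and \<open>P1\<close>, \<open>P2\<close> have squared
  norm \<open>N > 0\<close>, so suitable multiples of \<open>P1\<close> and \<open>P2\<close> form
  the dual pair.\<close>

lemma regular:
  assumes y: "y \<in> \<phi> ` U" and 0: "F1 (S y) = 0" "F2 (S y) = 0"
  obtains \<nu>1 \<nu>2 where "F1 (D y \<nu>1) = 1" "F1 (D y \<nu>2) = 0" "F2 (D y \<nu>1) = 0" "F2 (D y \<nu>2) = 1"
proof (rule frame[OF y])
  fix x :: "real^('n + 'n)^('n + 'n)" and T :: "real^'k \<Rightarrow> real^('n + 'n)^('n + 'n)"
  assume x: "x \<in> Sp_group" "coset U_group x \<in> U" "\<phi> (coset U_group x) = y"
    and T: "linear T" "inj T" "range T = p_space" "\<And>v. D y v = 2 *\<^sub>R (x ** T v ** transpose x)"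
  interpret isotropic_pair "transpose x *v a1" "transpose x *v a2"
    by (rule frame_at_zero[OF y 0 x])
  have F: "F1 (D y v) = 2 * (T v \<bullet> P1)" "F2 (D y v) = T v \<bullet> P2" for v
  proof -
    have "T v \<in> p_space" using T(3) by blast
    then show "F1 (D y v) = 2 * (T v \<bullet> P1)" "F2 (D y v) = T v \<bullet> P2"
      by (simp_all add: T(4) linear_cmul[OF linear_locus(1)] linear_cmul[OF linear_locus(2)] locus_conj
          inner_P1 inner_P2)
  qed
  obtain \<nu>1 where \<nu>1: "T \<nu>1 = (1 / (2 * N)) *\<^sub>R P1"
    using T(3) subspace_scale[OF subspace_p_space P_in(1)] by (metis imageE)
  obtain \<nu>2 where \<nu>2: "T \<nu>2 = (1 / N) *\<^sub>R P2"
    using T(3) subspace_scale[OF subspace_p_space P_in(2)] by (metis imageE)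
  show thesis
    using N_pos inner_P by (intro that[of \<nu>1 \<nu>2]) (simp_all add: F \<nu>1 \<nu>2 inner_commute[of P2 P1])
qed

lemma smooth_F: "smooth_on (\<phi> ` U) (\<lambda>z. F1 (S z))" "smooth_on (\<phi> ` U) (\<lambda>z. F2 (S z))"
  using smooth_on_linear[OF linear_locus(1) smooth_S open_image] smooth_on_linear[OF linear_locus(2) smooth_S open_image] .

lemma straighten_at_zero:
  assumes y: "y \<in> \<phi> ` U" and 0: "F1 (S y) = 0" "F2 (S y) = 0"
  obtains V W \<kappa> h where "open V" "V \<subseteq> \<phi> ` U" "y \<in> V" "open W" "homeomorphism V W \<kappa> h"
    "smooth_on V \<kappa>" "smooth_on W h"
    "\<And>z. z \<in> V \<Longrightarrow> F1 (D y (\<kappa> z)) = F1 (S z) \<and> F2 (D y (\<kappa> z)) = F2 (S z)"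
    "(h has_derivative (\<lambda>v. v)) (at (\<kappa> y))"
    "subspace {v. F1 (D y v) = 0 \<and> F2 (D y v) = 0}"
    "dim {v. F1 (D y v) = 0 \<and> F2 (D y v) = 0} + 2 = CARD('k)"
proof (rule regular[OF y 0])
  fix \<nu>1 \<nu>2
  assume \<nu>: "F1 (D y \<nu>1) = 1" "F1 (D y \<nu>2) = 0" "F2 (D y \<nu>1) = 0" "F2 (D y \<nu>2) = 1"
  note d = has_derivative_F(1,2)[OF y]
  note k = dim_common_kernel[OF d[THEN has_derivative_linear] \<nu>]
  show thesis
    by (rule straightening[OF open_image y smooth_F d \<nu>]) (rule that, assumption+, use k in simp_all)
qed

text \<open>In the chart straightened at \<open>C\<close> both equations are linear, so the locus is
  the part of the image that lies in the kernel of their differentials.\<close>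

lemma slice_exists:
  assumes C: "C \<in> U" "C \<in> Z"
  obtains c L where "slice_chart (coset_space Sp_group U_group :: (_, real^'k) riemannian) Z c L"
    "C \<in> fst c" "dim L + 2 = CARD('k)"
proof -
  have y: "\<phi> C \<in> \<phi> ` U" using C by blast
  have 0: "F1 (S (\<phi> C)) = 0" "F2 (S (\<phi> C)) = 0" using C(2) by (simp_all add: S_chart C(1) zero_locus_def)
  let ?L = "{v. F1 (D (\<phi> C) v) = 0 \<and> F2 (D (\<phi> C) v) = 0}"
  show thesis
  proof (rule straighten_at_zero[OF y 0])
    fix V W \<kappa> h
    assume V: "open V" "V \<subseteq> \<phi> ` U" "\<phi> C \<in> V" "open W" and h: "homeomorphism V W \<kappa> h"
      and sm: "smooth_on V \<kappa>" "smooth_on W h"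
      and F: "\<And>z. z \<in> V \<Longrightarrow> F1 (D (\<phi> C) (\<kappa> z)) = F1 (S z) \<and> F2 (D (\<phi> C) (\<kappa> z)) = F2 (S z)"
      and L: "subspace ?L" "dim ?L + 2 = CARD('k)"
    let ?U = "{C \<in> U. \<phi> C \<in> V}"
    have c: "(?U, \<kappa> \<circ> \<phi>) \<in> quotient_atlas Sp_group U_group"
      by (rule compose_chart[OF V(1,2,4) h sm])
    have "(\<kappa> \<circ> \<phi>) ` (?U \<inter> Z) = (\<kappa> \<circ> \<phi>) ` ?U \<inter> ?L"
    proof (intro equalityI subsetI)
      fix w assume "w \<in> (\<kappa> \<circ> \<phi>) ` (?U \<inter> Z)"
      then obtain C' where C': "C' \<in> U" "\<phi> C' \<in> V" "C' \<in> Z" "w = \<kappa> (\<phi> C')" by auto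
      then show "w \<in> (\<kappa> \<circ> \<phi>) ` ?U \<inter> ?L"
        using F[OF C'(2)] by (auto simp: S_chart zero_locus_def)
    next
      fix w assume "w \<in> (\<kappa> \<circ> \<phi>) ` ?U \<inter> ?L"
      then obtain C' where C': "C' \<in> U" "\<phi> C' \<in> V" "w = \<kappa> (\<phi> C')" "w \<in> ?L" by auto
      then have "C' \<in> Z" using F[OF C'(2)] U_cosets[OF C'(1)] by (auto simp: S_chart zero_locus_def)
      then show "w \<in> (\<kappa> \<circ> \<phi>) ` (?U \<inter> Z)" using C' by auto
    qed
    then have "slice_chart (coset_space Sp_group U_group) Z (?U, \<kappa> \<circ> \<phi>) ?L"
      using c L(1) by (simp add: slice_chart_def coset_space_def)
    then show thesis using C(1) V(3) L(2) by (intro that[of "(?U, \<kappa> \<circ> \<phi>)" ?L]) auto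
  qed
qed

end

section \<open>Mean curvature in an arbitrary slice chart\<close>

locale slice = zero_locus_chart U \<phi> a1 a2
  for U and \<phi> :: "(real^('n::finite + 'n)^('n + 'n)) set \<Rightarrow> real^'k" and a1 a2 +
  fixes L
  assumes slice: "slice_chart (coset_space Sp_group U_group) Z (U, \<phi>) L"
begin

lemma L: "subspace L" and L_image: "{z \<in> \<phi> ` U. F1 (S z) = 0 \<and> F2 (S z) = 0} = \<phi> ` U \<inter> L"
  using slice image_Z by (simp_all add: slice_chart_def)

lemma F_on_L: "z \<in> \<phi> ` U \<Longrightarrow> z \<in> L \<Longrightarrow> F1 (S z) = 0 \<and> F2 (S z) = 0"
  using L_image by blast

lemma D_on_L:
  assumes z: "z \<in> \<phi> ` U" "z \<in> L" and e: "e \<in> L"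
  shows "F1 (D z e) = 0 \<and> F2 (D z e) = 0"
  using vanishing_derivative[OF open_image z(1) L z(2) e has_derivative_F(1)[OF z(1)]]
    vanishing_derivative[OF open_image z(1) L z(2) e has_derivative_F(2)[OF z(1)]] F_on_L by blast

text \<open>In a slice chart the coordinate second derivatives of the equations vanish along
  \<open>L\<close>, so the Hessian in these directions is given by the Christoffel term
  alone.\<close>

lemma D2_on_L:
  assumes z: "z \<in> \<phi> ` U" "z \<in> L" and e: "e \<in> L"
  shows "F1 (D2 z e e) = 0 \<and> F2 (D2 z e e) = 0"
  using vanishing_derivative[OF open_image z(1) L z(2) e has_derivative_F(3)[OF z(1)]]
    vanishing_derivative[OF open_image z(1) L z(2) e has_derivative_F(4)[OF z(1)]] D_on_L e by blast

text \<open>For a vector \<open>v\<close> of the kernel, the line through \<open>\<kappa> y\<close>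
  in direction \<open>v\<close> is pulled back from the straightened coordinates. The resulting
  curve satisfies both equations, so it lies in \<open>L\<close>; its velocity is \<open>v\<close>
  because the inverse of \<open>\<kappa>\<close> has the identity as derivative.\<close>

lemma L_eq_kernel:
  assumes y: "y \<in> \<phi> ` U" "y \<in> L"
  shows "L = {v. F1 (D y v) = 0 \<and> F2 (D y v) = 0}"
proof (intro equalityI subsetI)
  fix v assume v: "v \<in> {v. F1 (D y v) = 0 \<and> F2 (D y v) = 0}"
  have 0: "F1 (S y) = 0" "F2 (S y) = 0" using F_on_L[OF y] by auto
  show "v \<in> L"
  proof (rule straighten_at_zero[OF y(1) 0])
    fix V W \<kappa> h
    assume V: "open V" "V \<subseteq> \<phi> ` U" "y \<in> V" "open W" and h: "homeomorphism V W \<kappa> h"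
      and F: "\<And>z. z \<in> V \<Longrightarrow> F1 (D y (\<kappa> z)) = F1 (S z) \<and> F2 (D y (\<kappa> z)) = F2 (S z)"
      and dh: "(h has_derivative (\<lambda>v. v)) (at (\<kappa> y))"
    have h': "\<And>w. w \<in> W \<Longrightarrow> h w \<in> V \<and> \<kappa> (h w) = w" "\<kappa> y \<in> W"
      using h V(3) by (auto simp: homeomorphism_def)
    let ?l = "\<lambda>t. \<kappa> y + t *\<^sub>R v"
    let ?T = "?l -` W"
    have T: "open ?T" "0 \<in> ?T" using V(4) h'(2) by (auto intro!: open_vimage continuous_intros)
    have l: "(?l has_derivative (\<lambda>t. t *\<^sub>R v)) (at 0)" by (auto intro!: derivative_eq_intros)
    have "((\<lambda>t. h (?l t)) has_derivative (\<lambda>t. t *\<^sub>R v)) (at 0)"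
      by (rule has_derivative_compose[OF l]) (simp add: dh)
    then have d: "((\<lambda>t. h (?l t)) has_vector_derivative v) (at 0)"
      by (simp add: has_vector_derivative_def)
    have lin: "F1 (D y (?l t)) = F1 (D y (\<kappa> y)) + t * F1 (D y v)" "F2 (D y (?l t)) = F2 (D y (\<kappa> y)) + t * F2 (D y v)" for t
      using linear_D[OF y(1)] linear_locus
      by (simp_all add: linear_add[OF linear_D[OF y(1)]] linear_cmul[OF linear_D[OF y(1)]] linear_add[OF linear_locus(1)]
          linear_add[OF linear_locus(2)] linear_cmul[OF linear_locus(1)] linear_cmul[OF linear_locus(2)])
    have "h (?l t) \<in> L" if "t \<in> ?T" for t
    proof -
      have w: "h (?l t) \<in> V" "\<kappa> (h (?l t)) = ?l t" using h'(1) that by auto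
      have "F1 (S (h (?l t))) = 0 \<and> F2 (S (h (?l t))) = 0"
        using F[OF w(1)] F[OF V(3)] lin[of t] v 0 unfolding w(2) by simp
      then show ?thesis using L_image w(1) V(2) by blast
    qed
    from subspace_contains_derivative[OF L T this d] show "v \<in> L" .
  qed
qed (use D_on_L[OF y] in blast)

text \<open>The trace of the second fundamental form is a sum over an orthonormal basis of \<open>L\<close>, which
  \<open>T\<close> maps to an orthonormal basis of the space in the lemma \<open>harmonic_sum\<close>.\<close>

theorem mean_curvature_0:
  assumes y: "y \<in> \<phi> ` U" "y \<in> L"
  shows "mean_curvature g L y = 0"
proof (rule frame[OF y(1)])
  fix x :: "real^('n + 'n)^('n + 'n)" and T :: "real^'k \<Rightarrow> real^('n + 'n)^('n + 'n)"
  assume x: "x \<in> Sp_group" "coset U_group x \<in> U" "\<phi> (coset U_group x) = y"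
    and T: "linear T" "inj T" "range T = p_space" "\<And>v. D y v = 2 *\<^sub>R (x ** T v ** transpose x)"
  let ?u = "transpose x *v a1" and ?w = "transpose x *v a2"
  have 0: "F1 (S y) = 0" "F2 (S y) = 0" using F_on_L[OF y] by auto
  interpret isotropic_pair ?u ?w by (rule frame_at_zero[OF y(1) 0 x])
  have Tp: "T v \<in> p_space" for v using T(3) by blast
  have gT: "g y v w = T v \<bullet> T w" for v w
    by (simp add: submersion_metric_eq[OF y(1)] T(4) bform_conj[OF x(1) Tp Tp])
  have F: "F1 (D y v) = 2 * (?u \<bullet> (T v *v ?u) - ?w \<bullet> (T v *v ?w))" "F2 (D y v) = 2 * (?u \<bullet> (T v *v ?w))" for v
    by (simp_all add: T(4) linear_cmul[OF linear_locus(1)] linear_cmul[OF linear_locus(2)] locus_conj)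
  let ?l = "{X \<in> p_space. ?u \<bullet> (X *v ?u) = ?w \<bullet> (X *v ?w) \<and> ?u \<bullet> (X *v ?w) = 0}"
  have TL: "T ` L = ?l"
  proof (intro equalityI subsetI)
    fix X assume "X \<in> ?l"
    then obtain v where "X = T v" using T(3) by blast
    with \<open>X \<in> ?l\<close> have "v \<in> L" unfolding L_eq_kernel[OF y] by (simp add: F)
    with \<open>X = T v\<close> show "X \<in> T ` L" by blast
  qed (use Tp in \<open>auto simp: L_eq_kernel[OF y] F\<close>)
  have "\<exists>B. orthonormal_basis g L y B"
  proof -
    obtain B0 where B0: "B0 \<subseteq> T ` L" "pairwise orthogonal B0" "\<forall>b\<in>B0. norm b = 1"
      "finite B0" "span B0 = T ` L"
      using subspace_orthonormal_basis[OF linear_subspace_image[OF T(1) L]] by blast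
    define B where "B = T -` B0"
    have TB: "T ` B = B0" unfolding B_def image_vimage_eq using B0(1) by blast
    have "finite B" unfolding B_def using B0(4) T(2) by (rule finite_vimageI)
    moreover have "T ` span B = T ` L"
      using B0(5) linear_span_image[OF T(1), of B] TB by simp
    then have "span B = L" using T(2) by (simp add: inj_image_eq_iff)
    moreover have "g y u v = (if u = v then 1 else 0)" if "u \<in> B" "v \<in> B" for u v
    proof (cases "u = v")
      case True
      then show ?thesis using B0(3) that(1) unfolding gT B_def norm_eq_1 by simp
    next
      case False
      then have "T u \<noteq> T v" using T(2) by (simp add: inj_eq)
      moreover have "T u \<in> B0" "T v \<in> B0" using that by (simp_all add: B_def)
      ultimately have "orthogonal (T u) (T v)" using B0(2) unfolding pairwise_def by blast
      then show ?thesis using False by (simp add: gT orthogonal_def)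
    qed
    ultimately show ?thesis unfolding orthonormal_basis_def by blast
  qed
  moreover define B where "B = (SOME B. orthonormal_basis g L y B)"
  ultimately have "orthonormal_basis g L y B" by (simp only: someI_ex)
  then have B: "finite B" "span B = L" "\<And>u v. u \<in> B \<Longrightarrow> v \<in> B \<Longrightarrow> T u \<bullet> T v = (if u = v then 1 else 0)"
    unfolding orthonormal_basis_def gT by blast+
  have injB: "inj_on T B" using T(2) by (rule inj_on_subset) simp
  have TB: "finite (T ` B)" "pairwise orthogonal (T ` B)" "\<And>b. b \<in> T ` B \<Longrightarrow> norm b = 1" "span (T ` B) = ?l"
  proof -
    show "finite (T ` B)" using B(1) by simp
    show "pairwise orthogonal (T ` B)" using B(3) by (auto simp: pairwise_def orthogonal_def)
    show "norm b = 1" if "b \<in> T ` B" for b using B(3) that by (auto simp: norm_eq_1)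
    show "span (T ` B) = ?l" using linear_span_image[OF T(1), of B] B(2) TL by simp
  qed
  have BL: "b \<in> L" if "b \<in> B" for b using span_base[OF that] B(2) by simp
  \<comment> \<open>The orthogonal projection onto \<open>L\<close> with respect to the metric at
    \<open>y\<close>.\<close>
  let ?pr = "\<lambda>w. \<Sum>b\<in>B. (T w \<bullet> T b) *\<^sub>R b"
  have prL: "?pr w \<in> L" for w using L BL by (intro subspace_sum subspace_scale)
  have Tpr: "T (?pr w) = (\<Sum>b\<in>T ` B. (T w \<bullet> b) *\<^sub>R b)" for w
    by (simp add: linear_sum[OF T(1)] linear_cmul[OF T(1)] sum.reindex[OF injB])
  have fixed: "?pr w = w" if "w \<in> L" for w
  proof -
    have "T w \<in> span (T ` B)" using that TL TB(4) by blast
    from orthonormal_basis_expand[OF TB(2) TB(3) this TB(1)] have "T (?pr w) = T w"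
      unfolding Tpr .
    then show ?thesis using T(2) by (simp add: inj_eq)
  qed
  have prb: "T (?pr w) \<bullet> T b = T w \<bullet> T b" if "b \<in> B" for w b
  proof -
    have "T (?pr w) \<bullet> T b = (\<Sum>c\<in>B. (T w \<bullet> T c) * (T c \<bullet> T b))"
      by (simp add: linear_sum[OF T(1)] linear_cmul[OF T(1)] inner_sum_left)
    also have "\<dots> = (\<Sum>c\<in>B. if c = b then T w \<bullet> T b else 0)"
      using that by (intro sum.cong refl) (simp add: B(3))
    also have "\<dots> = T w \<bullet> T b" using that B(1) by simp
    finally show ?thesis .
  qed
  have normal: "normal_part g L y w = w - ?pr w" for w
    unfolding normal_part_def
  proof (rule the_equality)
    have "T (w - ?pr w) \<bullet> T v = 0" if "v \<in> L" for v
    proof -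
      have ex: "T a \<bullet> T v = (\<Sum>b\<in>B. (T v \<bullet> T b) * (T a \<bullet> T b))" for a
      proof -
        have "T a \<bullet> T v = T a \<bullet> T (?pr v)" using fixed[OF that] by simp
        then show ?thesis
          by (simp only: linear_sum[OF T(1)] linear_cmul[OF T(1)] inner_sum_right inner_scaleR_right)
      qed
      have "T (?pr w) \<bullet> T v = T w \<bullet> T v"
        unfolding ex[of "?pr w"] ex[of w] by (intro sum.cong refl) (simp only: prb)
      then show ?thesis by (simp only: linear_diff[OF T(1)] inner_diff_left diff_self)
    qed
    note perp = this
    show "w - (w - ?pr w) \<in> L \<and> (\<forall>v\<in>L. g y (w - ?pr w) v = 0)"
      using prL perp by (simp add: gT)
    fix u assume u: "w - u \<in> L \<and> (\<forall>v\<in>L. g y u v = 0)"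
    define d where "d = (w - ?pr w) - u"
    have "d \<in> L"
      using subspace_diff[OF L _ prL[of w], of "w - u"] u by (simp add: d_def algebra_simps)
    then have d0: "T (w - ?pr w) \<bullet> T d = 0" "T u \<bullet> T d = 0"
      using u perp gT by auto
    have "T d = T (w - ?pr w) - T u"
      unfolding d_def by (rule linear_diff[OF T(1)])
    then have "T d \<bullet> T d = (T (w - ?pr w) - T u) \<bullet> T d" by (rule arg_cong)
    then have "T d \<bullet> T d = 0" by (simp only: inner_diff_left d0 diff_self)
    then have "T d = T 0" by (simp add: linear_0[OF T(1)])
    then have "d = 0" using T(2) by (simp add: inj_eq)
    then show "u = w - ?pr w" by (simp add: d_def)
  qed
  let ?\<Gamma> = "\<lambda>e. christoffel g y e e"
  have sff: "second_fundamental_form g L y e e = ?\<Gamma> e - ?pr (?\<Gamma> e)" for e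
    by (simp add: second_fundamental_form_def cov_deriv_def normal)
  \<comment> \<open>The mean curvature is \<open>W\<close> minus its projection to \<open>L\<close>,
    so it remains to show that \<open>W\<close> lies in \<open>L\<close>, that is, in the kernel of
    both differentials.\<close>
  define W where "W = (\<Sum>e\<in>B. ?\<Gamma> e)"
  have pr_sum: "(\<Sum>e\<in>B. ?pr (?\<Gamma> e)) = ?pr W"
    unfolding W_def linear_sum[OF T(1)] inner_sum_left scaleR_sum_left by (rule sum.swap)
  have mc: "mean_curvature g L y = W - ?pr W"
    unfolding mean_curvature_def B_def[symmetric] sff sum_subtractf pr_sum W_def ..
  have DG: "D y (?\<Gamma> e) = D2 y e e - 4 *\<^sub>R (x ** (T e ** T e) ** transpose x)" for e
    using christoffel_eq[OF y(1) x T] by (simp add: matrix_mul_assoc)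
  have TT: "b \<bullet> ((T e ** T e) *v c) = (T e *v b) \<bullet> (T e *v c)" for b c e
    by (simp add: matrix_vector_mul_assoc[symmetric] dot_matrix_mult[of b "T e"] p_space_transpose[OF Tp])
  have hs: "(\<Sum>e\<in>B. (T e *v ?u) \<bullet> (T e *v ?u)) = (\<Sum>e\<in>B. (T e *v ?w) \<bullet> (T e *v ?w))"
    "(\<Sum>e\<in>B. (T e *v ?u) \<bullet> (T e *v ?w)) = 0"
    using harmonic_sum[OF TB] by (simp_all only: sum.reindex[OF injB] o_def)
  \<comment> \<open>By \<open>D2_on_L\<close> the second derivative of \<open>S\<close> contributes
    nothing, and what is left of each Christoffel term is a summand of
    \<open>harmonic_sum\<close>.\<close>
  have "F1 (D y W) = (\<Sum>e\<in>B. F1 (D y (?\<Gamma> e)))"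
    unfolding W_def by (simp add: linear_sum[OF linear_D[OF y(1)]] linear_sum[OF linear_locus(1)])
  also have "\<dots> = (\<Sum>e\<in>B. - 4 * ((T e *v ?u) \<bullet> (T e *v ?u) - (T e *v ?w) \<bullet> (T e *v ?w)))"
    using D2_on_L[OF y BL]
    by (intro sum.cong refl) (simp add: DG linear_diff[OF linear_locus(1)] linear_cmul[OF linear_locus(1)] locus_conj TT)
  also have "\<dots> = 0"
    using hs(1) unfolding sum_distrib_left[symmetric] sum_subtractf by simp
  finally have 1: "F1 (D y W) = 0" .
  have "F2 (D y W) = (\<Sum>e\<in>B. F2 (D y (?\<Gamma> e)))"
    unfolding W_def by (simp add: linear_sum[OF linear_D[OF y(1)]] linear_sum[OF linear_locus(2)])
  also have "\<dots> = (\<Sum>e\<in>B. - 4 * ((T e *v ?u) \<bullet> (T e *v ?w)))"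
    using D2_on_L[OF y BL]
    by (intro sum.cong refl) (simp add: DG linear_diff[OF linear_locus(2)] linear_cmul[OF linear_locus(2)] locus_conj TT)
  also have "\<dots> = 0"
    using hs(2) unfolding sum_distrib_left[symmetric] by simp
  finally have 2: "F2 (D y W) = 0" .
  have "W \<in> L" unfolding L_eq_kernel[OF y] using 1 2 by blast
  then show ?thesis unfolding mc by (simp add: fixed)
qed

end

section \<open>Transitivity of the symplectic group on pairs of vectors\<close>

text \<open>The symplectic transvection along b = q - p, which adds a multiple of \<open>b\<close>
  proportional to the symplectic product with \<open>b\<close>. The coefficient \<open>c\<close> is
  normalized by p^t J b = p^t J q, so that exactly \<open>b\<close> is added to
  \<open>p\<close>.\<close>

lemma transvection:
  fixes p q :: "real^('n::finite + 'n)"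
  assumes "p \<bullet> (J *v q) \<noteq> 0"
  obtains h where "h \<in> Sp_group" "h *v p = q" "\<And>u. u \<bullet> (J *v (q - p)) = 0 \<Longrightarrow> h *v u = u"
proof -
  define b where "b = q - p"
  define c where "c = 1 / (p \<bullet> (J *v q))"
  define h where "h = mat 1 + c *\<^sub>R tensor b (J *v b)"
  have Jb: "(J *v b) \<bullet> b = 0" using dot_J_self[of b] by (simp add: inner_commute)
  have z: "tensor (0 :: real^('n + 'n)) b = 0" by (simp add: tensor_def vec_eq_iff)
  have tt: "tensor b (J *v b) ** (J ** tensor (J *v b) b) = 0"
  proof -
    have "tensor b (J *v b) ** (J ** tensor (J *v b) b) = tensor b (J *v b) ** tensor (- b) b"
      by (simp add: matrix_mult_tensor J_J_vec)
    also have "\<dots> = tensor (tensor b (J *v b) *v (- b)) b" by (rule matrix_mult_tensor)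
    also have "\<dots> = 0" by (simp add: tensor_mult_vec Jb z)
    finally show ?thesis .
  qed
  have tt': "tensor b b ** tensor (J *v b) b = 0"
    by (simp add: matrix_mult_tensor tensor_mult_vec dot_J_self z)
  have 1: "tensor b (J *v b) ** J = tensor b b"
    by (simp add: tensor_mult_matrix transpose_J matrix_vector_mult_minus_left J_J_vec)
  have 2: "J ** tensor (J *v b) b = - tensor b b"
    by (simp add: matrix_mult_tensor J_J_vec) (simp add: tensor_def vec_eq_iff)
  have "h ** J ** transpose h = J"
    by (simp add: h_def matrix_expand transpose_tensor tt tt' 1 2)
  then have "h \<in> Sp_group" by (simp add: Sp_group_iff)
  moreover have hv: "h *v u = u + (c * (u \<bullet> (J *v b))) *\<^sub>R b" for u
    by (simp add: h_def matrix_vector_mult_add_rdistrib matrix_vector_mult_scaleR_left tensor_mult_vec inner_commute)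
  moreover have "h *v p = q"
    using assms by (simp add: hv b_def matrix_vector_mult_diff_distrib inner_diff_right dot_J_self c_def)
  moreover have "h *v u = u" if "u \<bullet> (J *v (q - p)) = 0" for u
    using that by (simp add: hv b_def)
  ultimately show thesis by (intro that[of h])
qed

text \<open>Each of the two affine functions of \<open>s\<close> has at most one zero, so one of the
  values 0, 1, 2 avoids both.\<close>

lemma avoid_two_zeros:
  fixes a b c d :: real
  assumes "a \<noteq> 0 \<or> b \<noteq> 0" "c \<noteq> 0 \<or> d \<noteq> 0"
  obtains s where "a + s * b \<noteq> 0" "c + s * d \<noteq> 0"
proof (rule ccontr)
  assume "\<not> thesis"
  then have n: "a + s * b = 0 \<or> c + s * d = 0" for s using that by blast
  have "a = 0 \<or> c = 0" "a + b = 0 \<or> c + d = 0" "a + 2 * b = 0 \<or> c + 2 * d = 0"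
    using n[of 0] n[of 1] n[of 2] by simp_all
  then show False using assms by (elim disjE) linarith+
qed

text \<open>A transvection needs a nonzero symplectic product. An intermediate vector
  \<open>r\<close> in the span of \<open>J *v p\<close> and \<open>J *v q\<close> has nonzero
  product with both \<open>p\<close> and \<open>q\<close>, and two transvections are
  composed.\<close>

lemma Sp_transitive:
  fixes p q :: "real^('n::finite + 'n)"
  assumes "p \<noteq> 0" "q \<noteq> 0"
  obtains h where "h \<in> Sp_group" "h *v p = q"
proof -
  have "p \<bullet> p \<noteq> 0" "q \<bullet> q \<noteq> 0" using assms by simp_all
  then obtain s where s: "- (p \<bullet> p) + s * - (p \<bullet> q) \<noteq> 0" "p \<bullet> q + s * (q \<bullet> q) \<noteq> 0"
    using avoid_two_zeros[of "- (p \<bullet> p)" "- (p \<bullet> q)" "p \<bullet> q" "q \<bullet> q"] by auto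
  define r where "r = J *v p + s *\<^sub>R (J *v q)"
  have "p \<bullet> (J *v r) \<noteq> 0"
    using s(1) by (simp add: r_def matrix_vector_right_distrib matrix_vector_mult_scaleR J_J_vec inner_add_right
        inner_diff_right)
  then obtain h1 where h1: "h1 \<in> Sp_group" "h1 *v p = r" using transvection by blast
  have "r \<bullet> (J *v q) \<noteq> 0"
    using s(2) by (simp add: r_def inner_add_left dot_J_J)
  then obtain h2 where h2: "h2 \<in> Sp_group" "h2 *v r = q" using transvection by blast
  show thesis
    using h1 h2 Sp_mult by (intro that[of "h2 ** h1"]) (auto simp: matrix_vector_mul_assoc[symmetric])
qed

lemma orthogonal_component:
  fixes p u :: "'v::real_inner"
  assumes "u \<noteq> 0" "\<And>s. p \<noteq> s *\<^sub>R u"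
  obtains p' where "u \<bullet> p' = 0" "p \<bullet> p' \<noteq> 0"
proof
  let ?p = "p - ((p \<bullet> u) / (u \<bullet> u)) *\<^sub>R u"
  show u: "u \<bullet> ?p = 0" using assms(1) by (simp add: inner_diff_right inner_commute)
  have "p \<bullet> ?p = ?p \<bullet> ?p"
    using u by (simp add: inner_diff_left)
  moreover have "?p \<noteq> 0" using assms(2) by simp
  ultimately show "p \<bullet> ?p \<noteq> 0" by simp
qed

text \<open>The hypothesis \<open>eq\<close> says that \<open>u\<close> is symplectically orthogonal
  to q - p, so the transvection fixes \<open>u\<close>. When p^t J q vanishes, a detour through r =
  p + d is taken, where J d must be orthogonal to \<open>u\<close>; the independence hypotheses
  provide vectors \<open>p'\<close> and \<open>q'\<close> orthogonal to \<open>u\<close> from which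
  such a \<open>d\<close> is built.\<close>

lemma Sp_transitive_stabilizer:
  fixes u p q :: "real^('n::finite + 'n)"
  assumes u: "u \<noteq> 0" and p: "\<And>s. p \<noteq> s *\<^sub>R u" and q: "\<And>s. q \<noteq> s *\<^sub>R u"
    and eq: "u \<bullet> (J *v p) = u \<bullet> (J *v q)"
  obtains h where "h \<in> Sp_group" "h *v u = u" "h *v p = q"
proof (cases "p \<bullet> (J *v q) = 0")
  case False
  have "u \<bullet> (J *v (q - p)) = 0" using eq by (simp add: matrix_vector_mult_diff_distrib inner_diff_right)
  then show thesis using transvection[OF False] that by blast
next
  case True
  obtain p' where p': "u \<bullet> p' = 0" "p \<bullet> p' \<noteq> 0" using orthogonal_component[OF u p] by blast
  obtain q' where q': "u \<bullet> q' = 0" "q \<bullet> q' \<noteq> 0" using orthogonal_component[OF u q] by blast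
  obtain s where s: "- (p \<bullet> p') + s * - (p \<bullet> q') \<noteq> 0" "p' \<bullet> q + s * (q' \<bullet> q) \<noteq> 0"
    using avoid_two_zeros[of "- (p \<bullet> p')" "- (p \<bullet> q')" "p' \<bullet> q" "q' \<bullet> q"] p'(2) q'(2)
    by (auto simp: inner_commute)
  define d where "d = J *v p' + s *\<^sub>R (J *v q')"
  have Jd: "J *v d = - p' - s *\<^sub>R q'"
    by (simp add: d_def matrix_vector_right_distrib matrix_vector_mult_scaleR J_J_vec)
  define r where "r = p + d"
  have "p \<bullet> (J *v r) \<noteq> 0"
    using s(1) by (simp add: r_def matrix_vector_right_distrib inner_add_right dot_J_self Jd inner_diff_right)
  moreover have ur: "u \<bullet> (J *v (r - p)) = 0"
    by (simp add: r_def Jd inner_diff_right p'(1) q'(1))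
  ultimately obtain h1 where h1: "h1 \<in> Sp_group" "h1 *v p = r" "h1 *v u = u"
    using transvection by metis
  have "r \<bullet> (J *v q) \<noteq> 0"
    using s(2) True by (simp add: r_def d_def inner_add_left dot_J_J)
  moreover have "u \<bullet> (J *v (q - r)) = 0"
    using ur eq by (simp add: matrix_vector_mult_diff_distrib inner_diff_right)
  ultimately obtain h2 where h2: "h2 \<in> Sp_group" "h2 *v r = q" "h2 *v u = u"
    using transvection by metis
  show thesis
    using h1 h2 Sp_mult by (intro that[of "h2 ** h1"]) (auto simp: matrix_vector_mul_assoc[symmetric])
qed

section \<open>Nonemptiness of the zero locus\<close>

lemma isotropic_target:
  fixes c :: real
  assumes "CARD('n) \<ge> 2"
  obtains u v :: "real^('n::finite + 'n)" where "u \<bullet> u = v \<bullet> v" "u \<bullet> v = 0" "u \<noteq> 0" "u \<bullet> (J *v v) = c"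
proof -
  obtain i j :: 'n where ij: "i \<noteq> j"
  proof -
    have "\<not> card (UNIV :: 'n set) \<le> Suc 0" using assms by simp
    then show thesis using that by (meson card_le_Suc0_iff_eq finite)
  qed
  define e f :: "real^('n + 'n)" where "e = axis (Inl i) 1" and "f = axis (Inl j) 1"
  have ef: "e \<bullet> e = 1" "f \<bullet> f = 1" "e \<bullet> f = 0"
    using ij by (simp_all add: e_def f_def inner_axis_axis)
  have "J $ Inl i $ Inl j = 0" by (simp add: symplectic_J_def block_def)
  then have eJf: "e \<bullet> (J *v f) = 0"
    by (simp add: e_def f_def inner_axis' matrix_vector_mult_basis column_def)
  \<comment> \<open>The vectors will be k e and a combination of J e and f. The component along J e
    realizes the value \<open>c\<close>, and f, which is orthogonal to e and J e, fills up the
    length. The choice k^2 = |c| + 1 keeps \<open>k\<close> positive and makes c^2 / k^2 at most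
    k^2, so that the square root in \<open>\<beta>\<close> is real.\<close>
  define k where "k = sqrt (\<bar>c\<bar> + 1)"
  have k: "k > 0" "k * k = \<bar>c\<bar> + 1" by (simp_all add: k_def)
  define \<beta> where "\<beta> = sqrt (k * k - (c / k) * (c / k))"
  have "(c / k) * (c / k) = c * c / (k * k)" by simp
  also have "\<dots> \<le> k * k"
    unfolding k(2) using mult_mono[of "\<bar>c\<bar>" "\<bar>c\<bar> + 1" "\<bar>c\<bar>" "\<bar>c\<bar> + 1"]
    by (simp add: divide_le_eq)
  finally have \<beta>: "\<beta> * \<beta> = k * k - (c / k) * (c / k)" by (simp add: \<beta>_def)
  define v where "v = (- c / k) *\<^sub>R (J *v e) + \<beta> *\<^sub>R f"
  have Jef: "(J *v e) \<bullet> f = 0" using eJf dot_J[of e f] by simp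
  have "v \<bullet> v = k * k"
    using \<beta> by (simp add: v_def inner_diff_left inner_diff_right dot_J_J ef Jef inner_commute[of f "J *v e"])
  moreover have "(k *\<^sub>R e) \<bullet> v = 0"
    by (simp add: v_def inner_diff_right dot_J_self ef)
  moreover have "(k *\<^sub>R e) \<bullet> (J *v v) = c"
    using k by (simp add: v_def matrix_vector_mult_diff_distrib matrix_vector_mult_scaleR J_J_vec inner_diff_right inner_add_right eJf ef)
  moreover have "k *\<^sub>R e \<noteq> 0" using k ef(1) by auto
  ultimately show thesis using that[of "k *\<^sub>R e" v] ef by simp
qed

lemma Sp_preserves_J: "h \<in> Sp_group \<Longrightarrow> (h *v x) \<bullet> (J *v (h *v y)) = x \<bullet> (J *v y)"
  using Sp_transpose_mult[of h]
  by (simp add: inner_commute[of "h *v x"] dot_matrix_mult[of _ h] matrix_vector_mul_assoc matrix_mul_assoc)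
    (simp add: inner_commute)

text \<open>One symplectic matrix moves \<open>a1\<close> to \<open>u\<close>, and a second one that
  fixes \<open>u\<close> moves the image of \<open>a2\<close> to \<open>v\<close>. The second exists
  because symplectic matrices preserve a1^t J a2 and the target pair was built with this
  value.\<close>

theorem zero_locus_nonempty:
  fixes a1 a2 :: "real^('n::finite + 'n)"
  assumes card: "CARD('n) \<ge> 2" and a1: "a1 \<noteq> 0" and a2: "\<And>s. a2 \<noteq> s *\<^sub>R a1"
  shows "zero_locus a1 a2 \<noteq> {}"
proof -
  obtain u v :: "real^('n + 'n)" where uv: "u \<bullet> u = v \<bullet> v" "u \<bullet> v = 0" "u \<noteq> 0"
    "u \<bullet> (J *v v) = a1 \<bullet> (J *v a2)"
    using isotropic_target[OF card, of "a1 \<bullet> (J *v a2)"] by blast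
  obtain h1 where h1: "h1 \<in> Sp_group" "h1 *v a1 = u" using Sp_transitive[OF a1 uv(3)] by blast
  have inj: "x = y" if "h1 *v x = h1 *v y" for x y
  proof -
    have "matrix_inv h1 *v (h1 *v x) = matrix_inv h1 *v (h1 *v y)" using that by simp
    then show ?thesis by (simp add: matrix_vector_mul_assoc Sp_inv[OF h1(1)])
  qed
  have 1: "h1 *v a2 \<noteq> s *\<^sub>R u" for s
  proof
    assume "h1 *v a2 = s *\<^sub>R u"
    then have "h1 *v a2 = h1 *v (s *\<^sub>R a1)" by (simp add: h1(2) matrix_vector_mult_scaleR)
    then show False using inj a2 by blast
  qed
  have 2: "v \<noteq> s *\<^sub>R u" for s
  proof
    assume v: "v = s *\<^sub>R u"
    then have "s * (u \<bullet> u) = 0" using uv(2) by simp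
    then have "s = 0" using uv(3) by simp
    then have "v = 0" using v by simp
    then show False using uv(1,3) by simp
  qed
  have "u \<bullet> (J *v (h1 *v a2)) = u \<bullet> (J *v v)"
    using Sp_preserves_J[OF h1(1), of a1 a2] h1(2) uv(4) by simp
  then obtain h2 where h2: "h2 \<in> Sp_group" "h2 *v u = u" "h2 *v (h1 *v a2) = v"
    using Sp_transitive_stabilizer[OF uv(3) 1 2] by blast
  \<comment> \<open>The transpose appears because the equations at the coset of \<open>x\<close>
    concern the vectors x^t a1 and x^t a2.\<close>
  define x where "x = transpose (h2 ** h1)"
  have x: "x \<in> Sp_group" unfolding x_def using h1 h2 by (intro Sp_transpose Sp_mult)
  have xa: "transpose x *v a1 = u" "transpose x *v a2 = v"
    using h1 h2 by (simp_all add: x_def matrix_vector_mul_assoc[symmetric])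
  have "locus_re a1 a2 (x ** mat 1 ** transpose x) = 0" "locus_im a1 a2 (x ** mat 1 ** transpose x) = 0"
    unfolding locus_conj xa using uv by simp_all
  then have "coset U_group x \<in> zero_locus a1 a2"
    using x by (simp add: zero_locus_def gram_coset)
  then show ?thesis by blast
qed

section \<open>Completeness\<close>

lemma inner_mult_vec_le: "\<bar>w \<bullet> (X *v w)\<bar> \<le> norm X * (w \<bullet> w)" for X :: "real^'m^'m"
proof -
  have "norm (tensor w w) = w \<bullet> w"
    by (simp add: norm_eq_sqrt_inner inner_tensor tensor_mult_vec)
  then show ?thesis
    using Cauchy_Schwarz_ineq2[of X "tensor w w"] by (simp add: inner_tensor)
qed

lemma gram_pos:
  assumes "C \<in> coset U_group ` Sp_group" "b \<noteq> 0"
  shows "b \<bullet> (gram C *v b) > 0"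
proof -
  obtain x where x: "x \<in> Sp_group" "C = coset U_group x" using assms by blast
  have "transpose x *v b \<noteq> 0"
  proof
    assume "transpose x *v b = 0"
    then have "matrix_inv (transpose x) *v (transpose x *v b) = 0" by simp
    then show False using assms(2) by (simp add: matrix_vector_mul_assoc Sp_inv Sp_transpose x)
  qed
  then show ?thesis
    by (simp add: x gram_coset matrix_vector_mul_assoc[symmetric] dot_matrix_mult[of b x])
qed

context sp_chart
begin

text \<open>With w = x^t b and X the horizontal velocity, the derivative of b^t S b is 2 w^t X w,
  and the norm of X is the speed. This is where the Lipschitz constant 2 of the logarithm comes
  from.\<close>

lemma speed_bound:
  assumes "y \<in> \<phi> ` U"
  shows "\<bar>b \<bullet> (D y v *v b)\<bar> \<le> 2 * sqrt (bform (D y v) (D y v)) * (b \<bullet> (S y *v b))"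
proof (rule frame[OF assms])
  fix x :: "real^('n + 'n)^('n + 'n)" and T :: "'e \<Rightarrow> real^('n + 'n)^('n + 'n)"
  assume x: "x \<in> Sp_group" "coset U_group x \<in> U" "\<phi> (coset U_group x) = y"
    and T: "range T = p_space" "\<And>v. D y v = 2 *\<^sub>R (x ** T v ** transpose x)"
  let ?w = "transpose x *v b"
  have Tp: "T v \<in> p_space" using T(1) by blast
  have "sqrt (bform (D y v) (D y v)) = norm (T v)"
    by (simp add: T(2) bform_conj[OF x(1) Tp Tp] norm_eq_sqrt_inner)
  moreover have "b \<bullet> (D y v *v b) = 2 * (?w \<bullet> (T v *v ?w))"
    by (simp add: T(2) matrix_vector_mult_scaleR_left matrix_vector_mul_assoc[symmetric] dot_matrix_mult[of b x])
  moreover have "b \<bullet> (S y *v b) = ?w \<bullet> ?w"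
    using S_coset[OF x(2)] x(3) by (simp add: matrix_vector_mul_assoc[symmetric] dot_matrix_mult[of b x])
  ultimately show ?thesis
    using inner_mult_vec_le[of ?w "T v"] by (simp add: abs_mult)
qed

lemma D_expand: "y \<in> \<phi> ` U \<Longrightarrow> D y v = (\<Sum>i\<in>Basis. (v \<bullet> i) *\<^sub>R D y i)"
  by (subst euclidean_representation[of v, symmetric])
    (simp only: linear_sum[OF linear_D] linear_cmul[OF linear_D])

lemma continuous_on_D:
  assumes "continuous_on A z" "continuous_on A v" "z ` A \<subseteq> \<phi> ` U"
  shows "continuous_on A (\<lambda>t. D (z t) (v t))"
proof -
  have "continuous_on A (\<lambda>t. \<Sum>i\<in>Basis. (v t \<bullet> i) *\<^sub>R D (z t) i)"
    by (intro continuous_intros assms continuous_on_compose2[OF smooth_on_continuous[OF smooth_D] assms(1) assms(3)])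
  then show ?thesis
    by (rule continuous_on_eq) (use assms(3) D_expand in \<open>simp add: image_subset_iff\<close>)
qed

end

text \<open>Half the logarithm of b^t S b changes at most at the speed of the curve, by
  \<open>speed_bound\<close>. Integration takes some care because near a break point the speed may
  be unbounded and the length infinite.\<close>

lemma curve_length_lower_bound:
  fixes \<gamma> :: "real \<Rightarrow> (real^('n::finite + 'n)^('n + 'n)) set"
  assumes \<gamma>: "piecewise_C1_curve Sp_mod_U N \<gamma>" and b: "b \<noteq> 0"
  shows "ennreal \<bar>(ln (b \<bullet> (gram (\<gamma> 1) *v b)) - ln (b \<bullet> (gram (\<gamma> 0) *v b))) / 2\<bar> \<le> curve_length Sp_mod_U \<gamma>"
proof -
  let ?M = "coset U_group ` (Sp_group :: (real^('n + 'n)^('n + 'n)) set)"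
  interpret sp_chart ?M psi by unfold_locales (rule global_chart)
  have M: "\<gamma> t \<in> ?M" if "t \<in> {0..1}" for t
  proof -
    have "\<gamma> ` {0..1} \<subseteq> topspace (mtop Sp_mod_U)"
      using \<gamma> continuous_map_image_subset_topspace[of "top_of_set {0..1}" "mtop Sp_mod_U" \<gamma>]
      by (simp add: piecewise_C1_curve_def)
    then show ?thesis
      using that by (auto simp: Sp_mod_U_def coset_space_def topspace_quotient_topology)
  qed
  have "(psi \<circ> \<gamma>) piecewise_C1_differentiable_on {0..1}"
  proof -
    have "(?M, psi) \<in> atlas (Sp_mod_U :: (_, real^('n \<times> 'n option)) riemannian)"
      by (simp add: Sp_mod_U_def coset_space_def global_chart)
    moreover have "\<gamma> ` {0..1} \<subseteq> ?M" using M by blast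
    ultimately show ?thesis
      using \<gamma> unfolding piecewise_C1_curve_def by (metis fst_conv snd_conv order_refl zero_le_one)
  qed
  then obtain F where F: "finite F" "(psi \<circ> \<gamma>) C1_differentiable_on ({0..1} - F)"
    and cont: "continuous_on {0..1} (psi \<circ> \<gamma>)"
    by (auto simp: piecewise_C1_differentiable_on_def)
  from F(2) obtain z' where z': "\<forall>t\<in>{0..1} - F. ((psi \<circ> \<gamma>) has_vector_derivative z' t) (at t)"
    "continuous_on ({0..1} - F) z'"
    unfolding C1_differentiable_on_def by blast
  define A where "A = {0<..<1} - F"
  have A: "open A" "A \<subseteq> {0..1} - F" "A \<subseteq> {0..1}"
    using F(1) by (auto simp: A_def finite_imp_closed open_Diff)
  define h where "h t = b \<bullet> (gram (\<gamma> t) *v b)" for t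
  define V where "V t = D (psi (\<gamma> t)) (z' t)" for t
  \<comment> \<open>Cut off outside the open set \<open>A\<close>, on which the velocity is
    continuous; this makes \<open>K\<close> Borel measurable on the whole line.\<close>
  define K where "K t = indicator A t *\<^sub>R (b \<bullet> (V t *v b) / (2 * h t))" for t
  have im: "psi (\<gamma> t) \<in> psi ` ?M" if "t \<in> {0..1}" for t using M[OF that] by blast
  have hS: "h t = b \<bullet> (S (psi (\<gamma> t)) *v b)" if "t \<in> {0..1}" for t
    using S_chart[OF M[OF that]] by (simp add: h_def)
  have hpos: "h t > 0" if "t \<in> {0..1}" for t
    unfolding h_def by (rule gram_pos[OF M[OF that] b])
  have hne: "h t \<noteq> 0" if "t \<in> {0..1}" for t
    using hpos[OF that] by simp
  have lin: "linear (\<lambda>M. b \<bullet> (M *v b))"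
    by (rule linearI) (simp_all add: matrix_vector_mult_add_rdistrib inner_add_right matrix_vector_mult_scaleR_left)
  have contS: "continuous_on {0..1} (\<lambda>t. S (psi (\<gamma> t)))"
    using continuous_on_compose2[OF smooth_on_continuous[OF smooth_S] cont] im by (auto simp: image_subset_iff)
  have "continuous_on {0..1} (\<lambda>t. b \<bullet> (S (psi (\<gamma> t)) *v b))"
    by (rule bounded_linear.continuous_on[OF lin[unfolded linear_conv_bounded_linear] contS])
  then have conth: "continuous_on {0..1} h"
    by (rule continuous_on_eq) (simp add: hS)
  have contk: "continuous_on {0..1} (\<lambda>t. ln (h t) / 2)"
    by (intro continuous_on_divide continuous_on_ln conth continuous_on_const ballI) (use hne in simp_all)
  have der: "((\<lambda>t. ln (h t) / 2) has_vector_derivative K t) (at t)" if t: "t \<in> A" for t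
  proof -
    have t01: "t \<in> {0..1}" using t A by blast
    have z: "((\<lambda>t. psi (\<gamma> t)) has_derivative (\<lambda>s. s *\<^sub>R z' t)) (at t)"
      using z'(1) t A(2) by (auto simp: has_vector_derivative_def o_def)
    have "((\<lambda>t. S (psi (\<gamma> t))) has_derivative (\<lambda>s. D (psi (\<gamma> t)) (s *\<^sub>R z' t))) (at t)"
      by (rule has_derivative_compose[OF z has_derivative_S[OF im[OF t01]]])
    then have "((\<lambda>t. S (psi (\<gamma> t))) has_vector_derivative V t) (at t)"
      by (simp add: has_vector_derivative_def V_def linear_cmul[OF linear_D[OF im[OF t01]]])
    from bounded_linear.has_vector_derivative[OF lin[unfolded linear_conv_bounded_linear] this]
    have "(h has_vector_derivative b \<bullet> (V t *v b)) (at t)"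
      by (rule has_vector_derivative_transform_within_open[OF _ A(1) t]) (use hS A(3) in auto)
    then have "(h has_real_derivative b \<bullet> (V t *v b)) (at t)"
      by (simp add: has_real_derivative_iff_has_vector_derivative)
    then have "((\<lambda>t. ln (h t) / 2) has_real_derivative (b \<bullet> (V t *v b)) / h t / 2) (at t)"
      using hpos[OF t01] by (auto intro!: derivative_eq_intros)
    then show ?thesis
      using t by (simp add: has_real_derivative_iff_has_vector_derivative K_def mult.commute)
  qed
  \<comment> \<open>The gauge integral tolerates the finite exceptional set without any bound on
    \<open>K\<close>.\<close>
  have int: "(K has_integral (ln (h 1) / 2 - ln (h 0) / 2)) {0..1}"
    by (rule fundamental_theorem_of_calculus_interior_strong[OF F(1) _ _ contk]) (use der in \<open>auto simp: A_def\<close>)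
  have bound: "\<bar>K t\<bar> \<le> curve_speed Sp_mod_U \<gamma> t" if t: "t \<in> A" for t
  proof -
    have t01: "t \<in> {0..1}" using t A by blast
    have z: "((\<lambda>t. psi (\<gamma> t)) has_vector_derivative z' t) (at t)"
      using z'(1) t A(2) by (auto simp: o_def)
    have "curve_speed Sp_mod_U \<gamma> t = sqrt (bform (V t) (V t))"
      unfolding Sp_mod_U_def V_def
      by (rule speed_in_chart[OF A(1) t _ z]) (use M A(3) in blast)
    moreover have "\<bar>b \<bullet> (V t *v b)\<bar> \<le> 2 * sqrt (bform (V t) (V t)) * h t"
      unfolding V_def hS[OF t01] by (rule speed_bound[OF im[OF t01]])
    ultimately show ?thesis
      using hpos[OF t01] t by (simp add: K_def divide_le_eq mult_ac)
  qed
  have "continuous_on A (\<lambda>t. b \<bullet> (V t *v b))"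
    unfolding V_def
    by (intro bounded_linear.continuous_on[OF lin[unfolded linear_conv_bounded_linear]] continuous_on_D)
      (use cont z'(2) A im in \<open>auto simp: o_def image_subset_iff intro: continuous_on_subset\<close>)
  then have "continuous_on A (\<lambda>t. b \<bullet> (V t *v b) / (2 * h t))"
    by (intro continuous_on_divide continuous_on_mult continuous_on_const
        continuous_on_subset[OF conth A(3)] ballI) (use hne A(3) in auto)
  then have meas: "K \<in> borel_measurable borel"
    unfolding K_def using A(1) by (intro borel_measurable_continuous_on_indicator) auto
  have K0: "K t = 0" if "t \<notin> {0..1}" for t using that A(3) by (auto simp: K_def indicator_def)
  define I where "I = (\<integral>\<^sup>+ t. ennreal (norm (K t)) \<partial>lborel)"
  have I: "I \<le> curve_length Sp_mod_U \<gamma>"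
    unfolding I_def curve_length_def
  proof (rule nn_integral_mono)
    fix t :: real
    show "ennreal (norm (K t)) \<le> ennreal (curve_speed Sp_mod_U \<gamma> t) * indicator {0..1} t"
    proof (cases "t \<in> A")
      case True
      then show ?thesis using bound[OF True] A(3) by (auto simp: indicator_def intro: ennreal_leI)
    next
      case False
      then show ?thesis by (simp add: K_def)
    qed
  qed
  have "ennreal \<bar>ln (h 1) / 2 - ln (h 0) / 2\<bar> \<le> I"
  \<comment> \<open>If \<open>I\<close> is finite, then \<open>K\<close> is Lebesgue integrable and
    its two integrals agree; if \<open>I\<close> is infinite, the inequality is trivial.\<close>
  proof (cases "I < \<infinity>")
    case True
    then have i: "integrable lborel K"
      using meas unfolding I_def by (intro integrableI_bounded) auto
    have "(K has_integral (ln (h 1) / 2 - ln (h 0) / 2)) UNIV"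
      by (rule has_integral_on_superset[OF int]) (use K0 in auto)
    then have "ln (h 1) / 2 - ln (h 0) / 2 = integral\<^sup>L lborel K"
      using has_integral_integral_lborel[OF i] has_integral_unique by blast
    then show ?thesis
      using integral_norm_bound_ennreal[OF i] by (simp add: I_def)
  next
    case False
    then have "I = \<infinity>" by (simp add: less_top[symmetric])
    then show ?thesis by simp
  qed
  also note I
  finally show ?thesis by (simp add: h_def diff_divide_distrib)
qed

lemma induced_dist_lower_bound:
  fixes p q :: "(real^('n::finite + 'n)^('n + 'n)) set"
  assumes "b \<noteq> 0"
  shows "ennreal \<bar>(ln (b \<bullet> (gram q *v b)) - ln (b \<bullet> (gram p *v b))) / 2\<bar> \<le> induced_dist Sp_mod_U N p q"
  unfolding induced_dist_def
  using curve_length_lower_bound[OF _ assms] by (intro INF_greatest) auto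

section \<open>Upper bound for the induced distance near a point of the locus\<close>

context slice
begin

text \<open>The metric is compared with the Euclidean norm of the coordinates, uniformly on compact
  sets, so that short coordinate segments have small length.\<close>

lemma D_bound:
  assumes "compact Q" "Q \<subseteq> \<phi> ` U"
  obtains C where "C \<ge> 0" "\<And>z v. z \<in> Q \<Longrightarrow> sqrt (bform (D z v) (D z v)) \<le> C * norm v"
proof -
  interpret bf: bounded_bilinear "bform :: real^('n + 'n)^('n + 'n) \<Rightarrow> _" by (rule bounded_bilinear_bform)
  obtain K where K: "K > 0" "\<And>A B :: real^('n + 'n)^('n + 'n). norm (bform A B) \<le> norm A * norm B * K"
    using bf.pos_bounded by blast
  have "continuous_on Q (\<lambda>z. \<Sum>i\<in>Basis. norm (D z i))"
    by (intro continuous_intros continuous_on_subset[OF smooth_on_continuous[OF smooth_D] assms(2)])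
  then have "bounded ((\<lambda>z. \<Sum>i\<in>Basis. norm (D z i)) ` Q)"
    using assms(1) compact_continuous_image compact_imp_bounded by blast
  then obtain B where B: "\<And>z. z \<in> Q \<Longrightarrow> norm (\<Sum>i\<in>Basis. norm (D z i)) \<le> B"
    by (auto simp: bounded_iff)
  have "sqrt (bform (D z v) (D z v)) \<le> (\<bar>B\<bar> * sqrt K) * norm v" if z: "z \<in> Q" for z v
  proof -
    have "D z v = (\<Sum>i\<in>Basis. (v \<bullet> i) *\<^sub>R D z i)"
      using z assms(2) by (intro D_expand) blast
    then have "norm (D z v) = norm (\<Sum>i\<in>Basis. (v \<bullet> i) *\<^sub>R D z i)" by (rule arg_cong)
    also have "\<dots> \<le> (\<Sum>i\<in>Basis. norm ((v \<bullet> i) *\<^sub>R D z i))" by (rule norm_sum)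
    also have "\<dots> \<le> (\<Sum>i\<in>Basis. norm v * norm (D z i))"
      by (intro sum_mono) (auto intro!: mult_right_mono Basis_le_norm)
    also have "\<dots> \<le> norm v * \<bar>B\<bar>"
      using B[OF z] by (simp add: sum_distrib_left[symmetric] mult_left_mono)
    finally have n: "norm (D z v) \<le> norm v * \<bar>B\<bar>" .
    have "bform (D z v) (D z v) \<le> norm (D z v) * norm (D z v) * K"
      using K(2)[of "D z v" "D z v"] by simp
    then have "sqrt (bform (D z v) (D z v)) \<le> sqrt (norm (D z v) * norm (D z v) * K)"
      by (rule real_sqrt_le_mono)
    also have "\<dots> = norm (D z v) * sqrt K" by (simp add: real_sqrt_mult)
    also have "\<dots> \<le> (norm v * \<bar>B\<bar>) * sqrt K" using n K(1) by (intro mult_right_mono) auto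
    finally show ?thesis by (simp add: mult_ac)
  qed
  then show thesis using K(1) by (intro that[of "\<bar>B\<bar> * sqrt K"]) auto
qed

text \<open>The segment stays in \<open>L\<close>, hence in the locus. Piecewise differentiability
  is required in every chart that contains a piece of the curve, and is obtained there from the
  smooth transition map.\<close>

lemma segment_curve:
  assumes seg: "\<And>t. t \<in> {0..1} \<Longrightarrow> y + t *\<^sub>R v \<in> \<phi> ` U" and L': "y \<in> L" "v \<in> L"
  shows "piecewise_C1_curve (coset_space Sp_group U_group :: (_, real^'k) riemannian) Z (\<lambda>t. pt (y + t *\<^sub>R v))"
  unfolding piecewise_C1_curve_def
proof (intro conjI ballI allI impI)
  let ?l = "\<lambda>t. y + t *\<^sub>R v"
  let ?\<gamma> = "\<lambda>t. pt (?l t)"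
  have contl: "continuous_on A ?l" for A by (intro continuous_intros)
  have UM: "U \<subseteq> coset U_group ` Sp_group" using U_cosets by blast
  show "continuous_map (top_of_set {0..1}) (mtop (coset_space Sp_group U_group :: (_, real^'k) riemannian)) ?\<gamma>"
    unfolding continuous_map_alt
  proof (intro conjI)
    show "?\<gamma> \<in> topspace (top_of_set {0..1}) \<rightarrow> topspace (mtop (coset_space Sp_group U_group :: (_, real^'k) riemannian))"
      using seg pt_in UM by (auto simp: coset_space_def topspace_quotient_topology)
    show "\<forall>W. openin (mtop (coset_space Sp_group U_group :: (_, real^'k) riemannian)) W \<longrightarrow>
        openin (top_of_set {0..1}) (?\<gamma> -` W \<inter> topspace (top_of_set {0..1}))"
    proof (intro allI impI)
      fix W :: "(real^('n + 'n)^('n + 'n)) set set"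
      assume "openin (mtop (coset_space Sp_group U_group :: (_, real^'k) riemannian)) W"
      then have "open {z \<in> \<phi> ` U. pt z \<in> W}"
        by (intro open_pt_preimage) (simp add: coset_space_def)
      then have "openin (top_of_set {0..1}) ({0..1} \<inter> ?l -` {z \<in> \<phi> ` U. pt z \<in> W})"
        by (intro continuous_openin_preimage_gen contl)
      moreover have "{0..1} \<inter> ?l -` {z \<in> \<phi> ` U. pt z \<in> W} = ?\<gamma> -` W \<inter> topspace (top_of_set {0..1})"
        using seg by auto
      ultimately show "openin (top_of_set {0..1}) (?\<gamma> -` W \<inter> topspace (top_of_set {0..1}))" by simp
    qed
  qed
  show "?\<gamma> ` {0..1} \<subseteq> Z"
  proof (rule image_subsetI)
    fix t :: real assume t: "t \<in> {0..1}"
    have "?l t \<in> L" using L L' by (intro subspace_add subspace_scale)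
    then show "?\<gamma> t \<in> Z" using chart_in_Z[OF seg[OF t]] F_on_L[OF seg[OF t]] by blast
  qed
  fix c :: "(_, real^'k) chart" and s t :: real
  assume c: "c \<in> atlas (coset_space Sp_group U_group)"
    and st: "0 \<le> s \<and> s \<le> t \<and> t \<le> 1 \<and> ?\<gamma> ` {s..t} \<subseteq> fst c"
  obtain U' \<phi>' where c': "c = (U', \<phi>')" by (cases c)
  have c'': "(U', \<phi>') \<in> quotient_atlas Sp_group U_group" using c by (simp add: c' coset_space_def)
  let ?A = "{z \<in> \<phi> ` U. pt z \<in> U'}"
  let ?\<tau> = "\<lambda>z. \<phi>' (pt z)"
  note sm = transition(2)[OF c'']
  have lA: "?l r \<in> ?A" if "r \<in> {s..t}" for r
  proof -
    have "?\<gamma> r \<in> U'" using st that unfolding c' fst_conv by blast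
    then show ?thesis using seg[of r] st that by simp
  qed
  have d: "((\<lambda>r. ?\<tau> (?l r)) has_vector_derivative frechet_derivative ?\<tau> (at (?l r)) v) (at r)"
    if r: "r \<in> {s..t}" for r
  proof -
    have l: "(?l has_derivative (\<lambda>h. h *\<^sub>R v)) (at r)" by (auto intro!: derivative_eq_intros)
    note \<tau> = smooth_on_has_derivative[OF sm lA[OF r]]
    from has_derivative_compose[OF l \<tau>] show ?thesis
      by (simp add: has_vector_derivative_def linear_cmul[OF has_derivative_linear[OF \<tau>]])
  qed
  have "(\<lambda>r. ?\<tau> (?l r)) C1_differentiable_on {s..t}"
    unfolding C1_differentiable_on_def
  proof (intro exI conjI ballI)
    show "continuous_on {s..t} (\<lambda>r. frechet_derivative ?\<tau> (at (?l r)) v)"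
      by (rule continuous_on_compose2[OF smooth_on_continuous[OF smooth_on_frechet_derivative[OF sm]] contl])
        (use lA in blast)
  qed (rule d)
  then show "(snd c \<circ> ?\<gamma>) piecewise_C1_differentiable_on {s..t}"
    by (simp add: c' o_def C1_differentiable_imp_piecewise)
qed

text \<open>A closed ball in the chart image is convex and compact: the segment from
  \<open>y\<close> to \<open>y0\<close> stays inside it, and its speed is bounded by a multiple of
  its Euclidean length.\<close>

lemma induced_dist_upper_bound:
  assumes y0: "y0 \<in> \<phi> ` U" "y0 \<in> L"
  obtains r C where "r > 0" "\<And>y. y \<in> cball y0 r \<Longrightarrow> y \<in> L \<Longrightarrow>
    induced_dist (coset_space Sp_group U_group :: (_, real^'k) riemannian) Z (pt y) (pt y0) \<le> ennreal (C * norm (y0 - y))"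
proof -
  let ?M = "coset_space Sp_group U_group :: (_, real^'k) riemannian"
  obtain r where r: "r > 0" "cball y0 r \<subseteq> \<phi> ` U"
    using open_contains_cball open_image y0(1) by blast
  obtain C where C: "C \<ge> 0" "\<And>z v. z \<in> cball y0 r \<Longrightarrow> sqrt (bform (D z v) (D z v)) \<le> C * norm v"
    using D_bound[OF compact_cball r(2)] by blast
  have "induced_dist ?M Z (pt y) (pt y0) \<le> ennreal (C * norm (y0 - y))" if y: "y \<in> cball y0 r" "y \<in> L" for y
  proof -
    let ?v = "y0 - y"
    let ?l = "\<lambda>t. y + t *\<^sub>R ?v"
    have inb: "?l t \<in> cball y0 r" if "t \<in> {0..1}" for t
    proof -
      have "(1 - t) *\<^sub>R y + t *\<^sub>R y0 \<in> cball y0 r"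
        using that y(1) r(1) convex_cball[of y0 r] by (intro convexD) auto
      then show ?thesis by (simp add: algebra_simps)
    qed
    have v: "?v \<in> L" using subspace_diff[OF L y0(2) y(2)] .
    have pc: "piecewise_C1_curve ?M Z (\<lambda>t. pt (?l t))"
      by (rule segment_curve) (use inb r(2) y(2) v in auto)
    have speed: "curve_speed ?M (\<lambda>t. pt (?l t)) t \<le> C * norm ?v" if t: "t \<in> {0..1}" for t
    proof -
      let ?T = "?l -` (\<phi> ` U)"
      have T: "open ?T" by (intro open_vimage open_image continuous_intros)
      have tT: "t \<in> ?T" using inb[OF t] r(2) by blast
      have l: "(?l has_vector_derivative ?v) (at t)"
        by (auto intro!: derivative_eq_intros simp: has_vector_derivative_def)
      have "((\<lambda>s. \<phi> (pt (?l s))) has_vector_derivative ?v) (at t)"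
        by (rule has_vector_derivative_transform_within_open[OF l T tT]) (simp add: chart_pt)
      then have "curve_speed ?M (\<lambda>t. pt (?l t)) t = sqrt (bform (D (\<phi> (pt (?l t))) ?v) (D (\<phi> (pt (?l t))) ?v))"
        by (rule speed_in_chart[OF T tT, rotated]) (simp add: pt_in)
      also have "\<phi> (pt (?l t)) = ?l t" using tT by (simp add: chart_pt)
      also have "sqrt (bform (D (?l t) ?v) (D (?l t) ?v)) \<le> C * norm ?v" by (rule C(2)[OF inb[OF t]])
      finally show ?thesis .
    qed
    have "induced_dist ?M Z (pt y) (pt y0) \<le> curve_length ?M (\<lambda>t. pt (?l t))"
      unfolding induced_dist_def by (rule INF_lower) (simp add: pc)
    also have "\<dots> \<le> (\<integral>\<^sup>+ t. ennreal (C * norm ?v) * indicator {0..1::real} t \<partial>lborel)"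
      unfolding curve_length_def
      by (intro nn_integral_mono) (use speed in \<open>auto simp: indicator_def intro!: ennreal_leI\<close>)
    also have "\<dots> = ennreal (C * norm ?v)"
      by (simp add: nn_integral_cmult_indicator)
    finally show ?thesis .
  qed
  with r(1) show thesis by (rule that)
qed

end

section \<open>Limits of Cauchy sequences\<close>

lemma matrix_entry_polarization:
  fixes A :: "real^'m^'m"
  assumes "transpose A = A"
  shows "A $ i $ j = ((axis i 1 + axis j 1) \<bullet> (A *v (axis i 1 + axis j 1)) -
    axis i 1 \<bullet> (A *v axis i 1) - axis j 1 \<bullet> (A *v axis j 1)) / 2"
proof -
  have e: "axis i 1 \<bullet> (A *v axis j 1) = A $ i $ j" for i j
    by (simp add: inner_axis' matrix_vector_mult_basis column_def)
  have "A $ j $ i = transpose A $ i $ j" by (simp add: transpose_def)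
  then have "A $ j $ i = A $ i $ j" by (simp only: assms)
  then show ?thesis
    by (simp add: matrix_vector_right_distrib inner_add_left inner_add_right e)
qed

lemma Sp_closed:
  assumes "\<And>i. x i \<in> Sp_group" "x \<longlonglongrightarrow> l"
  shows "l \<in> Sp_group"
proof -
  have "(\<lambda>i. x i ** (J ** transpose (x i))) \<longlonglongrightarrow> l ** (J ** transpose l)"
    by (intro bounded_bilinear.tendsto[OF bounded_bilinear_matrix_mult] assms(2)
        bounded_linear.tendsto[OF linear_matrix_mult_left[unfolded linear_conv_bounded_linear]]
        bounded_linear.tendsto[OF linear_transpose[unfolded linear_conv_bounded_linear]])
  moreover have "x i ** (J ** transpose (x i)) = J" for i
    using Sp_groupD[OF assms(1)[of i]] by (simp add: matrix_mul_assoc)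
  ultimately have "(\<lambda>i. J) \<longlonglongrightarrow> l ** (J ** transpose l)" by simp
  then have "l ** (J ** transpose l) = J" using LIMSEQ_unique tendsto_const by blast
  then show ?thesis by (simp add: Sp_group_iff matrix_mul_assoc)
qed

text \<open>The logarithms of all values b^t S b are Cauchy, so these values converge and
  polarization yields the limit matrix \<open>X\<close>. The squared norm of a representative is the
  trace of its Gram matrix, so the representatives are bounded; a subsequence converges in the
  closed group, and its limit represents \<open>X\<close>.\<close>

lemma Cauchy_gram_convergent:
  fixes s :: "nat \<Rightarrow> (real^('n::finite + 'n)^('n + 'n)) set"
  assumes s: "range s \<subseteq> coset U_group ` Sp_group"
    and Cauchy: "\<And>\<epsilon>. \<epsilon> > 0 \<Longrightarrow> \<exists>K. \<forall>i\<ge>K. \<forall>j\<ge>K. induced_dist Sp_mod_U N (s i) (s j) < ennreal \<epsilon>"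
  obtains l where "l \<in> Sp_group" "(\<lambda>i. gram (s i)) \<longlonglongrightarrow> l ** transpose l"
proof -
  define q where "q b i = b \<bullet> (gram (s i) *v b)" for b i
  have "\<forall>i. \<exists>x. x \<in> Sp_group \<and> s i = coset U_group x" using s by blast
  then obtain x where x: "\<And>i. x i \<in> Sp_group" "\<And>i. s i = coset U_group (x i)" by metis
  have G: "gram (s i) = x i ** transpose (x i)" for i by (simp add: x(2) gram_coset)
  have "convergent (q b)" for b
  proof (cases "b = 0")
    case True
    then have "q b = (\<lambda>i. 0)" by (simp add: q_def fun_eq_iff)
    then show ?thesis by (simp add: convergent_const)
  next
    case False
    have pos: "q b i > 0" for i
      unfolding q_def using s by (intro gram_pos False) blast
    have "Cauchy (\<lambda>i. ln (q b i))"
    proof (rule metric_CauchyI)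
      fix e :: real assume e: "e > 0"
      then obtain K where K: "\<And>i j. i \<ge> K \<Longrightarrow> j \<ge> K \<Longrightarrow> induced_dist Sp_mod_U N (s i) (s j) < ennreal (e / 2)"
        using Cauchy[of "e / 2"] by auto
      have "dist (ln (q b i)) (ln (q b j)) < e" if "i \<ge> K" "j \<ge> K" for i j
      proof -
        have "ennreal \<bar>(ln (q b j) - ln (q b i)) / 2\<bar> < ennreal (e / 2)"
          using induced_dist_lower_bound[OF False, of "s j" "s i" N] K[OF that] unfolding q_def
          by (rule le_less_trans)
        then have "\<bar>(ln (q b j) - ln (q b i)) / 2\<bar> < e / 2"
          using e by (simp add: ennreal_less_iff)
        then show ?thesis by (simp add: dist_real_def)
      qed
      then show "\<exists>M. \<forall>m\<ge>M. \<forall>n\<ge>M. dist (ln (q b m)) (ln (q b n)) < e" by blast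
    qed
    then obtain l where "(\<lambda>i. ln (q b i)) \<longlonglongrightarrow> l" using Cauchy_convergent convergent_def by blast
    then have "(\<lambda>i. exp (ln (q b i))) \<longlonglongrightarrow> exp l" by (rule tendsto_exp)
    then have "q b \<longlonglongrightarrow> exp l" using pos by simp
    then show ?thesis by (rule convergentI)
  qed
  then obtain Q where Q: "\<And>b. q b \<longlonglongrightarrow> Q b" unfolding convergent_def by metis
  define X where "X = (\<chi> i j. (Q (axis i 1 + axis j 1) - Q (axis i 1) - Q (axis j 1)) / 2)"
  have GX: "(\<lambda>k. gram (s k)) \<longlonglongrightarrow> X"
  proof (intro vec_tendstoI)
    fix i j
    have "transpose (gram (s k)) = gram (s k)" for k by (simp add: G matrix_transpose_mul)
    from matrix_entry_polarization[OF this]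
    have "gram (s k) $ i $ j = (q (axis i 1 + axis j 1) k - q (axis i 1) k - q (axis j 1) k) / 2" for k
      by (simp add: q_def)
    moreover have "(\<lambda>k. (q (axis i 1 + axis j 1) k - q (axis i 1) k - q (axis j 1) k) / 2) \<longlonglongrightarrow> X $ i $ j"
      unfolding X_def vec_lambda_beta by (intro tendsto_intros Q) simp
    ultimately show "(\<lambda>k. gram (s k) $ i $ j) \<longlonglongrightarrow> X $ i $ j" by (simp only:)
  qed
  have "(\<lambda>k. trace (gram (s k))) \<longlonglongrightarrow> trace X"
    by (rule bounded_linear.tendsto[OF linear_trace[unfolded linear_conv_bounded_linear] GX])
  then have "Bseq (\<lambda>k. trace (gram (s k)))" using convergentI convergent_imp_Bseq by blast
  then obtain B where B: "\<And>k. norm (trace (gram (s k))) \<le> B" unfolding Bseq_def by blast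
  have "norm (x k) \<le> sqrt B" for k
  proof -
    have "x k \<bullet> x k \<le> B" using B[of k] by (simp add: inner_matrix G)
    then show ?thesis by (simp add: norm_eq_sqrt_inner)
  qed
  then have "bounded (range x)" by (auto simp: bounded_iff)
  then obtain l r where r: "strict_mono (r :: nat \<Rightarrow> nat)" "(x \<circ> r) \<longlonglongrightarrow> l"
    using bounded_imp_convergent_subsequence by blast
  have l: "l \<in> Sp_group" using Sp_closed[OF _ r(2)] x(1) by simp
  have "(\<lambda>k. (x \<circ> r) k ** transpose ((x \<circ> r) k)) \<longlonglongrightarrow> l ** transpose l"
    by (intro bounded_bilinear.tendsto[OF bounded_bilinear_matrix_mult] r(2)
        bounded_linear.tendsto[OF linear_transpose[unfolded linear_conv_bounded_linear]])
  moreover have "(\<lambda>k. (x \<circ> r) k ** transpose ((x \<circ> r) k)) \<longlonglongrightarrow> X"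
    using LIMSEQ_subseq_LIMSEQ[OF GX r(1)] by (simp add: o_def G)
  ultimately have "l ** transpose l = X" by (rule LIMSEQ_unique)
  with l GX show thesis by (intro that[of l]) simp_all
qed

theorem zero_locus_complete:
  fixes a1 a2 :: "real^('n::finite + 'n)"
  assumes a1: "a1 \<noteq> 0"
  shows "complete_in Sp_mod_U (zero_locus a1 a2)"
  unfolding complete_in_def
proof (intro allI impI, elim conjE)
  let ?N = "zero_locus a1 a2"
  let ?M = "coset U_group ` (Sp_group :: (real^('n + 'n)^('n + 'n)) set)"
  fix s :: "nat \<Rightarrow> (real^('n + 'n)^('n + 'n)) set"
  assume s: "range s \<subseteq> ?N"
    and Cauchy: "\<forall>\<epsilon>>0. \<exists>K. \<forall>i\<ge>K. \<forall>j\<ge>K. induced_dist Sp_mod_U ?N (s i) (s j) < ennreal \<epsilon>"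
  have sM: "s i \<in> ?M" "locus_re a1 a2 (gram (s i)) = 0" "locus_im a1 a2 (gram (s i)) = 0" for i
    using s by (auto simp: zero_locus_def)
  obtain l where l: "l \<in> Sp_group" "(\<lambda>i. gram (s i)) \<longlonglongrightarrow> l ** transpose l"
  proof (rule Cauchy_gram_convergent[of s ?N])
    show "range s \<subseteq> ?M" using sM by blast
  qed (use Cauchy in blast)+
  define p where "p = coset U_group l"
  have "(\<lambda>i. locus_re a1 a2 (gram (s i))) \<longlonglongrightarrow> locus_re a1 a2 (gram p)"
    "(\<lambda>i. locus_im a1 a2 (gram (s i))) \<longlonglongrightarrow> locus_im a1 a2 (gram p)"
    unfolding p_def gram_coset
    by (rule bounded_linear.tendsto[OF linear_locus(1)[unfolded linear_conv_bounded_linear] l(2)])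
      (rule bounded_linear.tendsto[OF linear_locus(2)[unfolded linear_conv_bounded_linear] l(2)])
  then have "locus_re a1 a2 (gram p) = 0" "locus_im a1 a2 (gram p) = 0"
    by (simp_all add: sM LIMSEQ_const_iff)
  then have pN: "p \<in> ?N" using l(1) by (simp add: zero_locus_def p_def)
  then have pM: "p \<in> ?M" by (simp add: zero_locus_def)
  have lin: "linear (\<lambda>M. to_coords (proj_p M))"
    using linear_compose[OF linear_proj_p linear_to_coords] by (simp add: o_def)
  have psi_lim: "(\<lambda>i. psi (s i)) \<longlonglongrightarrow> psi p"
    unfolding psi_def p_def gram_coset
    by (rule bounded_linear.tendsto[OF lin[unfolded linear_conv_bounded_linear] l(2)])
  interpret glob: zero_locus_chart ?M psi a1 a2
    by unfold_locales (simp_all add: global_chart a1)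
  obtain c L where c: "slice_chart (coset_space Sp_group U_group :: (_, real^('n \<times> 'n option)) riemannian) ?N c L"
    "p \<in> fst c"
    using glob.slice_exists[OF pM pN] by blast
  obtain U \<phi> where c': "c = (U, \<phi>)" by (cases c)
  have at: "(U, \<phi>) \<in> quotient_atlas Sp_group U_group"
    using c(1) by (simp add: c' slice_chart_def coset_space_def)
  interpret sl: slice U \<phi> a1 a2 L
    by unfold_locales (use at a1 c(1) c' in simp_all)
  have pU: "p \<in> U" using c(2) c' by simp
  \<comment> \<open>Convergence is known in the global chart only. The transition map, defined on
    \<open>?A\<close>, carries it to the slice chart around \<open>p\<close>, whose domain contains
    all but finitely many terms.\<close>
  let ?A = "{z \<in> psi ` ?M. glob.pt z \<in> U}"
  let ?\<tau> = "\<lambda>z. \<phi> (glob.pt z)"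
  have pA: "psi p \<in> ?A" using pM pU by (simp add: glob.pt_chart)
  have ev: "eventually (\<lambda>i. psi (s i) \<in> ?A) sequentially"
    using topological_tendstoD[OF psi_lim glob.transition(1)[OF at] pA] .
  have sU: "s i \<in> U" if "psi (s i) \<in> ?A" for i
    using that glob.pt_chart[OF sM(1)] by simp
  have "isCont ?\<tau> (psi p)"
    using smooth_on_continuous[OF glob.transition(2)[OF at]] glob.transition(1)[OF at] pA
    by (simp only: continuous_on_eq_continuous_at)
  from isCont_tendsto_compose[OF this psi_lim]
  have phi_lim: "(\<lambda>i. \<phi> (s i)) \<longlonglongrightarrow> \<phi> p"
    by (simp only: glob.pt_chart[OF sM(1)] glob.pt_chart[OF pM])
  have inL: "\<phi> C \<in> L" if "C \<in> U" "C \<in> ?N" for C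
    using c(1) that by (auto simp: c' slice_chart_def)
  obtain r C where r: "r > 0" and C: "\<And>y. y \<in> cball (\<phi> p) r \<Longrightarrow> y \<in> L \<Longrightarrow>
    induced_dist (coset_space Sp_group U_group :: (_, real^('n \<times> 'n option)) riemannian) ?N
      (sl.pt y) (sl.pt (\<phi> p)) \<le> ennreal (C * norm (\<phi> p - y))"
    using sl.induced_dist_upper_bound[OF imageI[OF pU] inL[OF pU pN]] by blast
  have "eventually (\<lambda>i. \<phi> (s i) \<in> ball (\<phi> p) r) sequentially"
    using topological_tendstoD[OF phi_lim open_ball, of "\<phi> p" r] r by simp
  with ev have up: "eventually (\<lambda>i. induced_dist Sp_mod_U ?N (s i) p \<le> ennreal (C * norm (\<phi> p - \<phi> (s i)))) sequentially"
  proof eventually_elim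
    case (elim i)
    have U: "s i \<in> U" using sU[OF elim(1)] .
    have "s i \<in> ?N" using s by blast
    then have "\<phi> (s i) \<in> L" using inL U by blast
    moreover have "\<phi> (s i) \<in> cball (\<phi> p) r" using elim(2) by simp
    ultimately show ?case
      using C[of "\<phi> (s i)"] by (simp add: sl.pt_chart U pU Sp_mod_U_def)
  qed
  have "(\<lambda>i. ennreal (C * norm (\<phi> p - \<phi> (s i)))) \<longlonglongrightarrow> ennreal (C * norm (\<phi> p - \<phi> p))"
    by (intro tendsto_ennrealI tendsto_intros phi_lim)
  then have lim: "(\<lambda>i. ennreal (C * norm (\<phi> p - \<phi> (s i)))) \<longlonglongrightarrow> 0"
    by (simp only: diff_self norm_zero mult_zero_right ennreal_0)
  have "(\<lambda>i. induced_dist Sp_mod_U ?N (s i) p) \<longlonglongrightarrow> 0"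
    by (rule tendsto_sandwich[OF _ up tendsto_const lim]) simp
  with pN show "\<exists>p\<in>?N. (\<lambda>i. induced_dist Sp_mod_U ?N (s i) p) \<longlonglongrightarrow> 0" by blast
qed

section \<open>Minimality and codimension, transferred from charts to the whole locus\<close>

theorem zero_locus_minimal:
  fixes a1 a2 :: "real^('n::finite + 'n)"
  assumes a1: "a1 \<noteq> 0"
  shows "minimal_in Sp_mod_U (zero_locus a1 a2)"
  unfolding minimal_in_def
proof (intro allI impI ballI)
  fix c :: "((real^('n + 'n)^('n + 'n)) set, real^('n \<times> 'n option)) chart" and L p
  assume c: "slice_chart Sp_mod_U (zero_locus a1 a2) c L" and p: "p \<in> fst c \<inter> zero_locus a1 a2"
  obtain U \<phi> where c': "c = (U, \<phi>)" by (cases c)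
  interpret slice U \<phi> a1 a2 L
    by unfold_locales (use c a1 c' in \<open>simp_all add: Sp_mod_U_def slice_chart_def coset_space_def\<close>)
  have "\<phi> p \<in> \<phi> ` U" "\<phi> p \<in> L"
    using c p by (auto simp: c' slice_chart_def)
  then show "mean_curvature (metric Sp_mod_U c) L (snd c p) = 0"
    using mean_curvature_0 by (simp add: c' Sp_mod_U_def coset_space_def)
qed

theorem zero_locus_submanifold:
  fixes a1 a2 :: "real^('n::finite + 'n)"
  assumes "CARD('n) \<ge> 2" and a1: "a1 \<noteq> 0" and "\<And>s. a2 \<noteq> s *\<^sub>R a1"
  shows "submanifold_of_codim (Sp_mod_U :: (_, real^('n \<times> 'n option)) riemannian) (zero_locus a1 a2) 2"
  unfolding submanifold_of_codim_def
proof (intro conjI ballI)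
  let ?M = "coset U_group ` (Sp_group :: (real^('n + 'n)^('n + 'n)) set)"
  show "zero_locus a1 a2 \<noteq> {}" by (rule zero_locus_nonempty[OF assms])
  show "zero_locus a1 a2 \<subseteq> topspace (mtop (Sp_mod_U :: (_, real^('n \<times> 'n option)) riemannian))"
    by (auto simp: zero_locus_def Sp_mod_U_def coset_space_def topspace_quotient_topology)
  fix p assume p: "p \<in> zero_locus a1 a2"
  then have pM: "p \<in> ?M" by (simp add: zero_locus_def)
  interpret zero_locus_chart ?M psi a1 a2
    by unfold_locales (simp_all add: global_chart a1)
  obtain c L where "slice_chart (coset_space Sp_group U_group :: (_, real^('n \<times> 'n option)) riemannian) (zero_locus a1 a2) c L"
    "p \<in> fst c" "dim L + 2 = CARD('n \<times> 'n option)"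
    using slice_exists[OF pM p] by blast
  then show "\<exists>c L. slice_chart Sp_mod_U (zero_locus a1 a2) c L \<and> p \<in> fst c \<and>
      dim L + 2 = DIM(real^('n \<times> 'n option))"
    unfolding Sp_mod_U_def by (intro exI[of _ c] exI[of _ L]) simp
qed

theorem theorem2p2:
  fixes a1 a2 :: "real^('n::finite + 'n)" and a :: "complex^('n + 'n)"
  assumes "CARD('n) \<ge> 2"
    and "a = (\<chi> i. complex_of_real (a1 $ i) + \<i> * complex_of_real (a2 $ i))"
    and "a1 \<noteq> a2" and "independent {a1, a2}"
  shows "complete_minimal_submanifold Sp_mod_U
           {p \<in> topspace (mtop Sp_mod_U). phi a p = 0} 2"
proof -
  have a1: "a1 \<noteq> 0" using assms(4) dependent_zero by blast
  \<comment> \<open>As \<open>a1 \<noteq> a2\<close>, the set has two elements, so its independence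
    is that of the pair of vectors.\<close>
  have "a2 \<notin> span {a1}"
    using assms(3,4) independent_insert[of a2 "{a1}"] by (auto simp: insert_commute)
  then have a2: "a2 \<noteq> s *\<^sub>R a1" for s by (auto simp: span_singleton)
  have "{p \<in> topspace (mtop Sp_mod_U). phi a p = 0} = zero_locus a1 a2"
    by (auto simp: zero_locus_def Sp_mod_U_def coset_space_def topspace_quotient_topology
        phi_eq_0_iff[OF assms(2)] gram_coset)
  then show ?thesis
    unfolding complete_minimal_submanifold_def
    using zero_locus_submanifold[OF assms(1) a1 a2] zero_locus_minimal[OF a1] zero_locus_complete[OF a1]
    by simp
qed

end
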